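(* Consider two single-server FIFO queues in tandem with i.i.d. interarrival times of mean $a$ and service times $\{\sigma_n^{(i)}\}$ of mean $b^{(i)}$ at station $i=1,2$, as specified in the context, with $\max(b^{(1)},b^{(2)})<a$. Assume $\mathbf{P}(\sigma^{(i)}>x)\sim d^{(i)}\overline{F}(x)$ as $x\to\infty$, $i=1,2$, with $d^{(i)}\ge0$, $d^{(1)}+d^{(2)}>0$, where both $F$ and $F^s$ are subexponential. Assume $b^{(1)}<b^{(2)}$. Then, as $x\to\infty$, the stationary waiting time $W^{(2)}$ at the second queue satisfies $$\mathbf{P}(W^{(2)}>x)=\frac{d^{(2)}}{a-b^{(2)}}\overline{F}^s(x)+\frac{d^{(1)}}{a-b^{(2)}}\overline{F}^s\Bigl(x\,\frac{a-b^{(1)}}{b^{(2)}-b^{(1)}}\Bigr)+o(\overline{F}^s(x)).$$ In particular, if either (i) $d^{(2)}>0$, or (ii) $d^{(2)}=0$, $d^{(1)}>0$ and $\liminf_{x\to\infty}\overline{F}^s(2x)/\overline{F}^s(x)>0$, then $$\mathbf{P}(W^{(2)}>x)\sim\frac{d^{(2)}}{a-b^{(2)}}\overline{F}^s(x)+\frac{d^{(1)}}{a-b^{(2)}}\overline{F}^s\Bigl(x\,\frac{a-b^{(1)}}{b^{(2)}-b^{(1)}}\Bigr).$$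
   Context: For $c>0$, $f\sim cg$ means $f(x)/g(x)\to c$ as $x\to\infty$; $f\sim cg$ with $c=0$ means $f(x)=o(g(x))$. $F$ is a distribution function on $\mathbb{R}^+$ with finite mean, $\overline{F}=1-F$, and $F^s$ is the integrated tail distribution, with tail $\overline{F}^s(x)=\min\{1,\int_x^\infty\overline{F}(u)\,du\}$. Tandem queue: customer $n\in\mathbb{Z}$ arrives at station 1 at time $T_n$, $\tau_n=T_{n+1}-T_n\ge 0$. The sequences $\{\tau_n\}$, $\{\sigma_n^{(1)}\}$, $\{\sigma_n^{(2)}\}$ are mutually independent, and each consists of i.i.d. nonnegative random variables with means $a$, $b^{(1)}$, $b^{(2)}$. Customers are served in order of arrival at station 1, then at station 2, by a single server at each station. The stationary waiting time of customer $n$ at station 1 is $W_n^{(1)}=\sup_{k\ge0}\sum_{i=1}^k(\sigma_{n-i}^{(1)}-\tau_{n-i})$; the time between the arrivals of customers $n$ and $n+1$ at station 2 is $\tau_n^{(2)}=-\min(0,W_n^{(1)}+\sigma_n^{(1)}-\tau_n)+\sigma_{n+1}^{(1)}$; and the stationary waiting time of customer $0$ at station 2 is $W^{(2)}=W_0^{(2)}=\sup_{k\ge0}\sum_{i=1}^k(\sigma_{-i}^{(2)}-\tau_{-i}^{(2)})$. *)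

theory Defs
  imports "HOL-Probability.Probability" "HOL-Library.Landau_Symbols"
begin

definition nonneg_distribution_function :: "(real \<Rightarrow> real) \<Rightarrow> bool" where
  "nonneg_distribution_function F \<longleftrightarrow>
     mono F \<and> (\<forall>x. continuous (at_right x) F) \<and> (\<forall>x<0. F x = 0) \<and> (F \<longlongrightarrow> 1) at_top"

definition tail :: "(real \<Rightarrow> real) \<Rightarrow> real \<Rightarrow> real" where
  "tail F x = 1 - F x"

text \<open>The limit forces the tail of \<open>F\<close> to be positive everywhere: where it vanishes, the quotient
  is \<open>0\<close> by the convention for division by zero.\<close>

definition subexponential :: "(real \<Rightarrow> real) \<Rightarrow> bool" where
  "subexponential F \<longleftrightarrow> nonneg_distribution_function F \<and>
     ((\<lambda>x. measure (interval_measure F \<star> interval_measure F) {x<..} / tail F x) \<longlongrightarrow> 2) at_top"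

text \<open>The case distinction makes this a distribution function on the nonnegative half-line: if the
  mean of \<open>F\<close> is below \<open>1\<close>, the formula used for \<open>x \<ge> 0\<close> would give mass to negative numbers,
  and that mass is put at \<open>0\<close> instead.\<close>

definition integrated_tail_df :: "(real \<Rightarrow> real) \<Rightarrow> real \<Rightarrow> real" where
  "integrated_tail_df F x =
     (if x < 0 then 0 else 1 - min 1 (LBINT u:{x..}. tail F u))"

text \<open>The relation \<open>f \<sim> c g\<close> at infinity, where \<open>c = 0\<close> is read as \<open>f = o(g)\<close>.\<close>

definition asymp_proportional :: "(real \<Rightarrow> real) \<Rightarrow> real \<Rightarrow> (real \<Rightarrow> real) \<Rightarrow> bool" where
  "asymp_proportional f c g \<longleftrightarrow>
     (if c = 0 then f \<in> o[at_top](g) else ((\<lambda>x. f x / g x) \<longlongrightarrow> c) at_top)"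

definition (in prob_space) iid_with_mean :: "(int \<Rightarrow> 'a \<Rightarrow> real) \<Rightarrow> real \<Rightarrow> bool" where
  "iid_with_mean X m \<longleftrightarrow>
     indep_vars (\<lambda>_. borel) X UNIV \<and>
     (\<forall>n. distr M borel (X n) = distr M borel (X 0)) \<and>
     (\<forall>n. integrable M (X n) \<and> expectation (X n) = m)"

text \<open>\<open>\<tau> n\<close> is the time between the arrivals of customers \<open>n\<close> and \<open>n + 1\<close> at station 1,
  \<open>\<sigma> i n\<close> is the service time of customer \<open>n\<close> at station \<open>i\<close>; only \<open>i = 1\<close> and \<open>i = 2\<close> matter.
  In the last assumption, the three sequences are three random elements of the product space
  of real sequences indexed by the integers; index \<open>0\<close> stands for the interarrival times.\<close>

locale tandem_queue = prob_space M
  for M :: "'w measure" +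
  fixes \<tau> :: "int \<Rightarrow> 'w \<Rightarrow> real"
    and \<sigma> :: "nat \<Rightarrow> int \<Rightarrow> 'w \<Rightarrow> real"
    and a :: real
    and b :: "nat \<Rightarrow> real"
  assumes iid_interarrival: "iid_with_mean \<tau> a"
    and iid_service: "\<And>i. i \<in> {1, 2} \<Longrightarrow> iid_with_mean (\<sigma> i) (b i)"
    and nonneg_interarrival: "\<And>n. AE \<omega> in M. 0 \<le> \<tau> n \<omega>"
    and nonneg_service: "\<And>i n. i \<in> {1, 2} \<Longrightarrow> AE \<omega> in M. 0 \<le> \<sigma> i n \<omega>"
    and indep_sequences:
      "indep_vars (\<lambda>_. \<Pi>\<^sub>M n\<in>(UNIV :: int set). borel)
         (\<lambda>j \<omega> n. if j = 0 then \<tau> n \<omega> else \<sigma> j n \<omega>) {0, 1, 2}"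

text \<open>The suprema are taken in the extended reals, so no finiteness has to be assumed. The values
  of \<open>interarrival2\<close> are finite for every outcome, since \<open>waiting1 \<ge> 0\<close>.\<close>

definition waiting1 ::
    "(int \<Rightarrow> 'w \<Rightarrow> real) \<Rightarrow> (nat \<Rightarrow> int \<Rightarrow> 'w \<Rightarrow> real) \<Rightarrow> int \<Rightarrow> 'w \<Rightarrow> ereal" where
  "waiting1 \<tau> \<sigma> n \<omega> =
     (SUP k :: nat. ereal (\<Sum>i=1..k. \<sigma> 1 (n - int i) \<omega> - \<tau> (n - int i) \<omega>))"

definition interarrival2 ::
    "(int \<Rightarrow> 'w \<Rightarrow> real) \<Rightarrow> (nat \<Rightarrow> int \<Rightarrow> 'w \<Rightarrow> real) \<Rightarrow> int \<Rightarrow> 'w \<Rightarrow> ereal" where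
  "interarrival2 \<tau> \<sigma> n \<omega> =
     - min 0 (waiting1 \<tau> \<sigma> n \<omega> + ereal (\<sigma> 1 n \<omega>) - ereal (\<tau> n \<omega>)) + ereal (\<sigma> 1 (n + 1) \<omega>)"

definition waiting2 ::
    "(int \<Rightarrow> 'w \<Rightarrow> real) \<Rightarrow> (nat \<Rightarrow> int \<Rightarrow> 'w \<Rightarrow> real) \<Rightarrow> 'w \<Rightarrow> ereal" where
  "waiting2 \<tau> \<sigma> \<omega> =
     (SUP k :: nat. \<Sum>i=1..k. ereal (\<sigma> 2 (- int i) \<omega>) - interarrival2 \<tau> \<sigma> (- int i) \<omega>)"

end

theory Submission
  imports Defs "HOL-Real_Asymp.Real_Asymp"
begin

text \<open>Summing the interarrival times at station 2 bounds the waiting time there by the supremum of the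
  dater, the value of a path that serves customers at station 2 up to some customer and at station 1
  from there on. The dater drifts to \<open>-\<infinity>\<close> with speed \<open>a - b 2\<close>, so that it leaves a linear
  barrier only by a big service time. Restarting it after the first passage over the barrier gives a
  renewal inequality for the tail of its supremum, which bounds that tail by a multiple of the
  integrated tail of \<open>F\<close> and then shows that a single big service time is needed. At
  station 2 it contributes through the drift alone. At station 1, for customer \<open>-j\<close>, it lets the
  queue at station 2 grow only by \<open>b 2 - b 1\<close> per customer, so that it matters only if
  \<open>j > x / (b 2 - b 1)\<close>; this is the source of the factor \<open>(a - b 1) / (b 2 - b 1)\<close>.\<close>

subsection \<open>Subexponential tails\<close>

text \<open>The interarrival times at station 2 depend on the whole past of station 1, so the theory
  of a single queue with i.i.d. input does not apply. The dater has the right order but the wrong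
  constant: it charges a big service time at station 1 in full wherever it occurs. It therefore only
  excludes paths without a big jump; given the jump, the waiting time itself is examined. Customer
  \<open>-j\<close> needs a service time of about \<open>x + j (a - b 2)\<close>, because the excess
  drains at speed \<open>a - b 2\<close> until customer \<open>0\<close>. Summing tails over
  \<open>j\<close> gives the integrated tail with factor \<open>1 / (a - b 2)\<close>; at station 1
  the sum starts at \<open>j = x / (b 2 - b 1)\<close>, where the level is
  \<open>x (a - b 1) / (b 2 - b 1)\<close>. The two subexponentiality assumptions serve different
  purposes: that of \<open>F\<close> excludes that both service times of one customer are big, that
  of its integrated tail excludes big jumps at two different times. The law of large numbers enters
  only as almost sure boundedness of walks with negative drift, for which the mean suffices.\<close>

lemma measure_Times:
  assumes "prob_space M1" "prob_space M2" "A \<in> sets M1" "B \<in> sets M2"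
  shows "measure (M1 \<Otimes>\<^sub>M M2) (A \<times> B) = measure M1 A * measure M2 B"
proof -
  interpret M2: prob_space M2 by fact
  show ?thesis
    using assms(3,4) by (simp add: measure_def M2.emeasure_pair_measure_Times enn2real_mult)
qed

lemma (in finite_measure) measure_disjoint3_le:
  assumes "A \<in> sets M" "B \<in> sets M" "C \<in> sets M" "D \<in> sets M"
    and "A \<inter> B = {}" "(A \<union> B) \<inter> C = {}" "A \<union> B \<union> C \<subseteq> D"
  shows "measure M A + measure M B + measure M C \<le> measure M D"
proof -
  have "measure M A + measure M B + measure M C = measure M (A \<union> B \<union> C)"
    using assms by (simp add: finite_measure_Union)
  also have "\<dots> \<le> measure M D"
    using assms by (intro finite_measure_mono) auto
  finally show ?thesis .
qed

lemma eventually_at_top_minus: "eventually P at_top \<Longrightarrow> eventually (\<lambda>x::real. P (x - k)) at_top"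
  by (rule eventually_compose_filterlim[of P at_top]) (assumption, real_asymp)

lemma eventually_scale: "0 < k \<Longrightarrow> eventually P at_top \<Longrightarrow> eventually (\<lambda>x::real. P (k * x)) at_top"
  by (rule eventually_compose_filterlim[of P at_top]) (assumption, real_asymp)

lemma suminf_if_ge:
  fixes v :: "nat \<Rightarrow> real"
  assumes "summable v"
  shows "summable (\<lambda>i. if i < n then 0 else v i)" "(\<Sum>i. if i < n then 0 else v i) = (\<Sum>i. v (i + n))"
proof -
  let ?u = "\<lambda>i. if i < n then 0 else v i"
  have 1: "summable (\<lambda>i. ?u (i + n))" using summable_ignore_initial_segment[OF assms, of n] by simp
  then show "summable ?u" by (rule summable_iff_shift[THEN iffD1])
  from suminf_split_initial_segment[OF this, of n] show "(\<Sum>i. ?u i) = (\<Sum>i. v (i + n))" by simp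
qed

text \<open>Serves to choose the slack parameter in the final bounds: all errors are collected in
  one function of it that vanishes at \<open>0\<close> from the right.\<close>

lemma limit_at_right_0:
  fixes f :: "real \<Rightarrow> real"
  assumes "(f \<longlongrightarrow> 0) (at_right 0)" "0 < \<eta>" "0 < u"
  obtains e where "0 < e" "e < u" "f e < \<eta>"
proof -
  have "eventually (\<lambda>e. f e < \<eta> \<and> e < u \<and> 0 < e) (at_right 0)"
    using order_tendstoD(2)[OF assms(1,2)] eventually_at_right_less[of 0]
      order_tendstoD(2)[OF tendsto_ident_at, of 0 u "{0<..}"] assms(3)
    by (auto elim: eventually_elim2 simp: eventually_conj_iff)
  then show ?thesis using that eventually_happens[of _ "at_right (0::real)"] by force
qed

text \<open>The part of the event \<open>x < fst p + snd p\<close> that a single big summand does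
  not explain. For large \<open>K\<close> it has only a small share of the tail at \<open>x\<close>;
  this is the main form in which subexponentiality is used.\<close>

abbreviation both_large :: "real \<Rightarrow> real \<Rightarrow> (real \<times> real) set" where
  "both_large K x \<equiv> {p. K < fst p \<and> K < snd p \<and> x < fst p + snd p}"

lemma both_large_sets:
  fixes \<alpha> \<beta> :: "real measure"
  assumes "sets \<alpha> = sets borel" "sets \<beta> = sets borel"
  shows "(both_large K x) \<in> sets (\<alpha> \<Otimes>\<^sub>M \<beta>)"
proof -
  have sets: "sets (\<alpha> \<Otimes>\<^sub>M \<beta>) = sets (borel \<Otimes>\<^sub>M borel)"
    using assms by (intro sets_pair_measure_cong)
  have "Measurable.pred (borel \<Otimes>\<^sub>M borel) (\<lambda>p::real \<times> real. K < fst p \<and> K < snd p \<and> x < fst p + snd p)"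
    by measurable
  then show ?thesis by (simp add: pred_def space_pair_measure sets)
qed

lemma emeasure_both_large:
  fixes \<alpha> \<beta> :: "real measure"
  assumes "prob_space \<beta>" "sets \<alpha> = sets borel" "sets \<beta> = sets borel"
  shows "emeasure (\<alpha> \<Otimes>\<^sub>M \<beta>) (both_large K x) =
    (\<integral>\<^sup>+u. indicator {K<..} u * emeasure \<beta> {max K (x - u)<..} \<partial>\<alpha>)"
proof -
  interpret prob_space \<beta> by fact
  show ?thesis
    unfolding emeasure_pair_measure_alt[OF both_large_sets[OF assms(2,3)]]
    by (intro nn_integral_cong) (auto split: split_indicator intro!: arg_cong[where f="emeasure \<beta>"])
qed

text \<open>Given the first coordinate \<open>u\<close>, the second one must exceed
  \<open>max K (x - u)\<close>, a level of at least \<open>K\<close>. So the second law enters only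
  through its tail from \<open>K\<close> on, and an estimate for one law transfers to all laws with
  comparable tails.\<close>

lemma both_large_tail_mono:
  fixes \<alpha> \<beta> \<beta>' :: "real measure"
  assumes "prob_space \<alpha>" "prob_space \<beta>" "prob_space \<beta>'"
    and sets: "sets \<alpha> = sets borel" "sets \<beta> = sets borel" "sets \<beta>' = sets borel"
    and C: "0 \<le> C" and tail: "\<And>y. K \<le> y \<Longrightarrow> measure \<beta> {y<..} \<le> C * measure \<beta>' {y<..}"
  shows "measure (\<alpha> \<Otimes>\<^sub>M \<beta>) (both_large K x) \<le>
    C * measure (\<alpha> \<Otimes>\<^sub>M \<beta>') (both_large K x)"
    (is "measure ?P ?A \<le> C * measure ?P' ?A")
proof -
  interpret \<alpha>: prob_space \<alpha> by fact
  interpret \<beta>: prob_space \<beta> by fact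
  interpret \<beta>': prob_space \<beta>' by fact
  interpret P: pair_prob_space \<alpha> \<beta> ..
  interpret P': pair_prob_space \<alpha> \<beta>' ..
  have [measurable]: "(\<lambda>u. emeasure \<beta>' {max K (x - u)<..}) \<in> borel_measurable \<alpha>"
  proof -
    have "antimono (\<lambda>y. measure \<beta>' {y<..})"
      using sets by (intro antimonoI \<beta>'.finite_measure_mono) auto
    then have "(\<lambda>y. measure \<beta>' {y<..}) \<in> borel_measurable borel"
      using borel_measurable_mono[of "\<lambda>y. - measure \<beta>' {y<..}"] by (simp add: monotone_def)
    then have "(\<lambda>y. emeasure \<beta>' {y<..}) \<in> borel_measurable borel"
      unfolding \<beta>'.emeasure_eq_measure by measurable
    then have "(\<lambda>u. emeasure \<beta>' {max K (x - u)<..}) \<in> borel_measurable borel"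
      by (rule measurable_compose[rotated]) measurable
    then show ?thesis using sets by (simp cong: measurable_cong_sets)
  qed
  have "emeasure ?P ?A = (\<integral>\<^sup>+u. indicator {K<..} u * emeasure \<beta> {max K (x - u)<..} \<partial>\<alpha>)"
    using assms(2) sets(1,2) by (rule emeasure_both_large)
  also have "\<dots> \<le> (\<integral>\<^sup>+u. ennreal C * (indicator {K<..} u * emeasure \<beta>' {max K (x - u)<..}) \<partial>\<alpha>)"
  proof (intro nn_integral_mono)
    fix u
    have "emeasure \<beta> {max K (x - u)<..} \<le> ennreal C * emeasure \<beta>' {max K (x - u)<..}"
      using tail[of "max K (x - u)"] C
      by (simp add: \<beta>.emeasure_eq_measure \<beta>'.emeasure_eq_measure ennreal_mult[symmetric] ennreal_leI)
    then show "indicator {K<..} u * emeasure \<beta> {max K (x - u)<..} \<le>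
        ennreal C * (indicator {K<..} u * emeasure \<beta>' {max K (x - u)<..})"
      by (auto split: split_indicator)
  qed
  also have "\<dots> = ennreal C * (\<integral>\<^sup>+u. (indicator {K<..} u * emeasure \<beta>' {max K (x - u)<..}) \<partial>\<alpha>)"
    using sets by (intro nn_integral_cmult) auto
  also have "\<dots> = ennreal C * emeasure ?P' ?A"
    using emeasure_both_large[OF assms(3) sets(1,3)] by simp
  finally show ?thesis
    using C by (simp add: P.emeasure_eq_measure P'.emeasure_eq_measure ennreal_mult[symmetric])
qed

lemma both_large_swap:
  fixes \<alpha> \<beta> :: "real measure"
  assumes "prob_space \<alpha>" "prob_space \<beta>" "sets \<alpha> = sets borel" "sets \<beta> = sets borel"
  shows "measure (\<alpha> \<Otimes>\<^sub>M \<beta>) (both_large K x) =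
    measure (\<beta> \<Otimes>\<^sub>M \<alpha>) (both_large K x)"
proof -
  interpret \<alpha>: prob_space \<alpha> by fact
  interpret \<beta>: prob_space \<beta> by fact
  interpret P: pair_prob_space \<alpha> \<beta> ..
  have sp: "space \<alpha> = UNIV" "space \<beta> = UNIV"
    using assms(3,4)[THEN sets_eq_imp_space_eq] by auto
  have "measure (\<alpha> \<Otimes>\<^sub>M \<beta>) (both_large K x) =
    measure (distr (\<beta> \<Otimes>\<^sub>M \<alpha>) (\<alpha> \<Otimes>\<^sub>M \<beta>) (\<lambda>(x, y). (y, x))) (both_large K x)"
    using P.distr_pair_swap by simp
  also have "\<dots> = measure (\<beta> \<Otimes>\<^sub>M \<alpha>) (both_large K x)"
    using assms by (subst measure_distr)
      (auto intro!: arg_cong[where f="measure (\<beta> \<Otimes>\<^sub>M \<alpha>)"] both_large_sets simp: space_pair_measure sp add.commute)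
  finally show ?thesis .
qed

lemma nonneg_dfD:
  assumes "nonneg_distribution_function H"
  shows nonneg_df_mono: "x \<le> y \<Longrightarrow> H x \<le> H y"
    and nonneg_df_neg: "x < 0 \<Longrightarrow> H x = 0"
    and nonneg_df_nonneg: "0 \<le> H x"
    and nonneg_df_le_1: "H x \<le> 1"
    and nonneg_df_real_distribution: "real_distribution (interval_measure H)"
    and nonneg_df_measure_atMost: "measure (interval_measure H) {..x} = H x"
    and tail_tendsto_0: "(tail H \<longlongrightarrow> 0) at_top"
proof -
  have mono: "mono H" and rc: "\<And>x. continuous (at_right x) H"
    and neg: "\<And>x. x < 0 \<Longrightarrow> H x = 0" and lim: "(H \<longlongrightarrow> 1) at_top"
    using assms by (auto simp: nonneg_distribution_function_def)
  show mono': "x \<le> y \<Longrightarrow> H x \<le> H y" for x y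
    using mono by (rule monoD)
  show "x < 0 \<Longrightarrow> H x = 0" by (rule neg)
  have "H (min x (-1)) \<le> H x" by (rule mono') simp
  then show "0 \<le> H x" using neg[of "min x (-1)"] by simp
  show "H x \<le> 1"
    by (rule tendsto_lowerbound[OF lim]) (auto simp: eventually_at_top_linorder intro!: exI[of _ x] mono')
  have bot: "(H \<longlongrightarrow> 0) at_bot"
    by (rule tendsto_eventually) (auto simp: eventually_at_bot_dense intro!: exI[of _ 0] neg)
  show "real_distribution (interval_measure H)"
    using mono' rc bot lim by (rule real_distribution_interval_measure)
  show "measure (interval_measure H) {..x} = H x"
    using mono' rc bot by (rule measure_interval_measure_Iic)
  show "(tail H \<longlongrightarrow> 0) at_top"
    unfolding tail_def using tendsto_diff[OF tendsto_const lim, of 1] by simp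
qed

lemma tail_antimono: "nonneg_distribution_function H \<Longrightarrow> x \<le> y \<Longrightarrow> tail H y \<le> tail H x"
  by (simp add: tail_def nonneg_df_mono)

lemma tail_nonneg: "nonneg_distribution_function H \<Longrightarrow> 0 \<le> tail H x"
  by (simp add: tail_def nonneg_df_le_1)

lemma measure_greaterThan_eq_tail:
  assumes "nonneg_distribution_function H"
  shows "measure (interval_measure H) {x<..} = tail H x"
proof -
  interpret real_distribution "interval_measure H"
    by (rule nonneg_df_real_distribution[OF assms])
  have "{x<..} = space (interval_measure H) - {..x}" by auto
  then show ?thesis
    using prob_compl[of "{..x}"] nonneg_df_measure_atMost[OF assms] by (simp add: tail_def)
qed

lemma measure_atLeastAtMost_eq:
  assumes "nonneg_distribution_function H" "0 \<le> x"
  shows "measure (interval_measure H) {0..x} = H x"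
proof -
  interpret real_distribution "interval_measure H"
    by (rule nonneg_df_real_distribution[OF assms(1)])
  have "(\<lambda>n. measure (interval_measure H) {..- (1 / real (Suc n))}) \<longlonglongrightarrow> measure (interval_measure H) (\<Union>n. {..- (1 / real (Suc n))})"
    by (rule finite_Lim_measure_incseq) (auto simp: incseq_def frac_le)
  also have "(\<Union>n. {..- (1 / real (Suc n))}) = {..<0}"
  proof safe
    fix x :: real assume "x < 0"
    then obtain n where "inverse (real (Suc n)) < - x"
      using reals_Archimedean[of "- x"] by auto
    then show "x \<in> (\<Union>n. {..- (1 / real (Suc n))})"
      by (auto intro!: exI[of _ n] simp: inverse_eq_divide)
  qed (metis less_le_trans neg_less_0_iff_less not_le of_nat_0_less_iff zero_less_Suc zero_less_divide_1_iff order.strict_trans1)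
  finally have "measure (interval_measure H) {..<0} = 0"
    using assms by (simp add: nonneg_df_measure_atMost nonneg_df_neg LIMSEQ_const_iff)
  moreover have "measure (interval_measure H) {..x} = measure (interval_measure H) {..<0} + measure (interval_measure H) {0..x}"
    using assms(2) by (subst finite_measure_Union[symmetric]) (auto intro!: arg_cong[where f="measure (interval_measure H)"])
  ultimately show ?thesis
    using nonneg_df_measure_atMost[OF assms(1)] by simp
qed

lemma measure_Ioc_eq:
  assumes "nonneg_distribution_function H" "x \<le> y"
  shows "measure (interval_measure H) {x<..y} = H y - H x"
proof -
  interpret real_distribution "interval_measure H"
    by (rule nonneg_df_real_distribution[OF assms(1)])
  show ?thesis
    using measure_interval_measure_Ioc[of x y H] assms
    by (auto simp: nonneg_df_mono nonneg_distribution_function_def)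
qed

lemma subexponential_df: "subexponential H \<Longrightarrow> nonneg_distribution_function H"
  by (simp add: subexponential_def)

lemma subexponential_tail_pos:
  assumes "subexponential H"
  shows "0 < tail H x"
proof (rule ccontr)
  note df = subexponential_df[OF assms]
  assume "\<not> 0 < tail H x"
  then have "tail H y = 0" if "x \<le> y" for y
    using tail_antimono[OF df that] tail_nonneg[OF df, of y] by simp
  then have "((\<lambda>x. measure (interval_measure H \<star> interval_measure H) {x<..} / tail H x) \<longlongrightarrow> 0) at_top"
    by (intro tendsto_eventually) (auto simp: eventually_at_top_linorder intro!: exI[of _ x])
  with assms show False
    unfolding subexponential_def using tendsto_unique[OF trivial_limit_at_top_linorder] by force
qed

lemma subexponential_pair_measure:
  assumes "subexponential H" "0 < e"
  defines "\<mu> \<equiv> interval_measure H"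
  shows "eventually (\<lambda>x. measure (\<mu> \<Otimes>\<^sub>M \<mu>) {p. x < fst p + snd p} \<le> (2 + e) * tail H x) at_top"
proof -
  have lim: "((\<lambda>x. measure (\<mu> \<star> \<mu>) {x<..} / tail H x) \<longlongrightarrow> 2) at_top"
    using assms by (simp add: subexponential_def)
  have meas: "measure (\<mu> \<star> \<mu>) {x<..} = measure (\<mu> \<Otimes>\<^sub>M \<mu>) {p. x < fst p + snd p}" for x
  proof -
    have m: "(\<lambda>(x, y). x + y) \<in> \<mu> \<Otimes>\<^sub>M \<mu> \<rightarrow>\<^sub>M borel"
      by (simp add: \<mu>_def)
    have "(\<lambda>(x, y). x + y) -` {x<..} \<inter> space (\<mu> \<Otimes>\<^sub>M \<mu>) = {p. x < fst p + snd p}"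
      by (auto simp: space_pair_measure \<mu>_def)
    then show ?thesis unfolding convolution_def
      using measure_distr[OF m, of "{x<..}"] by simp
  qed
  have "eventually (\<lambda>x. measure (\<mu> \<star> \<mu>) {x<..} / tail H x < 2 + e) at_top"
    using order_tendstoD(2)[OF lim, of "2 + e"] assms by simp
  then show ?thesis
    by eventually_elim (use subexponential_tail_pos[OF assms(1)] in \<open>simp add: meas field_simps\<close>)
qed

text \<open>For \<open>K <= x\<close>, the event that the sum exceeds \<open>x\<close> contains the
  disjoint strips where one coordinate exceeds \<open>x\<close> and the other lies in
  \<open>{0..K}\<close>. Each has mass \<open>H K * tail H x\<close>; removing both from a mass of
  about \<open>2 * tail H x\<close> leaves about \<open>2 * tail H K * tail H x\<close>.\<close>

lemma subexponential_both_large: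
  assumes "subexponential H" "0 \<le> K" "0 < e"
  defines "\<mu> \<equiv> interval_measure H"
  shows "eventually (\<lambda>x. measure (\<mu> \<Otimes>\<^sub>M \<mu>) (both_large K x)
    \<le> (2 * tail H K + e) * tail H x) at_top"
  using subexponential_pair_measure[OF assms(1,3)] eventually_ge_at_top[of K]
proof eventually_elim
  case (elim x)
  note df = subexponential_df[OF assms(1)]
  interpret real_distribution \<mu>
    unfolding \<mu>_def by (rule nonneg_df_real_distribution[OF df])
  interpret P: pair_prob_space \<mu> \<mu> ..
  let ?B = "(both_large K x)"
  let ?C1 = "{0..K} \<times> {x<..}" and ?C2 = "{x<..} \<times> {0..K}"
  have sets: "sets (\<mu> \<Otimes>\<^sub>M \<mu>) = sets (borel \<Otimes>\<^sub>M borel)"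
    by (intro sets_pair_measure_cong) (simp_all add: \<mu>_def)
  have "Measurable.pred (borel \<Otimes>\<^sub>M borel) (\<lambda>p::real \<times> real. x < fst p + snd p)"
    by measurable
  then have Bm: "?B \<in> sets (\<mu> \<Otimes>\<^sub>M \<mu>)" "{p. x < fst p + snd p} \<in> sets (\<mu> \<Otimes>\<^sub>M \<mu>)"
    by (simp_all add: both_large_sets \<mu>_def pred_def space_pair_measure sets)
  have [measurable]: "?C1 \<in> sets (\<mu> \<Otimes>\<^sub>M \<mu>)" "?C2 \<in> sets (\<mu> \<Otimes>\<^sub>M \<mu>)"
    by (auto simp: \<mu>_def)
  have C: "measure (\<mu> \<Otimes>\<^sub>M \<mu>) ?C1 = H K * tail H x" "measure (\<mu> \<Otimes>\<^sub>M \<mu>) ?C2 = H K * tail H x"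
    using measure_greaterThan_eq_tail[OF df, of x] measure_atLeastAtMost_eq[OF df assms(2)]
    unfolding \<mu>_def[symmetric] by (simp_all add: measure_Times[OF prob_space_axioms prob_space_axioms] ac_simps)
  have "measure (\<mu> \<Otimes>\<^sub>M \<mu>) ?B + measure (\<mu> \<Otimes>\<^sub>M \<mu>) ?C1 + measure (\<mu> \<Otimes>\<^sub>M \<mu>) ?C2
      \<le> measure (\<mu> \<Otimes>\<^sub>M \<mu>) {p. x < fst p + snd p}"
    using elim(2) Bm by (intro P.measure_disjoint3_le) auto
  also note elim(1)[folded \<mu>_def]
  finally show ?case
    unfolding C \<mu>_def[symmetric] by (simp add: tail_def algebra_simps)
qed

text \<open>Besides the strips \<open>?D1\<close> and \<open>?D2\<close>, in which one coordinate
  exceeds \<open>x\<close>, the event that the sum exceeds \<open>x\<close> contains the rectangle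
  \<open>?D3\<close>. After the strips only about \<open>tail H K * tail H x\<close> is left for it,
  while its mass is about \<open>tail H K * tail H (x - K)\<close>.\<close>

lemma subexponential_long_tailed:
  assumes "subexponential H" "0 \<le> K" "0 < e"
  shows "eventually (\<lambda>x. tail H (x - K) \<le> (1 + e) * tail H x) at_top"
proof -
  note df = subexponential_df[OF assms(1)]
  define \<mu> where "\<mu> = interval_measure H"
  \<comment> \<open>Solves \<open>tail H K + d = (1 + e) * (tail H K - d)\<close>.\<close>
  define d where "d = e * tail H K / (2 + e)"
  have K: "0 < tail H K" by (rule subexponential_tail_pos[OF assms(1)])
  have d: "0 < d" "d < tail H K" using K assms(3) by (auto simp: d_def field_simps)
  have "eventually (\<lambda>x. tail H x < d) at_top"
    using order_tendstoD(2)[OF tail_tendsto_0[OF df] d(1)] .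
  with subexponential_pair_measure[OF assms(1) d(1)] eventually_ge_at_top[of K]
  show ?thesis
  proof eventually_elim
    case (elim x)
    interpret real_distribution \<mu>
      unfolding \<mu>_def by (rule nonneg_df_real_distribution[OF df])
    interpret P: pair_prob_space \<mu> \<mu> ..
    let ?D1 = "{0..} \<times> {x<..}" and ?D2 = "{x<..} \<times> {0..K}" and ?D3 = "{x-K<..} \<times> {K<..x}"
    have sets: "sets (\<mu> \<Otimes>\<^sub>M \<mu>) = sets (borel \<Otimes>\<^sub>M borel)"
      by (intro sets_pair_measure_cong) (simp_all add: \<mu>_def)
    have "Measurable.pred (borel \<Otimes>\<^sub>M borel) (\<lambda>p::real \<times> real. x < fst p + snd p)"
      by measurable
    then have Dm: "{p. x < fst p + snd p} \<in> sets (\<mu> \<Otimes>\<^sub>M \<mu>)"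
      by (simp add: pred_def space_pair_measure sets)
    have [measurable]: "?D1 \<in> sets (\<mu> \<Otimes>\<^sub>M \<mu>)" "?D2 \<in> sets (\<mu> \<Otimes>\<^sub>M \<mu>)" "?D3 \<in> sets (\<mu> \<Otimes>\<^sub>M \<mu>)"
      by (auto simp: \<mu>_def)
    have "measure \<mu> {0..} = 1"
    proof (rule antisym)
      have "H y \<le> measure \<mu> {0..}" if "0 \<le> y" for y
        using measure_atLeastAtMost_eq[OF df that] finite_measure_mono[of "{0..y}" "{0..}"]
        by (auto simp: \<mu>_def)
      then show "1 \<le> measure \<mu> {0..}"
        by (intro tendsto_upperbound[of H 1 at_top])
           (use df in \<open>auto simp: nonneg_distribution_function_def eventually_at_top_linorder intro!: exI[of _ 0]\<close>)
    qed simp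
    then have D: "measure (\<mu> \<Otimes>\<^sub>M \<mu>) ?D1 = tail H x" "measure (\<mu> \<Otimes>\<^sub>M \<mu>) ?D2 = H K * tail H x"
      "measure (\<mu> \<Otimes>\<^sub>M \<mu>) ?D3 = (H x - H K) * tail H (x - K)"
      using measure_greaterThan_eq_tail[OF df] measure_atLeastAtMost_eq[OF df assms(2)]
        measure_Ioc_eq[OF df, of K x] elim(2)
      unfolding \<mu>_def[symmetric] by (simp_all add: measure_Times[OF prob_space_axioms prob_space_axioms] ac_simps)
    have "measure (\<mu> \<Otimes>\<^sub>M \<mu>) ?D1 + measure (\<mu> \<Otimes>\<^sub>M \<mu>) ?D2 + measure (\<mu> \<Otimes>\<^sub>M \<mu>) ?D3
        \<le> measure (\<mu> \<Otimes>\<^sub>M \<mu>) {p. x < fst p + snd p}"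
      using elim(2) Dm by (intro P.measure_disjoint3_le) auto
    also note elim(1)[folded \<mu>_def]
    finally have 1: "(tail H K - tail H x) * tail H (x - K) \<le> (tail H K + d) * tail H x"
      unfolding D by (simp add: tail_def algebra_simps)
    have "(tail H K - d) * tail H (x - K) \<le> (tail H K - tail H x) * tail H (x - K)"
      using elim(3) by (intro mult_right_mono tail_nonneg[OF df]) auto
    also note 1
    also have "tail H K + d = (tail H K - d) * (1 + e)"
      using assms(3) by (simp add: d_def field_simps)
    finally have "(tail H K - d) * tail H (x - K) \<le> (tail H K - d) * ((1 + e) * tail H x)"
      by (simp add: mult.assoc)
    then show ?case using d by (simp add: mult_le_cancel_left)
  qed
qed

section \<open>The tail of \<open>F\<close>, its integral and its sums along arithmetic
  progressions\<close>

locale subexponential_pair =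
  fixes F :: "real \<Rightarrow> real"
  assumes F: "subexponential F" and Fs: "subexponential (integrated_tail_df F)"
begin

abbreviation Fb :: "real \<Rightarrow> real" where "Fb \<equiv> tail F"
abbreviation G :: "real \<Rightarrow> real" where "G \<equiv> tail (integrated_tail_df F)"
text \<open>The integral without the cap at \<open>1\<close>: unlike \<open>G\<close> it has exact
  differences that telescope, and it agrees with \<open>G\<close> for large arguments.\<close>

definition I :: "real \<Rightarrow> real" where "I x = (LBINT u:{x..}. tail F u)"

lemmas F_df = subexponential_df[OF F]
lemmas Fs_df = subexponential_df[OF Fs]
lemmas Fb_pos = subexponential_tail_pos[OF F]
lemmas G_pos = subexponential_tail_pos[OF Fs]

lemma G_nonneg_eq: "0 \<le> x \<Longrightarrow> G x = min 1 (I x)"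
  by (simp add: tail_def[of "integrated_tail_df F"] integrated_tail_df_def I_def)

lemma I_pos: "0 \<le> x \<Longrightarrow> 0 < I x"
  using G_pos[of x] G_nonneg_eq[of x] by simp

text \<open>The integral of a non-integrable function is \<open>0\<close> by convention, so the
  positivity of \<open>I x\<close>, which comes from that of \<open>G x\<close>, yields
  integrability.\<close>

lemma Fb_set_integrable: "0 \<le> x \<Longrightarrow> set_integrable lborel {x..} Fb"
  using I_pos[of x] not_integrable_integral_eq[of lborel "\<lambda>u. indicator {x..} u *\<^sub>R Fb u"]
  unfolding I_def set_lebesgue_integral_def set_integrable_def by auto

lemma I_diff:
  assumes "0 \<le> x" "x \<le> y"
  shows I_diff_ge: "(y - x) * Fb y \<le> I x - I y" and I_diff_le: "I x - I y \<le> (y - x) * Fb x"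
proof -
  have "{x..} = {x..<y} \<union> {y..}" using assms by auto
  then have 1: "I x = (LBINT u:{x..<y}. Fb u) + I y"
    unfolding I_def using Fb_set_integrable[of x] Fb_set_integrable[of y] assms
    by (subst set_integral_Un[symmetric]) (auto intro: set_integrable_subset)
  have int: "set_integrable lborel {x..<y} Fb"
    using Fb_set_integrable[of x] by (rule set_integrable_subset) (use assms in auto)
  have c: "set_integrable lborel {x..<y} (\<lambda>_. z)" "(LBINT u:{x..<y}. z) = (y - x) * z" for z :: real
    using assms by (auto simp: set_integrable_def set_lebesgue_integral_def)
  have "(LBINT u:{x..<y}. Fb y) \<le> (LBINT u:{x..<y}. Fb u)"
    using c int by (intro set_integral_mono) (auto intro: tail_antimono[OF F_df])
  moreover have "(LBINT u:{x..<y}. Fb u) \<le> (LBINT u:{x..<y}. Fb x)"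
    using c int by (intro set_integral_mono) (auto intro: tail_antimono[OF F_df])
  ultimately show "(y - x) * Fb y \<le> I x - I y" "I x - I y \<le> (y - x) * Fb x"
    unfolding 1 c by auto
qed

lemma eventually_G_eq_I: "eventually (\<lambda>x. G x = I x) at_top"
  using order_tendstoD(2)[OF tail_tendsto_0[OF Fs_df], of 1, simplified] eventually_ge_at_top[of 0]
  by eventually_elim (auto simp: G_nonneg_eq min_def split: if_splits)

lemma I_tendsto_0: "(I \<longlongrightarrow> 0) at_top"
  using tail_tendsto_0[OF Fs_df] eventually_G_eq_I by (rule Lim_transform_eventually)

text \<open>Compares the integral of the decreasing function \<open>Fb\<close> with its Riemann sum
  of mesh \<open>c\<close>. The upper bound costs a shift of the argument by one mesh, which is
  negligible because \<open>G\<close> is long-tailed.\<close>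

lemma Fb_sum:
  assumes "0 < c" "0 \<le> y"
  shows Fb_summable: "summable (\<lambda>i. Fb (y + c * real i))"
    and Fb_sum_ge: "I y \<le> c * (\<Sum>i. Fb (y + c * real i))"
    and Fb_sum_le: "c \<le> y \<Longrightarrow> c * (\<Sum>i. Fb (y + c * real i)) \<le> I (y - c)"
proof -
  have tele: "(\<lambda>i. I (z + c * real i) - I (z + c * real (Suc i))) sums I z" for z
  proof -
    have "filterlim (\<lambda>i. z + c * real i) at_top sequentially"
      using assms(1) by real_asymp
    then have "(\<lambda>i. I (z + c * real i)) \<longlonglongrightarrow> 0"
      by (rule filterlim_compose[OF I_tendsto_0])
    from telescope_sums'[OF this] show ?thesis by simp
  qed
  have step: "c * Fb (z + c * real (Suc i)) \<le> I (z + c * real i) - I (z + c * real (Suc i))"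
      "I (z + c * real i) - I (z + c * real (Suc i)) \<le> c * Fb (z + c * real i)" if "0 \<le> z" for z i
    using I_diff_ge[of "z + c * real i" "z + c * real (Suc i)"]
      I_diff_le[of "z + c * real i" "z + c * real (Suc i)"] assms that by (auto simp: algebra_simps)
  have "summable (\<lambda>i. c * Fb (y + c * real (Suc i)))"
    by (rule summable_comparison_test'[OF sums_summable[OF tele[of y]], of 0])
       (use assms step[of y] in \<open>auto simp: abs_mult tail_nonneg[OF F_df]\<close>)
  then have "summable (\<lambda>i. Fb (y + c * real (Suc i)))"
    using assms summable_cmult_iff[of c] by auto
  then show summ: "summable (\<lambda>i. Fb (y + c * real i))"
    using summable_Suc_iff[of "\<lambda>i. Fb (y + c * real i)"] by auto
  show "I y \<le> c * (\<Sum>i. Fb (y + c * real i))"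
    unfolding suminf_mult[OF summ, symmetric]
    using sums_le[OF _ tele[of y] summable_sums[OF summable_mult[OF summ, of c]]] step[of y] assms by auto
  show "c * (\<Sum>i. Fb (y + c * real i)) \<le> I (y - c)" if "c \<le> y"
    unfolding suminf_mult[OF summ, symmetric]
    using sums_le[OF _ summable_sums[OF summable_mult[OF summ, of c]] tele[of "y - c"]] step(1)[of "y - c"] assms that
    by (auto simp: algebra_simps)
qed

text \<open>Measuring the error against \<open>Fb\<close> itself puts the cases \<open>d = 0\<close>
  and \<open>d > 0\<close> into one inequality that can be summed term by term.\<close>

definition asymp_tail :: "(real \<Rightarrow> real) \<Rightarrow> real \<Rightarrow> bool" where
  "asymp_tail q d \<longleftrightarrow> (\<forall>e>0. eventually (\<lambda>x. \<bar>q x - d * Fb x\<bar> \<le> e * Fb x) at_top)"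

lemma asymp_proportional_imp_asymp_tail:
  assumes "asymp_proportional q d Fb"
  shows "asymp_tail q d"
  unfolding asymp_tail_def
proof safe
  fix e :: real assume e: "0 < e"
  show "eventually (\<lambda>x. \<bar>q x - d * Fb x\<bar> \<le> e * Fb x) at_top"
  proof (cases "d = 0")
    case True
    then have "q \<in> o[at_top](Fb)" using assms by (simp add: asymp_proportional_def)
    from landau_o.smallD[OF this e] show ?thesis
      using True Fb_pos by (auto elim!: eventually_mono simp: less_imp_le abs_of_pos)
  next
    case False
    then have "((\<lambda>x. q x / Fb x) \<longlongrightarrow> d) at_top" using assms by (simp add: asymp_proportional_def)
    from tendstoD[OF this e] show ?thesis
    proof eventually_elim
      case (elim x)
      have "q x - d * Fb x = (q x / Fb x - d) * Fb x"
        using Fb_pos[of x] by (simp add: field_simps)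
      then show ?case using elim Fb_pos[of x] by (simp add: abs_mult dist_real_def mult_right_mono)
    qed
  qed
qed

lemma eventually_G_shift:
  assumes "0 < e"
  shows "eventually (\<lambda>x. G (x - K) \<le> (1 + e) * G x) at_top"
  using subexponential_long_tailed[OF Fs, of "max 0 K" e, OF _ assms]
  by (auto elim!: eventually_mono intro: order_trans[OF tail_antimono[OF Fs_df, of "x - max 0 K" "x - K" for x]])

text \<open>Source of the factor \<open>d / c\<close> in front of the integrated tail: termwise,
  \<open>q\<close> is replaced by \<open>d * Fb\<close>, and then the Riemann sum of mesh
  \<open>c\<close> by the integral.\<close>

lemma asymp_tail_sum:
  assumes q: "asymp_tail q d" "\<And>x. 0 \<le> q x" and "0 \<le> d" "0 < c" "0 < e"
  shows "eventually (\<lambda>y. summable (\<lambda>i. q (y + c * real i)) \<and>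
    \<bar>c * (\<Sum>i. q (y + c * real i)) - d * G y\<bar> \<le> e * G y) at_top"
proof -
  \<comment> \<open>Error budget: \<open>e1\<close> is the relative error of \<open>q\<close> and
    gets doubled, because the Riemann sum is bounded by \<open>2 * G y\<close>; \<open>e2\<close> is
    the relative error of the Riemann sum and gets multiplied by \<open>d\<close>. The
    \<open>d + 1\<close> avoids a division by zero.\<close>
  define e1 where "e1 = e / 4"
  define e2 where "e2 = min 1 (e / (2 * (d + 1)))"
  have e: "0 < e1" "0 < e2" "e2 \<le> 1" "d * e2 \<le> e / 2"
  proof -
    show "0 < e1" "0 < e2" "e2 \<le> 1" using assms by (auto simp: e1_def e2_def)
    have "d * e2 \<le> (d + 1) * (e / (2 * (d + 1)))"
      using assms by (intro mult_mono) (auto simp: e2_def)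
    also have "\<dots> = e / 2" using assms by (simp add: divide_simps)
    finally show "d * e2 \<le> e / 2" .
  qed
  obtain N where N: "\<And>x. N \<le> x \<Longrightarrow> \<bar>q x - d * Fb x\<bar> \<le> e1 * Fb x"
    using q(1) e(1) unfolding asymp_tail_def eventually_at_top_linorder by blast
  have "filterlim (\<lambda>x. x - c) at_top at_top" by real_asymp
  then have "eventually (\<lambda>x. G (x - c) = I (x - c)) at_top"
    using eventually_G_eq_I by (rule eventually_compose_filterlim[rotated])
  with eventually_G_shift[OF e(2), of c] eventually_G_eq_I eventually_ge_at_top[of "max N c"]
  show ?thesis
  proof eventually_elim
    case (elim y)
    have y: "0 \<le> y" "c \<le> y" "N \<le> y" using elim assms by auto
    let ?f = "\<lambda>i. Fb (y + c * real i)" and ?q = "\<lambda>i. q (y + c * real i)"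
    have summ: "summable ?f" using Fb_summable[of c y] assms y by auto
    have le: "\<bar>?q i - d * ?f i\<bar> \<le> e1 * ?f i" for i
      using y assms by (intro N) (auto intro: order_trans[of _ y])
    have summq: "summable ?q"
    proof (rule summable_comparison_test'[OF summable_mult[OF summ, of "d + e1"], of 0])
      fix i show "norm (?q i) \<le> (d + e1) * ?f i"
        using le[of i] q(2)[of "y + c * real i"] by (simp add: algebra_simps)
    qed
    have "\<bar>(\<Sum>i. ?q i) - d * (\<Sum>i. ?f i)\<bar> = \<bar>\<Sum>i. ?q i - d * ?f i\<bar>"
      using suminf_diff[OF summq summable_mult[OF summ, of d]] suminf_mult[OF summ, of d] by simp
    also have "\<dots> \<le> (\<Sum>i. e1 * ?f i)"
      using norm_suminf_le[of "\<lambda>i. ?q i - d * ?f i", OF _ summable_mult[OF summ]] le by simp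
    also have "\<dots> = e1 * (\<Sum>i. ?f i)" by (rule suminf_mult[OF summ])
    finally have "c * \<bar>(\<Sum>i. ?q i) - d * (\<Sum>i. ?f i)\<bar> \<le> c * (e1 * (\<Sum>i. ?f i))"
      using assms by (intro mult_left_mono) auto
    then have 1: "\<bar>c * (\<Sum>i. ?q i) - d * (c * (\<Sum>i. ?f i))\<bar> \<le> e1 * (c * (\<Sum>i. ?f i))"
      using assms abs_mult[of c "(\<Sum>i. ?q i) - d * (\<Sum>i. ?f i)"]
      by (simp add: right_diff_distrib mult.left_commute)
    define s where "s = c * (\<Sum>i. ?f i)"
    have s: "G y \<le> s" "s \<le> (1 + e2) * G y"
      using Fb_sum_ge[of c y] Fb_sum_le[of c y] assms y elim by (auto simp: s_def)
    have "d * (s - G y) \<le> d * (e2 * G y)" "0 \<le> d * (s - G y)"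
      using s assms(3) by (intro mult_left_mono mult_nonneg_nonneg; simp add: algebra_simps)+
    then have "\<bar>d * s - d * G y\<bar> \<le> d * e2 * G y"
      by (simp add: right_diff_distrib mult.assoc)
    also have "\<dots> \<le> e / 2 * G y" using e(4) G_pos[of y] by (intro mult_right_mono) auto
    finally have 2: "\<bar>d * s - d * G y\<bar> \<le> e / 2 * G y" .
    have "e1 * s \<le> e1 * (2 * G y)"
      using s(2) e G_pos[of y] by (intro mult_left_mono order_trans[OF s(2)] mult_right_mono) auto
    then have 3: "e1 * s \<le> e / 2 * G y" by (simp add: e1_def)
    show ?case using summq 1 2 3 unfolding s_def[symmetric]
      by (intro conjI) (assumption, linarith)
  qed
qed

text \<open>\<open>G\<close> need not vary regularly, so the ratio of \<open>G (p * x)\<close> and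
  \<open>G (r * x)\<close> may stay away from \<open>1\<close>; but their difference is small
  compared to \<open>G x\<close>. Between \<open>p * x\<close> and \<open>r * x\<close> the
  integrand is at most \<open>Fb (p * x)\<close>, and \<open>(p - 1) * x * Fb (p * x)\<close> is at
  most the integral from \<open>x\<close> to \<open>p * x\<close>, hence at most
  \<open>I x\<close>.\<close>

lemma G_scale_diff:
  assumes "1 < p" "p \<le> r"
  shows "eventually (\<lambda>x. G (p * x) - G (r * x) \<le> (r - p) / (p - 1) * G x) at_top"
proof -
  have "filterlim (\<lambda>x. p * x) at_top at_top" "filterlim (\<lambda>x. r * x) at_top at_top"
    using assms by real_asymp+
  then have "eventually (\<lambda>x. G (p * x) = I (p * x)) at_top" "eventually (\<lambda>x. G (r * x) = I (r * x)) at_top"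
    using eventually_compose_filterlim[OF eventually_G_eq_I] by auto
  with eventually_G_eq_I eventually_ge_at_top[of 0] show ?thesis
  proof eventually_elim
    case (elim x)
    have le: "x \<le> p * x" "p * x \<le> r * x" "0 \<le> p * x"
      using elim assms mult_right_mono[of 1 p x] by (auto intro: mult_right_mono)
    have "(p * x - x) * Fb (p * x) \<le> I x - I (p * x)"
      using elim le by (intro I_diff_ge) auto
    also have "\<dots> \<le> I x" using I_pos[of "p * x"] le by simp
    finally have "x * Fb (p * x) \<le> I x / (p - 1)"
      using assms by (simp add: field_simps)
    then have "(r - p) * (x * Fb (p * x)) \<le> (r - p) * (I x / (p - 1))"
      using assms by (intro mult_left_mono) auto
    moreover have "I (p * x) - I (r * x) \<le> (r * x - p * x) * Fb (p * x)"
      using le by (intro I_diff_le) auto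
    ultimately show ?case using elim by (simp add: algebra_simps)
  qed
qed

lemma asymp_tail_imp_le:
  assumes "asymp_tail q d" "0 \<le> d"
  shows "\<exists>y0. \<forall>y\<ge>y0. q y \<le> (d + 1) * Fb y"
proof -
  have "eventually (\<lambda>x. \<bar>q x - d * Fb x\<bar> \<le> 1 * Fb x) at_top"
    using assms(1) unfolding asymp_tail_def by (rule allE[of _ 1]) auto
  then obtain y0 where "\<And>y. y0 \<le> y \<Longrightarrow> \<bar>q y - d * Fb y\<bar> \<le> Fb y"
    by (auto simp: eventually_at_top_linorder)
  then show ?thesis by (intro exI[of _ y0]) (force simp: algebra_simps abs_le_iff)
qed

text \<open>The version for functions with a mere upper bound. The factor \<open>2\<close> reflects
  the relative error \<open>1\<close> granted to the Riemann sum of \<open>Fb\<close>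
  itself.\<close>

lemma sum_tail_le:
  assumes "0 < c" "0 \<le> C" and q: "\<And>y. 0 \<le> q y" "eventually (\<lambda>y. q y \<le> C * Fb y) at_top"
  shows "eventually (\<lambda>y. summable (\<lambda>i. q (y + c * real i)) \<and> c * (\<Sum>i. q (y + c * real i)) \<le> 2 * C * G y) at_top"
proof -
  obtain y0 where y0: "\<And>y. y0 \<le> y \<Longrightarrow> q y \<le> C * Fb y"
    using q(2) by (auto simp: eventually_at_top_linorder)
  have "asymp_tail Fb 1"
    using Fb_pos by (simp add: asymp_tail_def less_imp_le)
  from asymp_tail_sum[OF this tail_nonneg[OF F_df] zero_le_one assms(1) zero_less_one] eventually_ge_at_top[of y0]
  show ?thesis
  proof eventually_elim
    case (elim y)
    let ?f = "\<lambda>i. Fb (y + c * real i)"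
    have le: "q (y + c * real i) \<le> C * ?f i" for i
      using elim assms by (intro y0) (auto intro: order_trans[of _ y])
    have summ: "summable (\<lambda>i. C * ?f i)" using elim by (intro summable_mult) simp
    have summq: "summable (\<lambda>i. q (y + c * real i))"
      by (rule summable_comparison_test'[OF summ, of 0]) (simp add: q le)
    have "c * (\<Sum>i. q (y + c * real i)) \<le> c * (\<Sum>i. C * ?f i)"
      using assms by (intro mult_left_mono suminf_le le summq summ) auto
    also have "\<dots> = C * (c * (\<Sum>i. ?f i))" using elim by (simp add: suminf_mult)
    also have "\<dots> \<le> C * (2 * G y)" using elim assms by (intro mult_left_mono) (auto simp: abs_le_iff)
    finally show ?case using summq by simp
  qed
qed

text \<open>Taking the slack to be \<open>G K\<close> itself gives the \<open>3\<close>. The factor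
  \<open>G K\<close> is later made small by choosing \<open>K\<close> after the constants it is
  multiplied with.\<close>

lemma subexponential_both_large_G:
  assumes "0 \<le> K"
  defines "\<mu> \<equiv> interval_measure (integrated_tail_df F)"
  shows "eventually (\<lambda>x. measure (\<mu> \<Otimes>\<^sub>M \<mu>) (both_large K x) \<le> 3 * G K * G x) at_top"
  using subexponential_both_large[OF Fs assms(1) G_pos[of K]] unfolding \<mu>_def by simp

lemma G_small: "0 < e \<Longrightarrow> eventually (\<lambda>K. G K < e) at_top"
  using order_tendstoD(2)[OF tail_tendsto_0[OF Fs_df]] .

lemma G_shift_abs:
  assumes "0 < e"
  shows "eventually (\<lambda>y. \<bar>G (y - K) - G y\<bar> \<le> e * G y) at_top"
proof (cases "0 \<le> K")
  case True
  show ?thesis using eventually_G_shift[OF assms, of K]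
    by eventually_elim (use True tail_antimono[OF Fs_df] in \<open>auto simp: algebra_simps abs_le_iff intro: add_increasing2\<close>)
next
  case False
  have "eventually (\<lambda>y. G (y - K - (- K)) \<le> (1 + e) * G (y - K)) at_top"
    by (rule eventually_at_top_minus[OF eventually_G_shift[OF assms, of "- K"]])
  then show ?thesis
  proof eventually_elim
    case (elim y)
    have le: "G (y - K) \<le> G y" using False by (intro tail_antimono[OF Fs_df]) simp
    have "G y - G (y - K) \<le> e * G (y - K)" using elim by (simp add: algebra_simps)
    also have "\<dots> \<le> e * G y" using le assms by (intro mult_left_mono) auto
    finally show ?case using le by simp
  qed
qed

text \<open>The bounded terms of the path estimates end up in the shift \<open>K\<close> of the
  level, which is used with both signs and disappears in the limit.\<close>

lemma asymp_tail_sum_shift: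
  assumes q: "asymp_tail q d" "\<And>x. 0 \<le> q x" and "0 \<le> d" "0 < c" "0 < \<eta>"
  shows "eventually (\<lambda>y. summable (\<lambda>i. q (y - K + c * real i)) \<and>
    \<bar>c * (\<Sum>i. q (y - K + c * real i)) - d * G y\<bar> \<le> \<eta> * G y) at_top"
proof -
  define e where "e = min 1 (\<eta> / (2 * (d + 1)))"
  have e: "0 < e" "e \<le> 1" "d * e \<le> \<eta> / 2"
  proof -
    show "0 < e" "e \<le> 1" using assms by (auto simp: e_def)
    have "d * e \<le> (d + 1) * (\<eta> / (2 * (d + 1)))" using assms by (intro mult_mono) (auto simp: e_def)
    also have "\<dots> = \<eta> / 2" using assms by (simp add: divide_simps)
    finally show "d * e \<le> \<eta> / 2" .
  qed
  have "0 < \<eta> / 4" using assms by simp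
  from eventually_at_top_minus[OF asymp_tail_sum[OF q assms(3,4) this], of K] G_shift_abs[OF e(1), of K]
  show ?thesis
  proof eventually_elim
    case (elim y)
    let ?s = "c * (\<Sum>i. q (y - K + c * real i))"
    have "e * G y \<le> 1 * G y" using e G_pos[of y] by (intro mult_right_mono) auto
    then have "G (y - K) \<le> 2 * G y" using elim(2) by linarith
    then have "\<eta> / 4 * G (y - K) \<le> \<eta> / 4 * (2 * G y)" using assms by (intro mult_left_mono) auto
    then have 1: "\<bar>?s - d * G (y - K)\<bar> \<le> \<eta> / 2 * G y" using elim(1) by simp
    have "d * \<bar>G (y - K) - G y\<bar> \<le> d * (e * G y)" using elim(2) assms by (intro mult_left_mono) auto
    also have "\<dots> \<le> \<eta> / 2 * G y" using mult_right_mono[OF e(3), of "G y"] G_pos[of y] by (simp add: mult.assoc)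
    finally have "\<bar>d * G (y - K) - d * G y\<bar> \<le> \<eta> / 2 * G y"
      using assms(3) by (simp add: abs_mult right_diff_distrib[symmetric])
    then have "\<bar>?s - d * G y\<bar> \<le> \<eta> / 2 * G y + \<eta> / 2 * G y" using 1 by linarith
    then show ?case using elim(1) by simp
  qed
qed

text \<open>For large \<open>x\<close>, doubling the argument costs at most a fixed factor
  \<open>y\<close>, so \<open>k\<close> doublings cost \<open>y ^ k\<close>; monotonicity then
  covers every \<open>c < 2 ^ k\<close>.\<close>

lemma G_bigo_scale:
  assumes "0 < Liminf at_top (\<lambda>x. ereal (G (2 * x) / G x))" "0 < c"
  shows "G \<in> O[at_top](\<lambda>x. G (x * c))"
proof -
  obtain y where y: "0 < ereal y" "ereal y < Liminf at_top (\<lambda>x. ereal (G (2 * x) / G x))"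
    using ereal_dense2[OF assms(1)] by blast
  have "eventually (\<lambda>x. y < G (2 * x) / G x) at_top"
    using less_LiminfD[OF y(2)] by simp
  then obtain x0 where x0: "\<And>x. x0 \<le> x \<Longrightarrow> y * G x \<le> G (2 * x)"
    unfolding eventually_at_top_linorder using G_pos by (metis pos_less_divide_eq less_imp_le)
  obtain k where k: "c < 2 ^ k" using real_arch_pow[of 2 c] by auto
  have iter: "y ^ n * G x \<le> G (2 ^ n * x)" if "max 0 x0 \<le> x" for n x
  proof (induction n)
    case (Suc n)
    have "1 * x \<le> 2 ^ n * x" using that by (intro mult_right_mono) auto
    then have "y * G (2 ^ n * x) \<le> G (2 * (2 ^ n * x))" using that by (intro x0) auto
    moreover have "y * (y ^ n * G x) \<le> y * G (2 ^ n * x)" using Suc y by (intro mult_left_mono) auto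
    ultimately show ?case by (simp add: mult.assoc)
  qed simp
  have y0: "0 < y" using y by simp
  show ?thesis
  proof (rule bigoI[where c="1 / y ^ k"])
    show "eventually (\<lambda>x. norm (G x) \<le> 1 / y ^ k * norm (G (x * c))) at_top"
      using eventually_ge_at_top[of "max 0 x0"]
    proof eventually_elim
      case (elim x)
      have "c * x \<le> 2 ^ k * x" using elim k by (intro mult_right_mono) auto
      then have "x * c \<le> 2 ^ k * x" by (simp only: mult.commute)
      then have "y ^ k * G x \<le> G (x * c)"
        using iter[OF elim, of k] tail_antimono[OF Fs_df] by (meson order_trans)
      then show ?case
        using y0 G_pos[of x] G_pos[of "x * c"] by (simp add: field_simps)
    qed
  qed
qed

end

subsection \<open>Sample paths\<close>

text \<open>In all sequences over \<open>nat\<close> the index \<open>i\<close> stands for customer \<open>-i\<close>, so that larger indices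
  lie further in the past; \<open>f\<close>, \<open>g\<close>, \<open>h\<close> are the service times at stations 1 and 2 and the
  interarrival times. The second entry of the maximum is the path that changes stations at
  customer \<open>j\<close>, who is then served at both.\<close>

fun dater :: "(nat \<Rightarrow> real) \<Rightarrow> (nat \<Rightarrow> real) \<Rightarrow> (nat \<Rightarrow> real) \<Rightarrow> nat \<Rightarrow> real" where
  "dater f g h 0 = 0"
| "dater f g h (Suc j) = max (dater f g h j + f j - h j) ((\<Sum>i\<le>j. g i - h i) + f j)"

lemma sum_le_dater:
  assumes "\<And>i. 0 \<le> f i"
  shows "(\<Sum>i<j. g i - h i) \<le> dater f g h j"
proof (cases j)
  case (Suc k)
  then show ?thesis using assms[of k] by (auto simp: lessThan_Suc_atMost max_def)
qed simp

text \<open>By \<open>sum_le_dater\<close>, the path that changes stations at customer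
  \<open>j\<close> exceeds the previous dater by at most both service times of that customer. A
  single step up can therefore be large only if \<open>f j + g j\<close> is.\<close>

lemma dater_Suc_le:
  assumes "\<And>i. 0 \<le> f i" "\<And>i. 0 \<le> g i" "\<And>i. 0 \<le> h i"
  shows "dater f g h (Suc j) \<le> dater f g h j + (f j + g j)"
  using sum_le_dater[of f g h j] assms by (simp add: lessThan_Suc_atMost[symmetric] add_mono
      add_increasing diff_le_eq)

text \<open>A path that has changed stations before \<open>m\<close> continues at station 1 only,
  and this continuation is dominated by the restarted dater. A path that changes later has run at
  station 2 so far, where \<open>sum_le_dater\<close> bounds it by \<open>dater f g h m\<close>.
  This subadditivity allows restarting at a passage time.\<close>

lemma dater_add_le:
  assumes "\<And>i. 0 \<le> f i"
  shows "dater f g h (m + k) \<le> dater f g h m + dater (\<lambda>i. f (m + i)) (\<lambda>i. g (m + i)) (\<lambda>i. h (m + i)) k"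
proof (induction k)
  case (Suc k)
  have "(\<Sum>i\<le>m + k. g i - h i) = (\<Sum>i<m. g i - h i) + (\<Sum>i\<le>k. g (m + i) - h (m + i))"
    by (induction k) (simp_all add: lessThan_Suc_atMost[symmetric])
  then show ?case using Suc sum_le_dater[of f g h m] assms by (auto simp: max_def)
qed simp

text \<open>Unfolded, the dater is \<open>(\<Sum>i<j. f i - h i)\<close> plus the maximum of
  \<open>0\<close> and the differences bounded by \<open>z\<close>, over all customers
  \<open>k < j\<close> at whom the stations may change.\<close>

lemma dater_le:
  assumes "\<And>k. k < j \<Longrightarrow> (\<Sum>i\<le>k. g i) - (\<Sum>i<k. f i) \<le> z" "0 \<le> z"
  shows "dater f g h j \<le> (\<Sum>i<j. f i - h i) + z"
  using assms
proof (induction j)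
  case (Suc j)
  have "dater f g h j \<le> (\<Sum>i<j. f i - h i) + z" "(\<Sum>i\<le>j. g i) - (\<Sum>i<j. f i) \<le> z"
    using Suc by simp_all
  moreover have "(\<Sum>i\<le>j. h i) = (\<Sum>i<j. h i) + h j"
    by (simp add: lessThan_Suc_atMost[symmetric])
  ultimately show ?case by (simp add: sum_subtractf)
qed simp

text \<open>A law of large numbers with an offset \<open>L\<close>, so that it holds for all
  \<open>j\<close> at once with probability close to \<open>1\<close>. The cutoff at
  \<open>n\<close> makes it a statement about the entries below \<open>n\<close> only.\<close>

definition lin_close :: "real \<Rightarrow> real \<Rightarrow> real \<Rightarrow> (nat \<Rightarrow> real) \<Rightarrow> nat \<Rightarrow> bool" where
  "lin_close e L m u n \<longleftrightarrow> (\<forall>j\<le>n. \<bar>(\<Sum>i<j. u i) - real j * m\<bar> \<le> e * real j + L)"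

lemma lin_closeD:
  assumes "lin_close e L m u n" "j \<le> n"
  shows "(\<Sum>i<j. u i) \<le> real j * m + e * real j + L" "real j * m - e * real j - L \<le> (\<Sum>i<j. u i)"
  using assms unfolding lin_close_def by (auto dest!: spec[of _ j])

lemma lin_close_sum_diff_le:
  assumes "lin_close e L b1 f n" "lin_close e L b2 g n" "m < n"
  shows "(\<Sum>i\<le>m. g i) - (\<Sum>i<m. f i) \<le> real m * (b2 - b1) + 2 * e * real m + (2 * L + b2 + e)"
  using lin_closeD(1)[OF assms(2), of "Suc m"] lin_closeD(2)[OF assms(1), of m] assms(3)
  by (simp add: lessThan_Suc_atMost algebra_simps)

text \<open>Since \<open>b1 <= b2\<close>, changing stations late is best for a path, up to the
  errors. Two of the four \<open>L\<close> come from the change of stations, two from the sums of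
  \<open>f\<close> and \<open>h\<close>; \<open>b2 + e\<close> stems from the customer who is served
  at both stations.\<close>

lemma lin_close_dater_le:
  assumes f: "lin_close e L b1 f j" and g: "lin_close e L b2 g j" and h: "lin_close e L a h j"
    and "0 \<le> e" "0 \<le> L" "0 \<le> b2" "b1 \<le> b2"
  shows "dater f g h j \<le> (4 * L + b2 + e) - real j * (a - b2 - 4 * e)"
proof -
  have "dater f g h j \<le> (\<Sum>i<j. f i - h i) + (real j * (b2 - b1) + 2 * e * real j + (2 * L + b2 + e))"
  proof (rule dater_le)
    fix k assume k: "k < j"
    have "real k * (b2 - b1) \<le> real j * (b2 - b1)" "2 * e * real k \<le> 2 * e * real j"
      using k assms by (auto intro!: mult_mono)
    then show "(\<Sum>i\<le>k. g i) - (\<Sum>i<k. f i) \<le> real j * (b2 - b1) + 2 * e * real j + (2 * L + b2 + e)"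
      using lin_close_sum_diff_le[OF f g k] by linarith
  qed (use assms in auto)
  then show ?thesis
    using lin_closeD(1)[OF f, of j] lin_closeD(2)[OF h, of j]
    by (simp add: sum_subtractf algebra_simps)
qed

section \<open>Waiting times along one path\<close>

definition queue1_wait :: "(nat \<Rightarrow> real) \<Rightarrow> (nat \<Rightarrow> real) \<Rightarrow> nat \<Rightarrow> ereal" where
  "queue1_wait f h n = (SUP k. ereal (\<Sum>i=1..k. f (n + i) - h (n + i)))"

text \<open>\<open>f (i - 1)\<close> is the service time at station 1 of the next customer, who has
  index \<open>i - 1\<close>. The sum starts at \<open>1\<close>, so this subtraction is never
  truncated.\<close>

definition queue2_wait :: "(nat \<Rightarrow> real) \<Rightarrow> (nat \<Rightarrow> real) \<Rightarrow> (nat \<Rightarrow> real) \<Rightarrow> ereal" where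
  "queue2_wait f g h = (SUP k. \<Sum>i=1..k. ereal (g i) -
     (- min 0 (queue1_wait f h i + ereal (f i) - ereal (h i)) + ereal (f (i - 1))))"

lemma waiting2_eq_queue2_wait:
  "waiting2 \<tau> \<sigma> \<omega> = queue2_wait (\<lambda>i. \<sigma> 1 (- int i) \<omega>) (\<lambda>i. \<sigma> 2 (- int i) \<omega>) (\<lambda>i. \<tau> (- int i) \<omega>)"
  unfolding waiting2_def queue2_wait_def interarrival2_def waiting1_def queue1_wait_def
proof (intro SUP_cong refl sum.cong)
  fix k i :: nat assume "i \<in> {1..k}"
  then have "- int i + 1 = - int (i - 1)" by auto
  moreover have "- int i - int j = - int (i + j)" for j by simp
  ultimately show "ereal (\<sigma> 2 (- int i) \<omega>) - (- min 0 ((SUP k. ereal (\<Sum>ia = 1..k. \<sigma> 1 (- int i - int ia) \<omega> - \<tau> (- int i - int ia) \<omega>)) +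
      ereal (\<sigma> 1 (- int i) \<omega>) - ereal (\<tau> (- int i) \<omega>)) + ereal (\<sigma> 1 (- int i + 1) \<omega>)) =
    ereal (\<sigma> 2 (- int i) \<omega>) - (- min 0 ((SUP k. ereal (\<Sum>ia = 1..k. \<sigma> 1 (- int (i + ia)) \<omega> - \<tau> (- int (i + ia)) \<omega>)) +
      ereal (\<sigma> 1 (- int i) \<omega>) - ereal (\<tau> (- int i) \<omega>)) + ereal (\<sigma> 1 (- int (i - 1)) \<omega>))"
    by (simp only:)
qed

text \<open>\<open>bounded\<close> makes the waiting times at station 1 finite, so that the suprema
  of \<open>queue1_wait\<close> can be computed in the reals.\<close>

locale stable_path =
  fixes f g h :: "nat \<Rightarrow> real"
  assumes nonneg: "\<And>i. 0 \<le> f i" "\<And>i. 0 \<le> g i" "\<And>i. 0 \<le> h i"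
    and bounded: "\<exists>L. \<forall>k. (\<Sum>i<k. f i - h i) \<le> L"
begin

definition q :: "nat \<Rightarrow> nat \<Rightarrow> real" where "q n k = (\<Sum>i=1..k. f (n + i) - h (n + i))"
definition w :: "nat \<Rightarrow> real" where "w n = (SUP k. q n k)"
definition p :: "nat \<Rightarrow> real" where "p k = (\<Sum>i=1..k. g i - h i)"

lemma q_0 [simp]: "q n 0 = 0" by (simp add: q_def)

lemma q_Suc: "q n (Suc k) = q n k + (f (n + Suc k) - h (n + Suc k))" by (simp add: q_def)

lemma q_shift: "q n (Suc k) = f (Suc n) - h (Suc n) + q (Suc n) k"
  by (induction k) (simp_all add: q_Suc)

lemma q_eq: "q n k = (\<Sum>i<n + Suc k. f i - h i) - (\<Sum>i<Suc n. f i - h i)"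
  by (induction k) (simp_all add: q_Suc)

lemma bdd: "bdd_above (range (q n))"
proof -
  obtain L where L: "\<And>k. (\<Sum>i<k. f i - h i) \<le> L" using bounded by blast
  have "q n k \<le> L - (\<Sum>i<Suc n. f i - h i)" for k
    unfolding q_eq using L by (rule diff_right_mono)
  then show ?thesis by (rule bdd_aboveI2)
qed

lemma q_le_w: "q n k \<le> w n"
  unfolding w_def by (intro cSUP_upper bdd) simp

lemma w_le: "(\<And>k. q n k \<le> z) \<Longrightarrow> w n \<le> z"
  unfolding w_def by (intro cSUP_least) auto

lemma w_nonneg: "0 \<le> w n" using q_le_w[of n 0] by simp

lemma queue1_wait_eq: "queue1_wait f h n = ereal (w n)"
proof -
  have "(SUP k. ereal (q n k)) \<le> ereal (w n)"
    by (intro SUP_least) (simp add: q_le_w)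
  moreover have "ereal 0 \<le> (SUP k. ereal (q n k))"
    by (rule SUP_upper2[of 0]) auto
  ultimately have "\<bar>SUP k. ereal (q n k)\<bar> \<noteq> \<infinity>" by auto
  from ereal_SUP[OF this] show ?thesis
    by (simp add: queue1_wait_def w_def q_def)
qed

text \<open>Lindley's recursion; since indices run into the past, customer \<open>Suc n\<close> is
  the one served just before customer \<open>n\<close>.\<close>

lemma w_rec: "w n = max 0 (f (Suc n) - h (Suc n) + w (Suc n))"
proof (rule antisym)
  show "w n \<le> max 0 (f (Suc n) - h (Suc n) + w (Suc n))"
  proof (rule w_le)
    fix k show "q n k \<le> max 0 (f (Suc n) - h (Suc n) + w (Suc n))"
      using q_le_w[of "Suc n" "k - 1"] by (cases k) (auto simp: q_shift)
  qed
  have "w (Suc n) \<le> w n - (f (Suc n) - h (Suc n))"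
    using q_le_w[of n "Suc k" for k] by (intro w_le) (simp add: q_shift algebra_simps)
  then show "max 0 (f (Suc n) - h (Suc n) + w (Suc n)) \<le> w n"
    using w_nonneg[of n] by simp
qed

lemma w_le_add:
  "(\<And>m. m \<le> k \<Longrightarrow> q n m \<le> C) \<Longrightarrow> w n \<le> max C (q n k + w (n + k))"
proof (induction k)
  case (Suc k)
  have "q n k + w (n + k) = max (q n k) (q n (Suc k) + w (n + Suc k))"
    using w_rec[of "n + k"] by (simp add: q_Suc max_def)
  moreover have "q n k \<le> C" using Suc.prems by simp
  moreover have "w n \<le> max C (q n k + w (n + k))" using Suc by simp
  ultimately show ?case by linarith
qed simp

definition inter2 :: "nat \<Rightarrow> real" where
  "inter2 i = - min 0 (w i + f i - h i) + f (i - 1)"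

text \<open>With \<open>u = w i + f i - h i\<close>, the recursion gives
  \<open>- min 0 u = max 0 u - u = w (i - 1) - u\<close>. So the interarrival time is the difference
  of two departure times from station 1, and its sums telescope.\<close>

lemma inter2_eq: "0 < i \<Longrightarrow> inter2 i = w (i - 1) - w i - f i + h i + f (i - 1)"
  using w_rec[of "i - 1"] by (simp add: inter2_def min_def max_def)

lemma inter2_ge: "f (i - 1) \<le> inter2 i"
  by (simp add: inter2_def)

lemma queue2_wait_eq: "queue2_wait f g h = (SUP k. ereal (\<Sum>i=1..k. g i - inter2 i))"
proof -
  have "ereal (g i) - (- min 0 (queue1_wait f h i + ereal (f i) - ereal (h i)) + ereal (f (i - 1)))
      = ereal (g i - inter2 i)" for i
    unfolding queue1_wait_eq inter2_def zero_ereal_def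
    by (simp add: ereal_min[symmetric] del: ereal_min)
  then show ?thesis unfolding queue2_wait_def by simp
qed

lemma less_queue2_wait_iff: "ereal x < queue2_wait f g h \<longleftrightarrow> (\<exists>k. x < (\<Sum>i=1..k. g i - inter2 i))"
  by (simp add: queue2_wait_eq less_SUP_iff)

lemma sum_inter2: "(\<Sum>i=1..k. g i - inter2 i) = p k + w k + f k - w 0 - f 0"
  by (induction k) (simp_all add: p_def inter2_eq)

lemma sum_inter2_from:
  assumes "j \<le> k"
  shows "(\<Sum>i=Suc j..k. g i - inter2 i) = (\<Sum>i=Suc j..k. g i - h i) + w k + f k - w j - f j"
  using assms by (induction k rule: dec_induct) (simp_all add: inter2_eq)

text \<open>The left-hand side is the path that starts at customer \<open>Suc j\<close>, changes
  stations at \<open>k\<close> and serves \<open>l\<close> more customers at station 1. The second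
  entry of the maximum in the dater starts the induction, the first entry extends it.\<close>

lemma path_le_dater:
  assumes "j < k"
  shows "(\<Sum>i=Suc j..k. g i - h i) + f k + q k l \<le>
    dater (\<lambda>i. f (Suc j + i)) (\<lambda>i. g (Suc j + i)) (\<lambda>i. h (Suc j + i)) (k - j + l)"
proof (induction l)
  case 0
  obtain m where k: "k = Suc (j + m)" using assms less_imp_Suc_add by blast
  have "(\<Sum>i=Suc j..k. g i - h i) = (\<Sum>i\<le>m. g (Suc j + i) - h (Suc j + i))"
    unfolding k by (induction m) simp_all
  then show ?case by (simp add: k)
next
  case (Suc l)
  have "f (k + Suc l) = f (Suc j + (k - j + l))" "h (k + Suc l) = h (Suc j + (k - j + l))"
    using assms by (simp_all add: add.commute)
  then show ?case using Suc by (simp add: q_Suc le_max_iff_disj)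
qed

text \<open>Customer \<open>-j\<close> waits at station 2 for at most the supremum of the dater started afresh, and
  from then on the departures from station 1 are separated by at least the service times there.\<close>

lemma queue2_wait_split:
  assumes "ereal (x + y) < queue2_wait f g h" "0 \<le> y"
  shows "(\<exists>m\<le>j. x < (\<Sum>i=1..m. g i - f (i - 1))) \<or>
    (\<exists>k. y < dater (\<lambda>i. f (Suc j + i)) (\<lambda>i. g (Suc j + i)) (\<lambda>i. h (Suc j + i)) k)"
proof -
  obtain k where k: "x + y < (\<Sum>i=1..k. g i - inter2 i)"
    using assms(1) unfolding less_queue2_wait_iff by blast
  have le: "(\<Sum>i=1..m. g i - inter2 i) \<le> (\<Sum>i=1..m. g i - f (i - 1))" for m
    by (intro sum_mono diff_left_mono inter2_ge)
  show ?thesis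
  proof (cases "k \<le> j \<or> x < (\<Sum>i=1..j. g i - f (i - 1))")
    case True
    moreover have "x < (\<Sum>i=1..k. g i - f (i - 1))" using k le[of k] assms(2) by linarith
    ultimately show ?thesis by blast
  next
    case False
    then have jk: "j < k" by simp
    have "(\<Sum>i=1..k. g i - inter2 i) = (\<Sum>i=1..j. g i - inter2 i) + (\<Sum>i=Suc j..k. g i - inter2 i)"
      using jk sum.ub_add_nat[of 1 j "\<lambda>i. g i - inter2 i" "k - j"] by simp
    then have "y < (\<Sum>i=Suc j..k. g i - inter2 i)"
      using k le[of j] False by simp
    also have "\<dots> \<le> (\<Sum>i=Suc j..k. g i - h i) + f k + w k"
      using sum_inter2_from[of j k] jk w_nonneg[of j] nonneg(1)[of j] by simp
    finally have "y - (\<Sum>i=Suc j..k. g i - h i) - f k < w k" by simp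
    then obtain l where "y - (\<Sum>i=Suc j..k. g i - h i) - f k < q k l"
      using w_le[of k] by (meson not_le)
    then show ?thesis using path_le_dater[OF jk, of l] by (intro disjI2 exI[of _ "k - j + l"]) simp
  qed
qed

text \<open>The supremum at station 2 is bounded below by its partial sum at \<open>j\<close>, in
  which \<open>w 0\<close> enters negatively. Either \<open>w 0 <= C\<close>, or customer
  \<open>0\<close> still waits at station 1 because of customer \<open>j\<close>. In the latter case
  \<open>f j\<close> and \<open>w j\<close> cancel, and
  \<open>g j + p (j - 1) - q 0 (j - 1) - f 0\<close> remains, the growth of the queue at station 2
  while station 1 is busy. A big \<open>g j\<close> is effective in both cases, because
  \<open>w 0 - w j - f j <= C\<close> always holds.\<close>

lemma queue2_wait_lower:
  assumes C: "\<And>m. m < j \<Longrightarrow> q 0 m \<le> C" and j: "0 < j"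
  shows "p (j - 1) + g j - h j - C - f 0 > x \<Longrightarrow> ereal x < queue2_wait f g h"
    and "p (j - 1) + f j - h j - C - f 0 > x \<Longrightarrow> p (j - 1) - q 0 (j - 1) - f 0 > x \<Longrightarrow> ereal x < queue2_wait f g h"
proof -
  obtain l where l: "j = Suc l" using j by (cases j) auto
  have "w 0 \<le> max C (q 0 l + w l)"
    using w_le_add[of l 0 C] C l by simp
  also have "w l = max 0 (f j - h j + w j)" using w_rec[of l] l by simp
  finally have "w 0 \<le> max C (q 0 l + (f j - h j + w j))"
    using C[of l] l by (simp add: max_def split: if_splits)
  then have w0: "w 0 \<le> C \<or> w 0 \<le> q 0 l + (f j - h j + w j)" by (auto simp: max_def split: if_splits)
  have s: "(\<Sum>i=1..j. g i - inter2 i) = p l + (g j - h j) + w j + f j - w 0 - f 0"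
    by (simp only: sum_inter2) (simp add: l p_def)
  have "w 0 - w j - f j \<le> max C (q 0 l - h j)"
    using w0 w_nonneg[of j] nonneg(1)[of j] by auto
  moreover have "q 0 l - h j \<le> C" using C[of l] l nonneg(3)[of j] by simp
  ultimately have "w 0 - w j - f j \<le> C" by simp
  then have 1: "p l + g j - h j - C - f 0 \<le> (\<Sum>i=1..j. g i - inter2 i)" unfolding s by simp
  show "ereal x < queue2_wait f g h" if "p (j - 1) + g j - h j - C - f 0 > x"
    unfolding less_queue2_wait_iff using 1 that by (intro exI[of _ j]) (simp add: l)
  show "ereal x < queue2_wait f g h"
    if "p (j - 1) + f j - h j - C - f 0 > x" "p (j - 1) - q 0 (j - 1) - f 0 > x"
    unfolding less_queue2_wait_iff
  proof (intro exI[of _ j])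
    show "x < (\<Sum>i=1..j. g i - inter2 i)"
      unfolding s using w0 that w_nonneg[of j] nonneg(2)[of j] by (auto simp: l)
  qed
qed

text \<open>\<open>C\<close> collects the bounded terms: \<open>3 * L + a + e\<close> bounds the
  sums \<open>q 0\<close>, \<open>3 * L + b2 + e\<close> is lost in \<open>p\<close>, and
  \<open>b1 + e + L\<close> bounds \<open>f 0\<close>. The remaining \<open>L\<close> is for
  \<open>h j\<close>, which has its own assumption because \<open>lin_close\<close> up to
  \<open>j\<close> stops at the entry \<open>j - 1\<close>.\<close>

lemma queue2_wait_jump:
  assumes f: "lin_close e L b1 f j" and g: "lin_close e L b2 g j" and h: "lin_close e L a h j"
    and e: "0 \<le> e" "2 * e \<le> a - b1" and j: "0 < j" and hj: "h j \<le> L"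
  defines "C \<equiv> 8 * L + a + b1 + b2 + 3 * e"
  shows "x + real j * (a - b2 + 2 * e) + C < g j \<Longrightarrow> ereal x < queue2_wait f g h"
    and "x + real j * (a - b2 + 2 * e) + C < f j \<Longrightarrow> x + C < real j * (b2 - b1 - 2 * e) \<Longrightarrow>
      ereal x < queue2_wait f g h"
proof -
  have shift: "(\<Sum>i=1..k. u i) = (\<Sum>i<Suc k. u i) - u 0" for u :: "nat \<Rightarrow> real" and k
    by (induction k) auto
  have h0: "h 0 \<le> a + e + L" and g0: "g 0 \<le> b2 + e + L" and f0: "f 0 \<le> b1 + e + L"
    using lin_closeD(1)[OF h, of 1] lin_closeD(1)[OF g, of 1] lin_closeD(1)[OF f, of 1] j by auto
  have q: "q 0 m \<le> 3 * L + a + e" if "m < j" for m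
  proof -
    have "real (Suc m) * (2 * e) \<le> real (Suc m) * (a - b1)"
      using e by (intro mult_left_mono) auto
    then show ?thesis
      using lin_closeD(1)[OF f, of "Suc m"] lin_closeD(2)[OF h, of "Suc m"] that h0 nonneg(1)[of 0]
      unfolding q_def shift by (simp add: sum_subtractf algebra_simps)
  qed
  obtain l where l: "j = Suc l" using j by (cases j) auto
  have p: "- real j * (a - b2 + 2 * e) - (3 * L + b2 + e) \<le> p (j - 1)"
    using lin_closeD(2)[OF g, of j] lin_closeD(1)[OF h, of j] g0 nonneg(3)[of 0]
    unfolding p_def shift by (simp add: l sum_subtractf algebra_simps)
  have pq: "real j * (b2 - b1 - 2 * e) - (3 * L + b2 + e) \<le> p (j - 1) - q 0 (j - 1)"
    using lin_closeD(2)[OF g, of j] lin_closeD(1)[OF f, of j] g0 nonneg(1)[of 0]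
    unfolding p_def q_def shift by (simp add: l sum_subtractf algebra_simps)
  show "ereal x < queue2_wait f g h" if "x + real j * (a - b2 + 2 * e) + C < g j"
    using queue2_wait_lower(1)[OF q j, of x] that p f0 hj by (simp add: C_def)
  show "ereal x < queue2_wait f g h"
    if "x + real j * (a - b2 + 2 * e) + C < f j" "x + C < real j * (b2 - b1 - 2 * e)"
    using queue2_wait_lower(2)[OF q j, of x] that p pq f0 hj nonneg(3)[of 0] nonneg(3)[of j] h0
    unfolding C_def by linarith
qed

end

subsection \<open>Random walks on the sequence space\<close>

context sequence_space
begin

definition drop_seq :: "nat \<Rightarrow> (nat \<Rightarrow> 'a) \<Rightarrow> nat \<Rightarrow> 'a" where "drop_seq k \<xi> = (\<lambda>i. \<xi> (k + i))"

lemma drop_seq_measurable [measurable]: "drop_seq k \<in> S \<rightarrow>\<^sub>M S"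
proof -
  have "(\<lambda>\<xi>. \<lambda>i\<in>UNIV. \<xi> (k + i)) \<in> S \<rightarrow>\<^sub>M S"
    by (rule measurable_restrict) simp
  then show ?thesis by (simp add: drop_seq_def[abs_def] restrict_def)
qed

lemma drop_seq_comb_seq: "drop_seq j (comb_seq j \<xi> \<xi>') = \<xi>'"
  by (auto simp: drop_seq_def comb_seq_def)

text \<open>The Markov property: \<open>comb_seq j\<close> of two independent sequences has law
  \<open>S\<close> again, and \<open>dep\<close> says that \<open>\<phi>\<close> reads only the
  entries below \<open>j\<close> of its first argument.\<close>

lemma nn_integral_split:
  assumes [measurable]: "(\<lambda>(\<xi>, \<xi>'). \<phi> \<xi> \<xi>') \<in> borel_measurable (S \<Otimes>\<^sub>M S)"
    and dep: "\<And>\<xi> \<xi>' \<xi>''. \<phi> (comb_seq j \<xi> \<xi>') \<xi>'' = \<phi> \<xi> \<xi>''"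
  shows "(\<integral>\<^sup>+\<xi>. \<phi> \<xi> (drop_seq j \<xi>) \<partial>S) = (\<integral>\<^sup>+\<xi>. \<integral>\<^sup>+\<xi>'. \<phi> \<xi> \<xi>' \<partial>S \<partial>S)"
proof -
  have [measurable]: "(\<lambda>\<xi>. \<phi> \<xi> (drop_seq j \<xi>)) \<in> borel_measurable S"
    using measurable_compose[OF _ assms(1), of "\<lambda>\<xi>. (\<xi>, drop_seq j \<xi>)" S] by simp
  have "(\<integral>\<^sup>+\<xi>. \<phi> \<xi> (drop_seq j \<xi>) \<partial>S) =
      (\<integral>\<^sup>+\<xi>. \<phi> \<xi> (drop_seq j \<xi>) \<partial>distr (S \<Otimes>\<^sub>M S) S (\<lambda>(\<xi>, \<xi>'). comb_seq j \<xi> \<xi>'))"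
    by (simp add: PiM_comb_seq)
  also have "\<dots> = (\<integral>\<^sup>+p. (case p of (\<xi>, \<xi>') \<Rightarrow> \<phi> \<xi> \<xi>') \<partial>(S \<Otimes>\<^sub>M S))"
    by (subst nn_integral_distr) (auto simp: dep drop_seq_comb_seq split_beta' intro!: nn_integral_cong)
  also have "\<dots> = (\<integral>\<^sup>+\<xi>. \<integral>\<^sup>+\<xi>'. \<phi> \<xi> \<xi>' \<partial>S \<partial>S)"
    by (subst P.nn_integral_fst[symmetric]) auto
  finally show ?thesis .
qed

lemma prob_split:
  assumes [measurable]: "Measurable.pred S Q" "Measurable.pred S R"
    and dep: "\<And>\<xi> \<xi>'. Q (comb_seq j \<xi> \<xi>') = Q \<xi>"
  shows "\<P>(\<xi> in S. Q \<xi> \<and> R (drop_seq j \<xi>)) = \<P>(\<xi> in S. Q \<xi>) * \<P>(\<xi> in S. R \<xi>)"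
proof -
  have ind: "emeasure S {\<xi>\<in>space S. Q \<xi> \<and> R (drop_seq j \<xi>)}
      = (\<integral>\<^sup>+\<xi>. indicator {\<xi>\<in>space S. Q \<xi> \<and> R (drop_seq j \<xi>)} \<xi> \<partial>S)"
    by (rule nn_integral_indicator[symmetric]) measurable
  have "emeasure S {\<xi>\<in>space S. Q \<xi> \<and> R (drop_seq j \<xi>)}
      = (\<integral>\<^sup>+\<xi>. indicator {\<xi>. Q \<xi>} \<xi> * indicator {\<xi>\<in>space S. R \<xi>} (drop_seq j \<xi>) \<partial>S)"
    unfolding ind
    by (intro nn_integral_cong) (auto simp: measurable_space[OF drop_seq_measurable] split: split_indicator)
  also have "\<dots> = (\<integral>\<^sup>+\<xi>. \<integral>\<^sup>+\<xi>'. indicator {\<xi>. Q \<xi>} \<xi> * indicator {\<xi>\<in>space S. R \<xi>} \<xi>' \<partial>S \<partial>S)"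
    by (rule nn_integral_split) (auto simp: dep split: split_indicator)
  also have "\<dots> = (\<integral>\<^sup>+\<xi>. indicator {\<xi>\<in>space S. Q \<xi>} \<xi> * emeasure S {\<xi>\<in>space S. R \<xi>} \<partial>S)"
    by (subst nn_integral_cmult) (auto intro!: nn_integral_cong split: split_indicator)
  also have "\<dots> = emeasure S {\<xi>\<in>space S. Q \<xi>} * emeasure S {\<xi>\<in>space S. R \<xi>}"
    by (subst nn_integral_multc) auto
  finally show ?thesis
    by (simp add: measure_def enn2real_mult)
qed

lemma prob_drop_seq:
  assumes "Measurable.pred S R"
  shows "\<P>(\<xi> in S. R (drop_seq j \<xi>)) = \<P>(\<xi> in S. R \<xi>)"
  using prob_split[of "\<lambda>_. True" R j] assms P.prob_space by simp

lemma distr_drop_seq: "distr S S (drop_seq j) = S"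
proof (rule measure_eqI)
  fix A assume "A \<in> sets (distr S S (drop_seq j))"
  then have [measurable]: "A \<in> sets S" by simp
  have "\<P>(\<xi> in S. drop_seq j \<xi> \<in> A) = \<P>(\<xi> in S. \<xi> \<in> A)"
    by (rule prob_drop_seq) simp
  moreover have "drop_seq j -` A \<inter> space S = {\<xi>\<in>space S. drop_seq j \<xi> \<in> A}" "{\<xi>\<in>space S. \<xi> \<in> A} = A"
    using sets.sets_into_space[of A S] by auto
  ultimately show "emeasure (distr S S (drop_seq j)) A = emeasure S A"
    by (simp add: emeasure_distr P.emeasure_eq_measure)
qed simp

lemma distr_coordinate: "distr S M (\<lambda>\<xi>. \<xi> i) = M"
  by (rule distr_PiM_component) (auto intro: M.prob_space_axioms)

lemma prob_coordinate:
  assumes "Measurable.pred M r"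
  shows "\<P>(\<xi> in S. r (\<xi> i)) = \<P>(z in M. r z)"
proof -
  have "\<P>(z in M. r z) = \<P>(z in distr S M (\<lambda>\<xi>. \<xi> i). r z)"
    by (simp add: distr_coordinate)
  also have "\<dots> = \<P>(\<xi> in S. r (\<xi> i))"
    using assms by (subst measure_distr) (auto intro!: arg_cong[where f="measure S"] simp: space_PiM)
  finally show ?thesis by simp
qed

text \<open>The maximum \<open>m n\<close> of the first \<open>n\<close> partial sums satisfies \<open>m (n + 1) = max 0 (g + m n)\<close>
  with independent summands and has increasing means. On the shift-invariant event that \<open>m n\<close>
  tends to infinity the truncation at \<open>0\<close> disappears in the limit, so that there the mean of \<open>g\<close>
  would have to be nonnegative.\<close>

lemma walk_bounded_AE:
  fixes g :: "'a \<Rightarrow> real"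
  assumes g[measurable]: "integrable M g" and neg: "integral\<^sup>L M g < 0"
  shows "AE \<xi> in S. \<exists>L. \<forall>n. (\<Sum>i<n. g (\<xi> i)) \<le> L"
proof -
  define m where "m = rec_nat (\<lambda>_. 0) (\<lambda>n u \<xi>. max 0 (g (\<xi> 0) + u (drop_seq 1 \<xi>)))"
  have m0: "m 0 = (\<lambda>_. 0)" and mS: "m (Suc n) = (\<lambda>\<xi>. max 0 (g (\<xi> 0) + m n (drop_seq 1 \<xi>)))" for n
    by (simp_all add: m_def)
  have gm[measurable]: "g \<in> borel_measurable M" using g by simp
  have [measurable]: "m n \<in> borel_measurable S" for n
  proof (induction n)
    case (Suc n)
    note [measurable] = Suc
    show ?case unfolding mS by measurable
  qed (simp add: m0)
  have mono1: "m n \<xi> \<le> m (Suc n) \<xi>" for n \<xi>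
  proof (induction n arbitrary: \<xi>)
    case (Suc n)
    have "m (Suc (Suc n)) \<xi> = max 0 (g (\<xi> 0) + m (Suc n) (drop_seq 1 \<xi>))"
      "m (Suc n) \<xi> = max 0 (g (\<xi> 0) + m n (drop_seq 1 \<xi>))"
      by (simp_all only: mS[of "Suc n"] mS[of n])
    then show ?case using Suc[of "drop_seq 1 \<xi>"] by (auto simp: max_def)
  qed (simp add: m0 mS)
  then have inc: "incseq (\<lambda>n. m n \<xi>)" for \<xi> by (rule incseq_SucI)
  have nonneg: "0 \<le> m n \<xi>" for n \<xi> by (cases n) (auto simp: m0 mS)
  have g0: "integrable S (\<lambda>\<xi>. g (\<xi> 0))"
    using g integrable_distr_eq[of "\<lambda>\<xi>. \<xi> 0" S M g] by (simp add: distr_coordinate)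
  have int_drop_seq: "integrable S (\<lambda>\<xi>. u (drop_seq 1 \<xi>))" and
    integral_drop_seq: "(\<integral>\<xi>. u (drop_seq 1 \<xi>) \<partial>S) = (\<integral>\<xi>. u \<xi> \<partial>S)" if "integrable S u" for u :: "_ \<Rightarrow> real"
  proof -
    have [measurable]: "u \<in> borel_measurable S" using that by simp
    show "integrable S (\<lambda>\<xi>. u (drop_seq 1 \<xi>))"
      using that integrable_distr_eq[of "drop_seq 1" S S u] by (simp add: distr_drop_seq)
    show "(\<integral>\<xi>. u (drop_seq 1 \<xi>) \<partial>S) = (\<integral>\<xi>. u \<xi> \<partial>S)"
      using integral_distr[of "drop_seq 1" S S u] by (simp add: distr_drop_seq)
  qed
  have int: "integrable S (m n)" for n
  proof (induction n)
    case (Suc n)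
    have "integrable S (\<lambda>\<xi>. g (\<xi> 0) + m n (drop_seq 1 \<xi>))"
      using g0 int_drop_seq[OF Suc] by (rule Bochner_Integration.integrable_add)
    then show ?case unfolding mS by (intro integrable_max) simp_all
  qed (simp add: m0)
  define E where "E = {\<xi>\<in>space S. \<forall>L::nat. \<exists>n. real L < m n \<xi>}"
  have [measurable]: "E \<in> sets S" unfolding E_def by measurable
  have inv: "\<xi> \<in> E \<longleftrightarrow> drop_seq 1 \<xi> \<in> E" if "\<xi> \<in> space S" for \<xi>
  proof
    assume "\<xi> \<in> E"
    have "\<exists>n. real L < m n (drop_seq 1 \<xi>)" for L
    proof -
      obtain L' :: nat where L': "real L + \<bar>g (\<xi> 0)\<bar> < L'" using reals_Archimedean2 by blast
      obtain n where "real L' < m n \<xi>" using \<open>\<xi> \<in> E\<close> by (auto simp: E_def)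
      then show ?thesis using L' by (cases n) (auto simp: m0 mS intro!: exI[of _ "n - 1"])
    qed
    then show "drop_seq 1 \<xi> \<in> E"
      using measurable_space[OF drop_seq_measurable that] by (auto simp: E_def)
  next
    assume E1: "drop_seq 1 \<xi> \<in> E"
    have "\<exists>n. real L < m n \<xi>" for L
    proof -
      obtain L' :: nat where L': "real L + \<bar>g (\<xi> 0)\<bar> < L'" using reals_Archimedean2 by blast
      obtain n where "real L' < m n (drop_seq 1 \<xi>)" using E1 by (auto simp: E_def)
      then show ?thesis using L' by (intro exI[of _ "Suc n"]) (auto simp: mS)
    qed
    then show "\<xi> \<in> E" using that by (auto simp: E_def)
  qed
  \<comment> \<open>As \<open>max 0 (v + u) - u = max (- u) v\<close>, this is the increment from
    \<open>m n (drop_seq 1 \<xi>)\<close> to \<open>m (Suc n) \<xi>\<close> on \<open>E\<close>, in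
    a form that is visibly dominated by \<open>\<bar>g (\<xi> 0)\<bar>\<close>.\<close>
  define Z where "Z n \<xi> = indicator E \<xi> * max (- m n (drop_seq 1 \<xi>)) (g (\<xi> 0))" for n \<xi>
  have Z_nonneg: "0 \<le> (\<integral>\<xi>. Z n \<xi> \<partial>S)" for n
  proof -
    have i1: "integrable S (\<lambda>\<xi>. indicator E \<xi> * m k \<xi>)" for k
      using integrable_mult_indicator[OF _ int[of k], of E] by simp
    have "Z n \<xi> = indicator E \<xi> * m (Suc n) \<xi> - indicator E (drop_seq 1 \<xi>) * m n (drop_seq 1 \<xi>)"
      if "\<xi> \<in> space S" for \<xi>
      using inv[OF that] by (auto simp: Z_def mS split: split_indicator)
    then have "(\<integral>\<xi>. Z n \<xi> \<partial>S) = (\<integral>\<xi>. indicator E \<xi> * m (Suc n) \<xi> - indicator E (drop_seq 1 \<xi>) * m n (drop_seq 1 \<xi>) \<partial>S)"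
      by (intro Bochner_Integration.integral_cong) auto
    also have "\<dots> = (\<integral>\<xi>. indicator E \<xi> * m (Suc n) \<xi> \<partial>S) - (\<integral>\<xi>. indicator E \<xi> * m n \<xi> \<partial>S)"
      using integral_drop_seq[OF i1[of n]] int_drop_seq[OF i1[of n]] i1[of "Suc n"] by simp
    also have "\<dots> \<ge> 0"
      using integral_mono[OF i1[of n] i1[of "Suc n"]] mono1 by (simp add: mult_left_mono)
    finally show ?thesis .
  qed
  have "(\<lambda>n. \<integral>\<xi>. Z n \<xi> \<partial>S) \<longlonglongrightarrow> (\<integral>\<xi>. indicator E \<xi> * g (\<xi> 0) \<partial>S)"
  proof (rule integral_dominated_convergence[where w="\<lambda>\<xi>. \<bar>g (\<xi> 0)\<bar>"])
    show "integrable S (\<lambda>\<xi>. \<bar>g (\<xi> 0)\<bar>)" using g0 by simp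
    show "AE \<xi> in S. (\<lambda>n. Z n \<xi>) \<longlonglongrightarrow> indicator E \<xi> * g (\<xi> 0)"
    proof (intro AE_I2)
      fix \<xi> assume sp: "\<xi> \<in> space S"
      show "(\<lambda>n. Z n \<xi>) \<longlonglongrightarrow> indicator E \<xi> * g (\<xi> 0)"
      proof (cases "\<xi> \<in> E")
        case True
        obtain L :: nat where L: "\<bar>g (\<xi> 0)\<bar> < L" using reals_Archimedean2 by blast
        obtain k where "real L < m k (drop_seq 1 \<xi>)" using True inv[OF sp] by (auto simp: E_def)
        then have "Z n \<xi> = indicator E \<xi> * g (\<xi> 0)" if "k \<le> n" for n
          using incseqD[OF inc that, of "drop_seq 1 \<xi>"] L by (auto simp: Z_def max_def)
        then show ?thesis
          by (intro tendsto_eventually) (auto simp: eventually_sequentially)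
      qed (simp add: Z_def)
    qed
    show "AE \<xi> in S. norm (Z n \<xi>) \<le> \<bar>g (\<xi> 0)\<bar>" for n
    proof (intro AE_I2)
      fix \<xi>
      have "\<bar>max (- u) v\<bar> \<le> \<bar>v\<bar>" if "0 \<le> u" for u v :: real
        using that by auto
      from this[OF nonneg[of n]] show "norm (Z n \<xi>) \<le> \<bar>g (\<xi> 0)\<bar>"
        by (auto simp: Z_def split: split_indicator)
    qed
    show "Z n \<in> borel_measurable S" for n
      unfolding Z_def[abs_def] by measurable
  qed simp
  then have "0 \<le> (\<integral>\<xi>. indicator E \<xi> * g (\<xi> 0) \<partial>S)"
    using Z_nonneg by (intro tendsto_lowerbound[where F=sequentially]) auto
  \<comment> \<open>By invariance, \<open>E\<close> may be replaced by an event about the entries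
    from \<open>1\<close> on, which is independent of \<open>\<xi> 0\<close>. The integral then
    factors into \<open>measure S E\<close> and the negative mean.\<close>
  also have "\<dots> = (\<integral>\<xi>. indicator E (drop_seq 1 \<xi>) * g (\<xi> 0) \<partial>S)"
    using inv by (intro Bochner_Integration.integral_cong) (auto split: split_indicator)
  also have "\<dots> = (\<integral>\<xi>. indicator E (drop_seq 1 \<xi>) * g (\<xi> 0) \<partial>distr (M \<Otimes>\<^sub>M S) S (\<lambda>(s, \<xi>). case_nat s \<xi>))"
    by (simp add: PiM_iter)
  also have "\<dots> = (\<integral>p. indicator E (snd p) * g (fst p) \<partial>(M \<Otimes>\<^sub>M S))"
  proof (subst integral_distr)
    have "drop_seq 1 (case_nat z \<xi>) = \<xi>" for z and \<xi> :: "nat \<Rightarrow> 'a"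
      by (simp add: drop_seq_def fun_eq_iff)
    then show "(\<integral>p. indicator E (drop_seq 1 (case p of (s, \<xi>) \<Rightarrow> case_nat s \<xi>)) * g ((case p of (s, \<xi>) \<Rightarrow> case_nat s \<xi>) 0) \<partial>(M \<Otimes>\<^sub>M S))
      = (\<integral>p. indicator E (snd p) * g (fst p) \<partial>(M \<Otimes>\<^sub>M S))"
      by (simp add: split_beta')
  qed measurable
  also have "\<dots> = (\<integral>z. (\<integral>\<xi>. indicator E \<xi> * g z \<partial>S) \<partial>M)"
  proof -
    have "integrable (M \<Otimes>\<^sub>M S) (\<lambda>p. g (fst p))"
      using g integrable_distr_eq[of fst "M \<Otimes>\<^sub>M S" M g] by (simp add: distr_pair_fst P.prob_space_axioms)
    from integrable_mult_indicator[OF _ this, of "space M \<times> E"]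
    have "integrable (M \<Otimes>\<^sub>M S) (\<lambda>p. indicator E (snd p) * g (fst p))"
      by (rule Bochner_Integration.integrable_cong[THEN iffD1, rotated 2])
         (auto simp: space_pair_measure split: split_indicator)
    interpret MS: pair_sigma_finite M S ..
    show ?thesis
      using MS.integral_fst'[OF \<open>integrable (M \<Otimes>\<^sub>M S) (\<lambda>p. indicator E (snd p) * g (fst p))\<close>] by simp
  qed
  also have "\<dots> = measure S E * integral\<^sup>L M g" by simp
  finally have "measure S E = 0"
    using neg by (metis measure_nonneg mult_pos_neg not_le order_le_less)
  then have "AE \<xi> in S. \<xi> \<notin> E"
    by (subst AE_iff_null_sets[symmetric]) (auto simp: null_sets_def P.emeasure_eq_measure)
  note notin = this
  have sum_le: "(\<Sum>i<n. g (\<xi> i)) \<le> m n \<xi>" for n \<xi>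
  proof (induction n arbitrary: \<xi>)
    case (Suc n)
    show ?case
      using Suc[of "drop_seq 1 \<xi>"]
      by (simp add: sum.lessThan_Suc_shift mS drop_seq_def del: sum.lessThan_Suc)
  qed (simp add: m0)
  from notin AE_space show ?thesis
  proof eventually_elim
    case (elim \<xi>)
    then obtain L :: nat where L: "\<And>n. m n \<xi> \<le> real L"
      by (auto simp: E_def not_less)
    have "(\<Sum>i<n. g (\<xi> i)) \<le> real L" for n
      using sum_le L by (rule order_trans)
    then show ?case by blast
  qed
qed

text \<open>Almost sure boundedness means that the exceedance events decrease to a null set as
  \<open>L\<close> grows.\<close>

lemma walk_bounded:
  fixes g :: "'a \<Rightarrow> real"
  assumes g: "integrable M g" and neg: "integral\<^sup>L M g < 0" and "0 < d"
  shows "\<exists>L0. \<forall>L\<ge>L0. \<P>(\<xi> in S. \<exists>n. L < (\<Sum>i<n. g (\<xi> i))) \<le> d"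
proof -
  have [measurable]: "g \<in> borel_measurable M" using g by simp
  define A where "A L = {\<xi>\<in>space S. \<exists>n. L < (\<Sum>i<n. g (\<xi> i))}" for L
  have [measurable]: "A L \<in> sets S" for L unfolding A_def by measurable
  have A_mono: "A L' \<subseteq> A L" if "L \<le> L'" for L L'
    using that unfolding A_def by (auto) (meson le_less_trans)
  have "(\<lambda>k. measure S (A (real k))) \<longlonglongrightarrow> measure S (\<Inter>k. A (real k))"
    by (rule P.finite_Lim_measure_decseq) (use A_mono in \<open>auto simp: decseq_def\<close>)
  also have "measure S (\<Inter>k. A (real k)) = 0"
  proof -
    have "AE \<xi> in S. \<xi> \<notin> (\<Inter>k. A (real k))"
      using walk_bounded_AE[OF g neg]
    proof eventually_elim
      case (elim \<xi>)
      then obtain L where "\<And>n. (\<Sum>i<n. g (\<xi> i)) \<le> L" by blast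
      moreover obtain k :: nat where "L < k" using reals_Archimedean2 by blast
      ultimately show ?case by (auto simp: A_def not_less intro!: exI[of _ k] intro: order_trans less_imp_le)
    qed
    then show ?thesis by (subst (asm) AE_iff_null_sets[symmetric]) (auto simp: measure_eq_0_null_sets)
  qed
  finally have "eventually (\<lambda>k. measure S (A (real k)) < d) sequentially"
    using order_tendstoD(2) assms(3) by blast
  then obtain k where k: "measure S (A (real k)) < d" by (auto simp: eventually_sequentially)
  have "measure S (A L) \<le> d" if "real k \<le> L" for L
    using k P.finite_measure_mono[OF A_mono[OF that]] by simp
  then show ?thesis unfolding A_def by blast
qed

text \<open>The two one-sided deviations are walks with steps \<open>u - m - e\<close> and
  \<open>m - e - u\<close>, both of mean \<open>- e\<close>; bounds on their suprema supply the
  offset \<open>L\<close>.\<close>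

lemma prob_lin_close:
  fixes u :: "'a \<Rightarrow> real"
  assumes u: "integrable M u" and m: "integral\<^sup>L M u = m" and "0 < e" "0 < d"
  shows "\<exists>L0. \<forall>L\<ge>L0. \<P>(\<xi> in S. \<not> (\<forall>n. lin_close e L m (\<lambda>i. u (\<xi> i)) n)) \<le> d"
proof -
  have [measurable]: "u \<in> borel_measurable M" using u by simp
  have "integrable M (\<lambda>z. u z - m - e)" "integral\<^sup>L M (\<lambda>z. u z - m - e) < 0"
    "integrable M (\<lambda>z. m - e - u z)" "integral\<^sup>L M (\<lambda>z. m - e - u z) < 0"
    using assms by (simp_all add: M.prob_space)
  from walk_bounded[OF this(1,2), of "d/2"] walk_bounded[OF this(3,4), of "d/2"] assms
  obtain L1 L2 where L1: "\<And>L. L1 \<le> L \<Longrightarrow> \<P>(\<xi> in S. \<exists>n. L < (\<Sum>i<n. u (\<xi> i) - m - e)) \<le> d / 2"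
    and L2: "\<And>L. L2 \<le> L \<Longrightarrow> \<P>(\<xi> in S. \<exists>n. L < (\<Sum>i<n. m - e - u (\<xi> i))) \<le> d / 2"
    by auto
  have "\<P>(\<xi> in S. \<not> (\<forall>n. lin_close e L m (\<lambda>i. u (\<xi> i)) n)) \<le> d" if L: "max L1 L2 \<le> L" for L
  proof -
    have "{\<xi>\<in>space S. \<not> (\<forall>n. lin_close e L m (\<lambda>i. u (\<xi> i)) n)} \<subseteq>
        {\<xi>\<in>space S. \<exists>n. L < (\<Sum>i<n. u (\<xi> i) - m - e)} \<union> {\<xi>\<in>space S. \<exists>n. L < (\<Sum>i<n. m - e - u (\<xi> i))}"
    proof
      fix \<xi> assume "\<xi> \<in> {\<xi>\<in>space S. \<not> (\<forall>n. lin_close e L m (\<lambda>i. u (\<xi> i)) n)}"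
      then obtain j where "\<xi> \<in> space S" "e * real j + L < \<bar>(\<Sum>i<j. u (\<xi> i)) - real j * m\<bar>"
        by (auto simp: lin_close_def not_le)
      then show "\<xi> \<in> {\<xi>\<in>space S. \<exists>n. L < (\<Sum>i<n. u (\<xi> i) - m - e)} \<union> {\<xi>\<in>space S. \<exists>n. L < (\<Sum>i<n. m - e - u (\<xi> i))}"
        by (auto simp: sum_subtractf sum.distrib abs_if algebra_simps split: if_splits intro!: exI[of _ j])
    qed
    then have "\<P>(\<xi> in S. \<not> (\<forall>n. lin_close e L m (\<lambda>i. u (\<xi> i)) n)) \<le>
        measure S ({\<xi>\<in>space S. \<exists>n. L < (\<Sum>i<n. u (\<xi> i) - m - e)} \<union> {\<xi>\<in>space S. \<exists>n. L < (\<Sum>i<n. m - e - u (\<xi> i))})"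
      by (intro P.finite_measure_mono) auto
    also have "\<dots> \<le> d / 2 + d / 2"
      using L by (intro order_trans[OF measure_Un_le] add_mono L1 L2) auto
    finally show ?thesis by simp
  qed
  then show ?thesis by blast
qed

end

lemma dater_cong:
  assumes "\<And>i. i < j \<Longrightarrow> f i = f' i" "\<And>i. i < j \<Longrightarrow> g i = g' i" "\<And>i. i < j \<Longrightarrow> h i = h' i"
  shows "dater f g h j = dater f' g' h' j"
  using assms
proof (induction j)
  case (Suc j)
  have "(\<Sum>i\<le>j. g i - h i) = (\<Sum>i\<le>j. g' i - h' i)"
    using Suc.prems by (intro sum.cong) auto
  then show ?case using Suc by simp
qed simp

subsection \<open>First passage of the dater\<close>

text \<open>\<open>N\<close> is the law of the marks of one customer, and entry \<open>i\<close> of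
  a sequence under \<open>S\<close> belongs to customer \<open>-i\<close>. Independence within one
  customer is split into \<open>indep12\<close> and \<open>indep3\<close>, the latter in the form in
  which the lower bound restricts a jump to \<open>t <= L\<close>.\<close>

locale iid_tandem = sequence_space N + subexponential_pair F
  for N :: "'a measure" and F :: "real \<Rightarrow> real" +
  fixes s1 s2 t :: "'a \<Rightarrow> real" and b1 b2 a d1 d2 :: real
  assumes nonneg: "\<And>z. 0 \<le> s1 z" "\<And>z. 0 \<le> s2 z" "\<And>z. 0 \<le> t z"
    and int: "integrable N s1" "integrable N s2" "integrable N t"
    and mean: "integral\<^sup>L N s1 = b1" "integral\<^sup>L N s2 = b2" "integral\<^sup>L N t = a"
    and indep12: "prob_space.indep_var N borel s1 borel s2"
    and indep3: "\<And>A L. A \<in> sets (borel \<Otimes>\<^sub>M borel) \<Longrightarrow>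
      \<P>(z in N. (s1 z, s2 z) \<in> A \<and> t z \<le> L) = \<P>(z in N. (s1 z, s2 z) \<in> A) * \<P>(z in N. t z \<le> L)"
    and tail1: "asymp_tail (\<lambda>x. \<P>(z in N. x < s1 z)) d1"
    and tail2: "asymp_tail (\<lambda>x. \<P>(z in N. x < s2 z)) d2"
    and d: "0 \<le> d1" "0 \<le> d2"
    and b: "b1 < b2" "b2 < a"
begin

definition q1 where "q1 x = \<P>(z in N. x < s1 z)"
definition q2 where "q2 x = \<P>(z in N. x < s2 z)"
definition q12 where "q12 x = \<P>(z in N. x < s1 z + s2 z)"
definition r where "r K x = \<P>(z in N. K < s1 z \<and> K < s2 z \<and> x < s1 z + s2 z)"

lemma meas [measurable]:
  "s1 \<in> borel_measurable N" "s2 \<in> borel_measurable N" "t \<in> borel_measurable N"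
  by (fact int[THEN borel_measurable_integrable])+

lemma q_nonneg: "0 \<le> q1 x" "0 \<le> q2 x" "0 \<le> q12 x" "0 \<le> r K x"
  by (simp_all add: q1_def q2_def q12_def r_def)

lemma q_antimono: "x \<le> y \<Longrightarrow> q1 y \<le> q1 x" "x \<le> y \<Longrightarrow> q2 y \<le> q2 x"
  unfolding q1_def q2_def by (auto intro!: M.finite_measure_mono)

lemma b_nonneg: "0 \<le> b1" "0 \<le> b2" "0 \<le> a"
  unfolding mean[symmetric] by (intro integral_nonneg_AE AE_I2 nonneg)+

lemma tail_le: "\<exists>C\<ge>0. \<exists>y0\<ge>0. \<forall>y\<ge>y0. q1 y \<le> C * Fb y \<and> q2 y \<le> C * Fb y"
proof -
  obtain y1 y2 where y: "\<And>y. y1 \<le> y \<Longrightarrow> q1 y \<le> (d1 + 1) * Fb y" "\<And>y. y2 \<le> y \<Longrightarrow> q2 y \<le> (d2 + 1) * Fb y"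
    using asymp_tail_imp_le[OF tail1 d(1)] asymp_tail_imp_le[OF tail2 d(2)]
    unfolding q1_def[symmetric] q2_def[symmetric] by blast
  have "(d1 + 1) * Fb y \<le> (d1 + d2 + 1) * Fb y" "(d2 + 1) * Fb y \<le> (d1 + d2 + 1) * Fb y" for y
    using d Fb_pos[of y] by (auto intro!: mult_right_mono)
  then show ?thesis
    using d by (intro exI[of _ "d1 + d2 + 1"] conjI exI[of _ "max 0 (max y1 y2)"])
      (auto intro: order_trans[OF y(1)] order_trans[OF y(2)])
qed

text \<open>If the sum exceeds \<open>x\<close> and neither summand exceeds \<open>x - K\<close>,
  then both exceed \<open>K\<close>.\<close>

lemma q12_le: "q12 x \<le> q1 (x - K) + q2 (x - K) + r K x"
proof -
  have "q12 x \<le> measure N ({z\<in>space N. x - K < s1 z} \<union> {z\<in>space N. x - K < s2 z} \<union>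
      {z\<in>space N. K < s1 z \<and> K < s2 z \<and> x < s1 z + s2 z})"
    unfolding q12_def by (intro M.finite_measure_mono) auto
  also have "\<dots> \<le> q1 (x - K) + q2 (x - K) + r K x"
    unfolding q1_def q2_def r_def
    by (intro order_trans[OF measure_Un_le] add_mono order_refl) auto
  finally show ?thesis .
qed

text \<open>This is where \<open>F\<close> itself has to be subexponential: one customer hardly ever
  has two big service times. Their laws are replaced by that of \<open>F\<close> one after the
  other, as only the tails from \<open>K\<close> on matter.\<close>

lemma r_small:
  assumes "0 < \<eta>"
  shows "\<exists>K\<ge>0. eventually (\<lambda>x. r K x \<le> \<eta> * Fb x) at_top"
proof -
  obtain C y0 where C: "0 \<le> C" "0 \<le> y0" and q: "\<And>y. y0 \<le> y \<Longrightarrow> q1 y \<le> C * Fb y" "\<And>y. y0 \<le> y \<Longrightarrow> q2 y \<le> C * Fb y"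
    using tail_le by blast
  \<comment> \<open>Each of the two replacements costs a factor \<open>C\<close>, and
    \<open>2 * Fb K + e\<close> is at most \<open>3 * e\<close> once
    \<open>Fb K < e\<close>.\<close>
  define e where "e = \<eta> / (3 * (C * C + 1))"
  have e: "0 < e" "C * (C * (3 * e)) \<le> \<eta>"
  proof -
    have "0 < C * C + 1" using C by (simp add: add_nonneg_pos)
    then show "0 < e" using assms by (simp add: e_def)
    have "C * C * (3 * e) \<le> (C * C + 1) * (3 * e)" using \<open>0 < e\<close> by (intro mult_right_mono) auto
    also have "\<dots> = \<eta>" using \<open>0 < C * C + 1\<close> by (simp add: e_def field_simps)
    finally show "C * (C * (3 * e)) \<le> \<eta>" by (simp add: mult.assoc)
  qed
  have "eventually (\<lambda>K. Fb K < e \<and> y0 \<le> K) at_top"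
    by (intro eventually_conj order_tendstoD(2)[OF tail_tendsto_0[OF F_df] e(1)] eventually_ge_at_top)
  then obtain K where K: "Fb K < e" "y0 \<le> K" by (auto simp: eventually_at_top_linorder)
  then have K0: "0 \<le> K" using C by simp
  have "eventually (\<lambda>x. r K x \<le> \<eta> * Fb x) at_top"
    using subexponential_both_large[OF F K0 e(1)]
  proof eventually_elim
    case (elim x)
    let ?A = "(both_large K x)"
    let ?N1 = "distr N borel s1" and ?N2 = "distr N borel s2" and ?\<mu> = "interval_measure F"
    interpret \<mu>: real_distribution ?\<mu> by (rule nonneg_df_real_distribution[OF F_df])
    have ps: "prob_space ?N1" "prob_space ?N2" by (simp_all add: M.prob_space_distr)
    have t: "measure ?N1 {y<..} = q1 y" "measure ?N2 {y<..} = q2 y" for y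
      by (subst measure_distr, auto simp: q1_def q2_def intro!: arg_cong[where f="measure N"])+
    have \<mu>t: "measure ?\<mu> {y<..} = Fb y" for y
      by (rule measure_greaterThan_eq_tail[OF F_df])
    have "distr N (borel \<Otimes>\<^sub>M borel) (\<lambda>z. (s1 z, s2 z)) = ?N1 \<Otimes>\<^sub>M ?N2"
      using indep12[unfolded M.indep_var_distribution_eq] by simp
    then have "measure (?N1 \<Otimes>\<^sub>M ?N2) ?A = measure (distr N (borel \<Otimes>\<^sub>M borel) (\<lambda>z. (s1 z, s2 z))) ?A"
      by simp
    also have "\<dots> = r K x"
      unfolding r_def
      by (subst measure_distr) (auto intro!: arg_cong[where f="measure N"] both_large_sets)
    finally have "r K x = measure (?N1 \<Otimes>\<^sub>M ?N2) ?A" ..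
    also have "\<dots> \<le> C * measure (?N1 \<Otimes>\<^sub>M ?\<mu>) ?A"
      using K by (intro both_large_tail_mono ps \<mu>.prob_space_axioms C) (auto simp: t \<mu>t intro!: q)
    also have "measure (?N1 \<Otimes>\<^sub>M ?\<mu>) ?A = measure (?\<mu> \<Otimes>\<^sub>M ?N1) ?A"
      by (intro both_large_swap ps \<mu>.prob_space_axioms) auto
    also have "C * measure (?\<mu> \<Otimes>\<^sub>M ?N1) ?A \<le> C * (C * measure (?\<mu> \<Otimes>\<^sub>M ?\<mu>) ?A)"
      using K by (intro mult_left_mono both_large_tail_mono ps \<mu>.prob_space_axioms C) (auto simp: t \<mu>t intro!: q)
    also have "\<dots> \<le> C * (C * ((2 * Fb K + e) * Fb x))"
      using elim by (intro mult_left_mono C)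
    also have "\<dots> \<le> C * (C * ((3 * e) * Fb x))"
      using K Fb_pos[of x] by (intro mult_left_mono mult_right_mono C) auto
    also have "\<dots> \<le> \<eta> * Fb x"
      using mult_right_mono[OF e(2), of "Fb x"] Fb_pos[of x] by (simp add: mult.assoc)
    finally show ?case .
  qed
  with K0 show ?thesis by blast
qed

lemma q12_tail_le: "\<exists>C\<ge>0. \<exists>y0. \<forall>y\<ge>y0. q12 y \<le> C * Fb y"
proof -
  obtain C y0 where C: "0 \<le> C" "0 \<le> y0" and q: "\<And>y. y0 \<le> y \<Longrightarrow> q1 y \<le> C * Fb y" "\<And>y. y0 \<le> y \<Longrightarrow> q2 y \<le> C * Fb y"
    using tail_le by blast
  obtain K where K: "0 \<le> K" "eventually (\<lambda>x. r K x \<le> 1 * Fb x) at_top"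
    using r_small[of 1] by auto
  have "eventually (\<lambda>x. q12 x \<le> (4 * C + 1) * Fb x) at_top"
    using K(2) subexponential_long_tailed[OF F K(1), of 1, simplified] eventually_ge_at_top[of "y0 + K"]
  proof eventually_elim
    case (elim x)
    have "C * Fb (x - K) \<le> C * (2 * Fb x)" using elim C by (intro mult_left_mono) auto
    then show ?case
      using q12_le[of x K] q(1)[of "x - K"] q(2)[of "x - K"] elim by (simp add: algebra_simps)
  qed
  then show ?thesis using C by (intro exI[of _ "4 * C + 1"]) (auto simp: eventually_at_top_linorder)
qed

section \<open>The dater as a random sequence\<close>

definition dat :: "(nat \<Rightarrow> 'a) \<Rightarrow> nat \<Rightarrow> real" where
  "dat \<xi> = dater (\<lambda>i. s1 (\<xi> i)) (\<lambda>i. s2 (\<xi> i)) (\<lambda>i. t (\<xi> i))"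

abbreviation exceeds :: "real \<Rightarrow> (nat \<Rightarrow> 'a) \<Rightarrow> bool" where
  "exceeds x \<xi> \<equiv> \<exists>k. x < dat \<xi> k"

abbreviation jump :: "real \<Rightarrow> real \<Rightarrow> (nat \<Rightarrow> 'a) \<Rightarrow> bool" where
  "jump y c \<xi> \<equiv> \<exists>i. y + c * real i < s1 (\<xi> i) + s2 (\<xi> i)"

abbreviation no_jump :: "real \<Rightarrow> real \<Rightarrow> real \<Rightarrow> real" where
  "no_jump y c x \<equiv> \<P>(\<xi> in S. exceeds x \<xi> \<and> \<not> jump y c \<xi>)"

definition dat_tail :: "real \<Rightarrow> real" where "dat_tail x = \<P>(\<xi> in S. exceeds x \<xi>)"

definition good :: "real \<Rightarrow> real \<Rightarrow> nat \<Rightarrow> (nat \<Rightarrow> 'a) \<Rightarrow> bool" where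
  "good e L n \<xi> \<longleftrightarrow> lin_close e L b1 (\<lambda>i. s1 (\<xi> i)) n \<and> lin_close e L b2 (\<lambda>i. s2 (\<xi> i)) n \<and>
     lin_close e L a (\<lambda>i. t (\<xi> i)) n"

abbreviation bad :: "real \<Rightarrow> real \<Rightarrow> real" where
  "bad e L \<equiv> \<P>(\<xi> in S. \<not> (\<forall>n. good e L n \<xi>))"

lemma dat_measurable [measurable]: "(\<lambda>\<xi>. dat \<xi> j) \<in> borel_measurable S"
proof (induction j)
  case (Suc j)
  note [measurable] = Suc[unfolded dat_def]
  show ?case unfolding dat_def dater.simps by measurable
qed (simp add: dat_def)

lemma lin_close_measurable [measurable]:
  assumes [measurable]: "u \<in> borel_measurable N"
  shows "Measurable.pred S (\<lambda>\<xi>. lin_close e L m (\<lambda>i. u (\<xi> i)) n)"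
  unfolding lin_close_def by measurable

lemma good_measurable [measurable]: "Measurable.pred S (good e L n)"
  unfolding good_def[abs_def] by measurable

lemma dat_0 [simp]: "dat \<xi> 0 = 0" by (simp add: dat_def)

lemma dat_comb_seq: "i \<le> j \<Longrightarrow> dat (comb_seq j \<xi> \<xi>') i = dat \<xi> i"
  unfolding dat_def by (intro dater_cong) (simp_all add: comb_seq_def)

lemma good_comb_seq: "n \<le> j \<Longrightarrow> good e L n (comb_seq j \<xi> \<xi>') = good e L n \<xi>"
  by (simp add: good_def lin_close_def comb_seq_def)

lemma dat_add_le: "dat \<xi> (m + k) \<le> dat \<xi> m + dat (drop_seq m \<xi>) k"
  unfolding dat_def drop_seq_def by (rule dater_add_le) (rule nonneg)

lemma dat_Suc_le: "dat \<xi> (Suc j) \<le> dat \<xi> j + (s1 (\<xi> j) + s2 (\<xi> j))"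
  unfolding dat_def by (rule dater_Suc_le) (simp_all add: nonneg)

lemma prob_good:
  assumes "0 < e" "0 < \<delta>"
  shows "\<exists>L0\<ge>0. \<forall>L\<ge>L0. bad e L \<le> \<delta>"
proof -
  have "0 < \<delta> / 3" using assms by simp
  from prob_lin_close[OF int(1) mean(1) assms(1) this] prob_lin_close[OF int(2) mean(2) assms(1) this]
    prob_lin_close[OF int(3) mean(3) assms(1) this]
  obtain L1 L2 L3 where
    L: "\<And>L. L1 \<le> L \<Longrightarrow> \<P>(\<xi> in S. \<not> (\<forall>n. lin_close e L b1 (\<lambda>i. s1 (\<xi> i)) n)) \<le> \<delta> / 3"
      "\<And>L. L2 \<le> L \<Longrightarrow> \<P>(\<xi> in S. \<not> (\<forall>n. lin_close e L b2 (\<lambda>i. s2 (\<xi> i)) n)) \<le> \<delta> / 3"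
      "\<And>L. L3 \<le> L \<Longrightarrow> \<P>(\<xi> in S. \<not> (\<forall>n. lin_close e L a (\<lambda>i. t (\<xi> i)) n)) \<le> \<delta> / 3"
    by blast
  have "bad e L \<le> \<delta>" if "max 0 (max L1 (max L2 L3)) \<le> L" for L
  proof -
    have "bad e L \<le>
      measure S ({\<xi>\<in>space S. \<not> (\<forall>n. lin_close e L b1 (\<lambda>i. s1 (\<xi> i)) n)} \<union>
      {\<xi>\<in>space S. \<not> (\<forall>n. lin_close e L b2 (\<lambda>i. s2 (\<xi> i)) n)} \<union>
      {\<xi>\<in>space S. \<not> (\<forall>n. lin_close e L a (\<lambda>i. t (\<xi> i)) n)})"
      by (intro P.finite_measure_mono) (auto simp: good_def)
    also have "\<dots> \<le> \<delta> / 3 + \<delta> / 3 + \<delta> / 3"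
      using that by (intro order_trans[OF measure_Un_le] add_mono L) auto
    finally show ?thesis by simp
  qed
  then show ?thesis by (intro exI[of _ "max 0 (max L1 (max L2 L3))"]) auto
qed

lemma dat_tail_antimono:
  assumes "x \<le> y"
  shows "dat_tail y \<le> dat_tail x"
  unfolding dat_tail_def by (intro P.finite_measure_mono) (auto intro: le_less_trans[OF assms])

lemma dat_tail_nonneg: "0 \<le> dat_tail x" and dat_tail_le_1: "dat_tail x \<le> 1"
  by (simp_all add: dat_tail_def)

text \<open>The barrier falls at a speed \<open>c\<close> below \<open>a - b2\<close>, so a path
  close to its mean stays under it if \<open>R\<close> is large, while every path that exceeds a
  level \<open>x >= R\<close> has to cross it.\<close>

definition pass :: "real \<Rightarrow> real \<Rightarrow> (nat \<Rightarrow> 'a) \<Rightarrow> nat \<Rightarrow> bool" where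
  "pass R c \<xi> j \<longleftrightarrow> R - c * real j < dat \<xi> j"

definition first :: "real \<Rightarrow> real \<Rightarrow> nat \<Rightarrow> (nat \<Rightarrow> 'a) \<Rightarrow> bool" where
  "first R c j \<xi> \<longleftrightarrow> pass R c \<xi> j \<and> (\<forall>i<j. \<not> pass R c \<xi> i)"

text \<open>The default \<open>0\<close> for paths without passage never counts as big, since the
  tail is estimated at levels \<open>y >= 0\<close> only.\<close>

definition pass_val :: "real \<Rightarrow> real \<Rightarrow> (nat \<Rightarrow> 'a) \<Rightarrow> real" where
  "pass_val R c \<xi> = (if \<exists>j. pass R c \<xi> j then dat \<xi> (LEAST j. pass R c \<xi> j) else 0)"

abbreviation pass_tail :: "real \<Rightarrow> real \<Rightarrow> real \<Rightarrow> real" where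
  "pass_tail R c y \<equiv> \<P>(\<xi> in S. y < pass_val R c \<xi>)"

abbreviation late :: "real \<Rightarrow> real \<Rightarrow> real \<Rightarrow> real \<Rightarrow> real" where
  "late R c x y \<equiv> \<P>(\<xi> in S. exceeds x \<xi> \<and> pass_val R c \<xi> \<le> y)"

definition pass_prob :: "real \<Rightarrow> real \<Rightarrow> real" where
  "pass_prob R c = \<P>(\<xi> in S. \<exists>j. pass R c \<xi> j)"

lemma pass_measurable [measurable]: "Measurable.pred S (\<lambda>\<xi>. pass R c \<xi> j)"
  unfolding pass_def by measurable

lemma first_measurable [measurable]: "Measurable.pred S (first R c j)"
  unfolding first_def[abs_def] by measurable

lemma pass_val_measurable [measurable]: "pass_val R c \<in> borel_measurable S"
proof -
  have "(\<lambda>\<xi>. dat \<xi> (LEAST j. pass R c \<xi> j)) \<in> borel_measurable S"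
    by (rule measurable_compose_countable[where f="\<lambda>j \<xi>. dat \<xi> j"]) measurable
  then show ?thesis unfolding pass_val_def[abs_def] by measurable
qed

lemma ex_first: "pass R c \<xi> j \<Longrightarrow> \<exists>i\<le>j. first R c i \<xi>"
  by (intro exI[of _ "LEAST j. pass R c \<xi> j"]) (auto simp: first_def intro: LeastI Least_le dest: not_less_Least)

lemma pass_val_first: "first R c j \<xi> \<Longrightarrow> pass_val R c \<xi> = dat \<xi> j"
  unfolding pass_val_def first_def by (subst Least_equality[of _ j]) (auto intro: leI)

lemma first_unique: "first R c i \<xi> \<Longrightarrow> first R c j \<xi> \<Longrightarrow> i = j"
  by (metis first_def linorder_neqE_nat)

lemma first_comb_seq: "first R c j (comb_seq j \<xi> \<xi>') = first R c j \<xi>"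
  by (simp add: first_def pass_def dat_comb_seq)

lemma dat_tail_measurable [measurable]: "dat_tail \<in> borel_measurable borel"
  using borel_measurable_mono[of "\<lambda>x. - dat_tail x"] dat_tail_antimono by (simp add: monotone_def)

lemma suminf_first: "(\<Sum>j. indicator {\<xi>. first R c j \<xi>} \<xi> :: ennreal) = indicator {\<xi>. \<exists>j. pass R c \<xi> j} \<xi>"
proof -
  have "disjoint_family (\<lambda>j. {\<xi>. first R c j \<xi>})"
    using first_unique by (auto simp: disjoint_family_on_def)
  from suminf_indicator[OF this, of \<xi>]
  have "(\<Sum>j. indicator {\<xi>. first R c j \<xi>} \<xi> :: ennreal) = indicator (\<Union>j. {\<xi>. first R c j \<xi>}) \<xi>" .
  also have "(\<Union>j. {\<xi>. first R c j \<xi>}) = {\<xi>. \<exists>j. pass R c \<xi> j}"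
  proof -
    have "first R c j \<xi> \<Longrightarrow> pass R c \<xi> j" for j \<xi> by (simp add: first_def)
    then have "(\<exists>j. first R c j \<xi>) \<longleftrightarrow> (\<exists>j. pass R c \<xi> j)" for \<xi>
      using ex_first[of R c \<xi>] by metis
    then show ?thesis by auto
  qed
  finally show ?thesis .
qed

text \<open>If a path exceeds \<open>x\<close> and has a passage value \<open>u <= x - K\<close>,
  then by subadditivity the dater restarted at the passage exceeds \<open>x - u\<close>. It is
  independent of the past and has tail \<open>dat_tail\<close>. Values \<open>u <= K\<close> cost at
  most \<open>dat_tail (x - K)\<close> times the probability of a passage; the others make up the
  integral, a convolution in disguise.\<close>

lemma passage_ineq:
  assumes "0 \<le> R" "R \<le> x" "0 < c"
  shows "ennreal (late R c x (x - K)) \<le>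
    ennreal (pass_prob R c * dat_tail (x - K)) +
    (\<integral>\<^sup>+\<xi>. indicator {K<..x - K} (pass_val R c \<xi>) * ennreal (dat_tail (x - pass_val R c \<xi>)) \<partial>S)"
proof -
  define A where "A j = {\<xi>\<in>space S. (first R c j \<xi> \<and> dat \<xi> j \<le> x - K) \<and> (\<exists>k. x - dat \<xi> j < dat (drop_seq j \<xi>) k)}" for j
  have [measurable]: "A j \<in> sets S" for j unfolding A_def by measurable
  let ?h = "\<lambda>\<xi>. ennreal (dat_tail (x - K)) + indicator {K<..x - K} (pass_val R c \<xi>) * ennreal (dat_tail (x - pass_val R c \<xi>))"
  have A_le: "emeasure S (A j) \<le> (\<integral>\<^sup>+\<xi>. indicator {\<xi>. first R c j \<xi>} \<xi> * ?h \<xi> \<partial>S)" for j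
  proof -
    define \<phi> :: "(nat \<Rightarrow> 'a) \<Rightarrow> (nat \<Rightarrow> 'a) \<Rightarrow> ennreal" where
      "\<phi> \<xi> \<xi>' = indicator {\<xi>. first R c j \<xi> \<and> dat \<xi> j \<le> x - K} \<xi> *
         indicator {p. \<exists>k. x - dat (fst p) j < dat (snd p) k} (\<xi>, \<xi>')" for \<xi> \<xi>'
    have "emeasure S (A j) = (\<integral>\<^sup>+\<xi>. indicator (A j) \<xi> \<partial>S)"
      by simp
    also have "\<dots> = (\<integral>\<^sup>+\<xi>. \<phi> \<xi> (drop_seq j \<xi>) \<partial>S)"
      by (intro nn_integral_cong) (auto simp: A_def \<phi>_def split: split_indicator)
    also have "\<dots> = (\<integral>\<^sup>+\<xi>. \<integral>\<^sup>+\<xi>'. \<phi> \<xi> \<xi>' \<partial>S \<partial>S)"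
    proof (rule nn_integral_split)
      show "(\<lambda>(\<xi>, \<xi>'). \<phi> \<xi> \<xi>') \<in> borel_measurable (S \<Otimes>\<^sub>M S)"
        unfolding \<phi>_def by measurable
      show "\<phi> (comb_seq j \<xi> \<xi>') \<xi>'' = \<phi> \<xi> \<xi>''" for \<xi> \<xi>' \<xi>''
        by (auto simp: \<phi>_def first_comb_seq dat_comb_seq split: split_indicator)
    qed
    also have "\<dots> = (\<integral>\<^sup>+\<xi>. indicator {\<xi>. first R c j \<xi> \<and> dat \<xi> j \<le> x - K} \<xi> * ennreal (dat_tail (x - dat \<xi> j)) \<partial>S)"
    proof (intro nn_integral_cong)
      fix \<xi>
      have "(\<integral>\<^sup>+\<xi>'. \<phi> \<xi> \<xi>' \<partial>S) = (\<integral>\<^sup>+\<xi>'. indicator {\<xi>. first R c j \<xi> \<and> dat \<xi> j \<le> x - K} \<xi> *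
          indicator {\<xi>'\<in>space S. \<exists>k. x - dat \<xi> j < dat \<xi>' k} \<xi>' \<partial>S)"
        by (intro nn_integral_cong) (auto simp: \<phi>_def split: split_indicator)
      also have "\<dots> = indicator {\<xi>. first R c j \<xi> \<and> dat \<xi> j \<le> x - K} \<xi> * ennreal (dat_tail (x - dat \<xi> j))"
        by (subst nn_integral_cmult) (auto simp: dat_tail_def P.emeasure_eq_measure)
      finally show "(\<integral>\<^sup>+\<xi>'. \<phi> \<xi> \<xi>' \<partial>S) = indicator {\<xi>. first R c j \<xi> \<and> dat \<xi> j \<le> x - K} \<xi> * ennreal (dat_tail (x - dat \<xi> j))" .
    qed
    also have "\<dots> \<le> (\<integral>\<^sup>+\<xi>. indicator {\<xi>. first R c j \<xi>} \<xi> * ?h \<xi> \<partial>S)"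
    proof (intro nn_integral_mono)
      fix \<xi>
      show "indicator {\<xi>. first R c j \<xi> \<and> dat \<xi> j \<le> x - K} \<xi> * ennreal (dat_tail (x - dat \<xi> j)) \<le> indicator {\<xi>. first R c j \<xi>} \<xi> * ?h \<xi>"
      proof (cases "first R c j \<xi> \<and> dat \<xi> j \<le> x - K")
        case True
        then have Y: "pass_val R c \<xi> = dat \<xi> j" by (simp add: pass_val_first)
        show ?thesis
        proof (cases "K < dat \<xi> j")
          case False
          then have "ennreal (dat_tail (x - dat \<xi> j)) \<le> ennreal (dat_tail (x - K))"
            by (intro ennreal_leI dat_tail_antimono) simp
          then show ?thesis using True False by (simp add: Y)
        qed (use True in \<open>simp add: Y\<close>)
      qed simp
    qed
    finally show ?thesis .
  qed
  have "ennreal (late R c x (x - K)) \<le> emeasure S (\<Union>j. A j)"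
    unfolding P.emeasure_eq_measure[symmetric]
  proof (intro emeasure_mono subsetI)
    fix \<xi> assume "\<xi> \<in> {\<xi> \<in> space S. exceeds x \<xi> \<and> pass_val R c \<xi> \<le> x - K}"
    then obtain k where \<xi>: "\<xi> \<in> space S" "pass_val R c \<xi> \<le> x - K" and k: "x < dat \<xi> k" by auto
    have "pass R c \<xi> k"
    proof -
      have "0 \<le> c * real k" using assms(3) by simp
      then show ?thesis using k assms(2) unfolding pass_def by linarith
    qed
    then obtain j where j: "j \<le> k" "first R c j \<xi>" using ex_first by blast
    have "x - dat \<xi> j < dat (drop_seq j \<xi>) (k - j)"
      using dat_add_le[of \<xi> j "k - j"] j k by simp
    then show "\<xi> \<in> (\<Union>j. A j)"
      using \<xi> j(2) pass_val_first[OF j(2)] unfolding A_def by auto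
  qed simp
  also have "\<dots> \<le> (\<Sum>j. emeasure S (A j))"
    by (rule emeasure_subadditive_countably) auto
  also have "\<dots> \<le> (\<Sum>j. \<integral>\<^sup>+\<xi>. indicator {\<xi>. first R c j \<xi>} \<xi> * ?h \<xi> \<partial>S)"
    by (intro suminf_le A_le) auto
  also have "\<dots> = (\<integral>\<^sup>+\<xi>. (\<Sum>j. indicator {\<xi>. first R c j \<xi>} \<xi> * ?h \<xi>) \<partial>S)"
    by (rule nn_integral_suminf[symmetric]) measurable
  also have "\<dots> = (\<integral>\<^sup>+\<xi>. indicator {\<xi>. \<exists>j. pass R c \<xi> j} \<xi> * ?h \<xi> \<partial>S)"
    by (intro nn_integral_cong) (simp add: ennreal_suminf_multc suminf_first)
  also have "\<dots> \<le> (\<integral>\<^sup>+\<xi>. indicator {\<xi>\<in>space S. \<exists>j. pass R c \<xi> j} \<xi> * ennreal (dat_tail (x - K)) +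
      indicator {K<..x - K} (pass_val R c \<xi>) * ennreal (dat_tail (x - pass_val R c \<xi>)) \<partial>S)"
    by (intro nn_integral_mono) (auto split: split_indicator)
  also have "\<dots> = ennreal (pass_prob R c * dat_tail (x - K)) +
      (\<integral>\<^sup>+\<xi>. indicator {K<..x - K} (pass_val R c \<xi>) * ennreal (dat_tail (x - pass_val R c \<xi>)) \<partial>S)"
    by (subst nn_integral_add)
       (auto simp: nn_integral_multc pass_prob_def P.emeasure_eq_measure ennreal_mult dat_tail_nonneg)
  finally show ?thesis .
qed

text \<open>Both factors of the integral are bounded by multiples of \<open>G\<close>, so that it is
  at most a multiple of the probability that two independent variables with tail \<open>G\<close>
  both exceed \<open>K\<close> and have a sum above \<open>x\<close>. The bound on
  \<open>dat_tail\<close> is asked for only up to \<open>x\<close>, because the lemma also serves to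
  establish such a bound.\<close>

lemma passage_bound:
  assumes R: "0 \<le> R" "R \<le> x" and c: "0 < c" and K: "0 \<le> K" "K \<le> x" and C: "0 \<le> C0" "0 \<le> C1"
    and dat_tail: "\<And>u. 0 \<le> u \<Longrightarrow> u \<le> x \<Longrightarrow> dat_tail u \<le> C0 * G u"
    and tail: "\<And>y. K \<le> y \<Longrightarrow> pass_tail R c y \<le> C1 * G y"
  defines "\<mu> \<equiv> interval_measure (integrated_tail_df F)"
  shows "late R c x (x - K) \<le> pass_prob R c * (C0 * G (x - K)) +
    C0 * (C1 * measure (\<mu> \<Otimes>\<^sub>M \<mu>) (both_large K x))"
proof -
  let ?A = "(both_large K x)"
  let ?\<nu> = "distr S borel (pass_val R c)"
  interpret \<mu>: real_distribution \<mu> unfolding \<mu>_def by (rule nonneg_df_real_distribution[OF Fs_df])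
  interpret \<nu>: prob_space ?\<nu> by (rule P.prob_space_distr) measurable
  interpret \<nu>\<mu>: pair_prob_space ?\<nu> \<mu> ..
  have \<mu>t: "measure \<mu> {y<..} = G y" for y
    unfolding \<mu>_def by (rule measure_greaterThan_eq_tail[OF Fs_df])
  have \<nu>t: "measure ?\<nu> {y<..} = pass_tail R c y" for y
    by (subst measure_distr) (auto intro!: arg_cong[where f="measure S"])
  have G_meas[measurable]: "G \<in> borel_measurable borel"
    using borel_measurable_mono[of "\<lambda>x. - G x"] tail_antimono[OF Fs_df] by (simp add: monotone_def)
  have "(\<integral>\<^sup>+\<xi>. indicator {K<..x - K} (pass_val R c \<xi>) * ennreal (dat_tail (x - pass_val R c \<xi>)) \<partial>S) \<le>
      (\<integral>\<^sup>+\<xi>. ennreal C0 * (indicator {K<..x - K} (pass_val R c \<xi>) * ennreal (G (x - pass_val R c \<xi>))) \<partial>S)"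
    using K C by (intro nn_integral_mono)
      (auto simp: ennreal_mult[symmetric] G_pos less_imp_le intro!: ennreal_leI dat_tail split: split_indicator)
  also have "\<dots> = ennreal C0 * (\<integral>\<^sup>+u. indicator {K<..x - K} u * ennreal (G (x - u)) \<partial>?\<nu>)"
    by (subst nn_integral_cmult) (auto simp: nn_integral_distr)
  \<comment> \<open>As \<open>u <= x - K\<close>, the level \<open>x - u\<close> equals
    \<open>max K (x - u)\<close>.\<close>
  also have "(\<integral>\<^sup>+u. indicator {K<..x - K} u * ennreal (G (x - u)) \<partial>?\<nu>) \<le>
      (\<integral>\<^sup>+u. indicator {K<..} u * emeasure \<mu> {max K (x - u)<..} \<partial>?\<nu>)"
    by (intro nn_integral_mono) (auto simp: \<mu>.emeasure_eq_measure \<mu>t max_def split: split_indicator)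
  also have "\<dots> = emeasure (?\<nu> \<Otimes>\<^sub>M \<mu>) ?A"
    by (rule emeasure_both_large[symmetric]) (auto simp: \<mu>.prob_space_axioms)
  also have "\<dots> = ennreal (measure (?\<nu> \<Otimes>\<^sub>M \<mu>) ?A)"
    by (rule \<nu>\<mu>.emeasure_eq_measure)
  finally have 1: "(\<integral>\<^sup>+\<xi>. indicator {K<..x - K} (pass_val R c \<xi>) * ennreal (dat_tail (x - pass_val R c \<xi>)) \<partial>S) \<le>
      ennreal (C0 * measure (?\<nu> \<Otimes>\<^sub>M \<mu>) ?A)"
    using C by (simp add: ennreal_mult mult_left_mono)
  have "measure (?\<nu> \<Otimes>\<^sub>M \<mu>) ?A = measure (\<mu> \<Otimes>\<^sub>M ?\<nu>) ?A"
    by (rule both_large_swap) (auto simp: \<mu>.prob_space_axioms \<nu>.prob_space_axioms)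
  also have "\<dots> \<le> C1 * measure (\<mu> \<Otimes>\<^sub>M \<mu>) ?A"
    by (rule both_large_tail_mono) (auto simp: \<mu>.prob_space_axioms \<nu>.prob_space_axioms \<mu>t \<nu>t C tail)
  finally have 2: "C0 * measure (?\<nu> \<Otimes>\<^sub>M \<mu>) ?A \<le> C0 * (C1 * measure (\<mu> \<Otimes>\<^sub>M \<mu>) ?A)"
    using C by (intro mult_left_mono)
  have "ennreal (late R c x (x - K)) \<le>
      ennreal (pass_prob R c * dat_tail (x - K)) + ennreal (C0 * measure (?\<nu> \<Otimes>\<^sub>M \<mu>) ?A)"
    by (intro order_trans[OF passage_ineq[OF R c]] add_left_mono 1)
  also have "\<dots> = ennreal (pass_prob R c * dat_tail (x - K) + C0 * measure (?\<nu> \<Otimes>\<^sub>M \<mu>) ?A)"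
    using C by (subst ennreal_plus) (auto simp: pass_prob_def dat_tail_nonneg)
  finally have "late R c x (x - K) \<le>
      pass_prob R c * dat_tail (x - K) + C0 * measure (?\<nu> \<Otimes>\<^sub>M \<mu>) ?A"
    using C by (subst (asm) ennreal_le_iff) (auto simp: pass_prob_def dat_tail_nonneg)
  moreover have "pass_prob R c * dat_tail (x - K) \<le> pass_prob R c * (C0 * G (x - K))"
    using K by (intro mult_left_mono dat_tail) (auto simp: pass_prob_def)
  ultimately show ?thesis using 2 by linarith
qed

lemma pass_prob_nonneg: "0 \<le> pass_prob R c"
  by (simp add: pass_prob_def)

text \<open>On a good path the dater stays below the barrier by \<open>lin_close_dater_le\<close>.
  The slack \<open>e\<close> is chosen such that the slope there is exactly \<open>c\<close>, and
  \<open>R\<close> is the constant there.\<close>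

lemma pass_prob_small:
  assumes "0 < c" "c < a - b2" "0 < \<delta>"
  shows "\<exists>R\<ge>0. pass_prob R c \<le> \<delta>"
proof -
  define e where "e = (a - b2 - c) / 4"
  have e: "0 < e" using assms unfolding e_def by simp
  have c_eq: "c = a - b2 - 4 * e" unfolding e_def by (simp add: field_simps)
  obtain L where L: "0 \<le> L" "bad e L \<le> \<delta>"
    using prob_good[OF e assms(3)] by blast
  define R where "R = 4 * L + b2 + e"
  have "pass_prob R c \<le> bad e L"
    unfolding pass_prob_def
  proof (intro P.finite_measure_mono subsetI)
    fix \<xi> assume "\<xi> \<in> {\<xi> \<in> space S. \<exists>j. pass R c \<xi> j}"
    then obtain j where \<xi>: "\<xi> \<in> space S" and j: "pass R c \<xi> j" by auto
    have "\<not> good e L j \<xi>"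
    proof
      assume "good e L j \<xi>"
      then have "dat \<xi> j \<le> R - real j * c"
        unfolding dat_def R_def c_eq good_def using b b_nonneg e L(1)
        by (intro lin_close_dater_le[where ?b1.0=b1]) auto
      then show False using j by (simp add: pass_def mult.commute)
    qed
    then show "\<xi> \<in> {\<xi> \<in> space S. \<not> (\<forall>n. good e L n \<xi>)}" using \<xi> by blast
  qed measurable
  then show ?thesis
    using L b_nonneg e by (intro exI[of _ R]) (auto simp: R_def)
qed

text \<open>Just before a first passage at \<open>Suc i\<close> the dater is at most
  \<open>R - c * i\<close>, so the last step must exceed \<open>y - R + c * i\<close>. A passage at
  index \<open>0\<close> is impossible here, since the dater starts at
  \<open>0 <= y\<close>.\<close>

lemma pass_val_large_jump:
  assumes "0 \<le> R" "0 \<le> y" "y < pass_val R c \<xi>"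
  shows "\<exists>i. y - R + c * real i < s1 (\<xi> i) + s2 (\<xi> i)"
proof -
  obtain j0 where "pass R c \<xi> j0" using assms by (auto simp: pass_val_def split: if_splits)
  then obtain j where j: "first R c j \<xi>" using ex_first by blast
  then have Y: "y < dat \<xi> j" using pass_val_first assms by simp
  then obtain i where i: "j = Suc i" using assms(2) by (cases j) auto
  have "\<not> pass R c \<xi> i" using j i by (simp add: first_def)
  then show ?thesis
    using dat_Suc_le[of \<xi> i] Y unfolding i pass_def by (intro exI[of _ i]) simp
qed

lemma pass_val_tail:
  assumes "0 \<le> R" "0 \<le> y" "summable (\<lambda>i. q12 (y - R + c * real i))"
  shows "pass_tail R c y \<le> (\<Sum>i. q12 (y - R + c * real i))"
proof -
  have q: "\<P>(\<xi> in S. z < s1 (\<xi> i) + s2 (\<xi> i)) = q12 z" for z i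
    unfolding q12_def by (rule prob_coordinate) measurable
  have "pass_tail R c y \<le> measure S (\<Union>i. {\<xi>\<in>space S. y - R + c * real i < s1 (\<xi> i) + s2 (\<xi> i)})"
    using pass_val_large_jump[OF assms(1,2)] by (intro P.finite_measure_mono) auto
  also have "\<dots> \<le> (\<Sum>i. \<P>(\<xi> in S. y - R + c * real i < s1 (\<xi> i) + s2 (\<xi> i)))"
    using assms(3) by (intro P.finite_measure_subadditive_countably) (auto simp: q)
  finally show ?thesis by (simp add: q)
qed

lemma pass_val_tail_G:
  assumes "0 < c" "0 \<le> R"
  shows "\<exists>C\<ge>0. \<exists>K0. \<forall>y\<ge>K0. pass_tail R c y \<le> C * G y"
proof -
  obtain C where C: "0 \<le> C" "eventually (\<lambda>y. q12 y \<le> C * Fb y) at_top"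
    using q12_tail_le by (auto simp: eventually_at_top_linorder)
  have "eventually (\<lambda>y. pass_tail R c y \<le> (4 * C / c) * G y) at_top"
    using eventually_at_top_minus[OF sum_tail_le[OF assms(1) C(1) q_nonneg(3) C(2)], of R]
      eventually_G_shift[of 1 R, simplified] eventually_ge_at_top[of 0]
  proof eventually_elim
    case (elim y)
    have "c * pass_tail R c y \<le> c * (\<Sum>i. q12 (y - R + c * real i))"
      using elim assms by (intro mult_left_mono pass_val_tail) auto
    also have "\<dots> \<le> 2 * C * (2 * G y)"
      using elim C by (intro order_trans[OF conjunct2[OF elim(1)]] mult_left_mono) auto
    finally show ?case using assms by (simp add: field_simps)
  qed
  then show ?thesis
    using C assms by (intro exI[of _ "4 * C / c"]) (auto simp: eventually_at_top_linorder)
qed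

lemma D_decompose:
  "dat_tail x \<le> pass_tail R c y + late R c x y"
proof -
  have "dat_tail x \<le> measure S ({\<xi>\<in>space S. y < pass_val R c \<xi>} \<union> {\<xi>\<in>space S. exceeds x \<xi> \<and> pass_val R c \<xi> \<le> y})"
    unfolding dat_tail_def by (intro P.finite_measure_mono) (auto simp: not_le)
  also have "\<dots> \<le> pass_tail R c y + late R c x y"
    by (rule measure_Un_le) measurable
  finally show ?thesis .
qed

text \<open>The constant is bootstrapped from the supremum of \<open>dat_tail / G\<close> over \<open>[0, X]\<close>, which is
  trivially finite and reappears on the right-hand side of the passage inequality with
  a factor less than \<open>1\<close>.\<close>

lemma dat_tail_bound: "\<exists>C\<ge>0. \<forall>x\<ge>0. dat_tail x \<le> C * G x"
proof -
  define c where "c = (a - b2) / 2"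
  have c: "0 < c" "c < a - b2" using b by (auto simp: c_def)
  obtain R where R: "0 \<le> R" "pass_prob R c \<le> 1/8" using pass_prob_small[OF c, of "1/8"] by auto
  obtain C1 K0 where C1: "0 \<le> C1" and Yt: "\<And>y. K0 \<le> y \<Longrightarrow> pass_tail R c y \<le> C1 * G y"
    using pass_val_tail_G[OF c(1) R(1)] by blast
  have "eventually (\<lambda>K. G K < 1 / (24 * (C1 + 1)) \<and> max 0 K0 \<le> K) at_top"
    using C1 by (intro eventually_conj G_small eventually_ge_at_top) auto
  then obtain K where K: "G K < 1 / (24 * (C1 + 1))" "0 \<le> K" "K0 \<le> K"
    by (auto simp: eventually_at_top_linorder)
  have C1K: "C1 * (3 * G K) \<le> 1/8"
  proof -
    have "C1 * (3 * G K) \<le> (C1 + 1) * (3 * (1 / (24 * (C1 + 1))))"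
      using C1 K G_pos[of K] by (intro mult_mono) auto
    also have "\<dots> = 1 / 8" using C1 by (simp add: divide_simps)
    finally show ?thesis .
  qed
  let ?\<mu> = "interval_measure (integrated_tail_df F)"
  let ?J = "\<lambda>x. measure (?\<mu> \<Otimes>\<^sub>M ?\<mu>) (both_large K x)"
  have "eventually (\<lambda>x. G (x - K) \<le> 2 * G x \<and> ?J x \<le> 3 * G K * G x \<and> max R (2 * K) \<le> x) at_top"
    using eventually_G_shift[of 1 K] subexponential_both_large_G[OF K(2)]
    by (intro eventually_conj eventually_ge_at_top) auto
  then obtain x0 where x0: "\<And>x. x0 \<le> x \<Longrightarrow> G (x - K) \<le> 2 * G x \<and> ?J x \<le> 3 * G K * G x \<and> max R (2 * K) \<le> x"
    by (auto simp: eventually_at_top_linorder)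
  \<comment> \<open>\<open>1 / G x0\<close> handles \<open>x < x0\<close> through
    \<open>dat_tail x <= 1\<close>, \<open>2 * C1\<close> is the direct contribution of a big
    passage value, and the outer \<open>2\<close> resolves \<open>Q <= u + 3/8 * Q\<close>. None of
    them depends on \<open>X\<close>.\<close>
  define C where "C = 2 * (1 / G x0 + 2 * C1)"
  have C_nonneg: "0 \<le> C" using G_pos[of x0] C1 by (simp add: C_def)
  have "dat_tail X \<le> C * G X" if X: "0 \<le> X" for X
  proof -
    define Q where "Q = Sup ((\<lambda>x. dat_tail x / G x) ` {0..X})"
    have bdd: "bdd_above ((\<lambda>x. dat_tail x / G x) ` {0..X})"
    proof (rule bdd_aboveI2)
      fix x assume "x \<in> {0..X}"
      then have "G X \<le> G x" by (intro tail_antimono[OF Fs_df]) simp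
      then show "dat_tail x / G x \<le> 1 / G X"
        using dat_tail_le_1[of x] dat_tail_nonneg[of x] G_pos[of X] by (intro frac_le) auto
    qed
    have Q: "dat_tail x \<le> Q * G x" if "0 \<le> x" "x \<le> X" for x
    proof -
      have "dat_tail x / G x \<le> Q" unfolding Q_def using bdd that by (intro cSUP_upper) auto
      then show ?thesis using G_pos[of x] by (simp add: field_simps)
    qed
    have "0 \<le> Q * G X" using order_trans[OF dat_tail_nonneg Q[of X]] X by simp
    then have Q0: "0 \<le> Q" using G_pos[of X] by (auto simp: zero_le_mult_iff)
    \<comment> \<open>The coefficient \<open>3/8\<close> is \<open>2/8\<close> for a restart after a
      passage value of at most \<open>K\<close>, where the shift from \<open>x - K\<close> to
      \<open>x\<close> doubles the \<open>1/8\<close>, plus \<open>1/8\<close> for two big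
      jumps.\<close>
    have "dat_tail x / G x \<le> (1 / G x0 + 2 * C1) + 3/8 * Q" if x: "0 \<le> x" "x \<le> X" for x
    proof (cases "x0 \<le> x")
      case True
      note x0' = x0[OF True]
      have "pass_tail R c (x - K) \<le> C1 * G (x - K)"
        using x0' K by (intro Yt) auto
      also have "\<dots> \<le> C1 * (2 * G x)" using x0' C1 by (intro mult_left_mono) auto
      finally have 1: "pass_tail R c (x - K) \<le> 2 * C1 * G x" by simp
      have "late R c x (x - K) \<le> pass_prob R c * (Q * G (x - K)) + Q * (C1 * ?J x)"
        using x x0' K by (intro passage_bound R c Q0 C1 Yt Q) auto
      moreover have "pass_prob R c * (Q * G (x - K)) \<le> 1/8 * (Q * (2 * G x))"
        using x0' R Q0 G_pos[of x] by (intro mult_mono mult_left_mono mult_nonneg_nonneg) (auto simp: G_pos less_imp_le)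
      moreover have "Q * (C1 * ?J x) \<le> Q * (C1 * (3 * G K * G x))"
        using x0' Q0 C1 by (intro mult_left_mono) auto
      moreover have "Q * (C1 * (3 * G K * G x)) \<le> Q * (1/8 * G x)"
        using C1K Q0 G_pos[of x] mult_right_mono[OF C1K, of "G x"] by (intro mult_left_mono) (auto simp: mult.assoc)
      ultimately have "dat_tail x \<le> (2 * C1 + 3/8 * Q) * G x"
        using D_decompose[of x "x - K" R c] 1 by (simp add: algebra_simps)
      then have "dat_tail x / G x \<le> 2 * C1 + 3/8 * Q" using G_pos[of x] by (simp add: field_simps)
      moreover have "0 \<le> 1 / G x0" using G_pos[of x0] by simp
      ultimately show ?thesis by linarith
    next
      case False
      then have "G x0 \<le> G x" by (intro tail_antimono[OF Fs_df]) simp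
      then have "dat_tail x / G x \<le> 1 / G x0"
        using dat_tail_le_1[of x] dat_tail_nonneg[of x] G_pos[of x0] by (intro frac_le) auto
      then show ?thesis using C1 Q0 by simp
    qed
    then have "Q \<le> (1 / G x0 + 2 * C1) + 3/8 * Q"
      unfolding Q_def using X by (intro cSUP_least) (auto simp: Q_def)
    moreover have "0 \<le> 1 / G x0 + 2 * C1" using C1 G_pos[of x0] by simp
    moreover have "q \<le> 2 * u" if "q \<le> u + 3/8 * q" "0 \<le> u" for q u :: real
      using that by linarith
    ultimately have "Q \<le> C" unfolding C_def by blast
    then have "Q * G X \<le> C * G X" using G_pos[of X] by (intro mult_right_mono) auto
    then show ?thesis using Q[of X] X by simp
  qed
  with C_nonneg show ?thesis by blast
qed

text \<open>Without a jump over the line, \<open>pass_val_large_jump\<close> keeps the passage value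
  at most \<open>x - K\<close>, so that \<open>passage_bound\<close> applies. Its first term is made
  small by \<open>R\<close>, its second one by \<open>K\<close>. The order matters: \<open>K\<close>
  depends on the constant \<open>C1\<close>, which belongs to the chosen \<open>R\<close>. The
  witness is \<open>K + R\<close>.\<close>

lemma no_big_jump:
  assumes "0 < \<eta>" "0 < c" "c < a - b2"
  shows "\<exists>K. eventually (\<lambda>x. no_jump (x - K) c x \<le> \<eta> * G x) at_top"
proof -
  obtain C where C: "0 \<le> C" "\<And>x. 0 \<le> x \<Longrightarrow> dat_tail x \<le> C * G x" using dat_tail_bound by blast
  obtain R where R: "0 \<le> R" "pass_prob R c \<le> \<eta> / (4 * (C + 1))"
    using pass_prob_small[OF assms(2,3), of "\<eta> / (4 * (C + 1))"] assms C by auto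
  obtain C1 K0 where C1: "0 \<le> C1" and Yt: "\<And>y. K0 \<le> y \<Longrightarrow> pass_tail R c y \<le> C1 * G y"
    using pass_val_tail_G[OF assms(2) R(1)] by blast
  have "eventually (\<lambda>K. G K < \<eta> / (6 * (C + 1) * (C1 + 1)) \<and> max 0 K0 \<le> K) at_top"
    using C C1 assms by (intro eventually_conj G_small eventually_ge_at_top) auto
  then obtain K where K: "G K < \<eta> / (6 * (C + 1) * (C1 + 1))" "0 \<le> K" "K0 \<le> K"
    by (auto simp: eventually_at_top_linorder)
  have 1: "pass_prob R c * (C * 2) \<le> \<eta> / 2"
  proof -
    have "pass_prob R c * (C * 2) \<le> \<eta> / (4 * (C + 1)) * ((C + 1) * 2)"
      using R C assms by (intro mult_mono) auto
    also have "\<dots> = \<eta> / 2" using C by (simp add: divide_simps)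
    finally show ?thesis .
  qed
  have 2: "C * (C1 * (3 * G K)) \<le> \<eta> / 2"
  proof -
    have "C * (C1 * (3 * G K)) \<le> (C + 1) * ((C1 + 1) * (3 * (\<eta> / (6 * (C + 1) * (C1 + 1)))))"
      using C C1 K G_pos[of K] by (intro mult_mono mult_nonneg_nonneg) auto
    also have "\<dots> = \<eta> / 2" using C C1 by (simp add: divide_simps)
    finally show ?thesis .
  qed
  have "eventually (\<lambda>x. no_jump (x - (K + R)) c x \<le> \<eta> * G x) at_top"
    using eventually_G_shift[of 1 K, simplified] subexponential_both_large_G[OF K(2)] eventually_ge_at_top[of "max R K"]
  proof eventually_elim
    case (elim x)
    let ?\<mu> = "interval_measure (integrated_tail_df F)"
    let ?J = "measure (?\<mu> \<Otimes>\<^sub>M ?\<mu>) (both_large K x)"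
    have "no_jump (x - (K + R)) c x \<le>
        late R c x (x - K)"
    proof (intro P.finite_measure_mono subsetI CollectI)
      fix \<xi> assume *: "\<xi> \<in> {\<xi> \<in> space S. exceeds x \<xi> \<and> \<not> jump (x - (K + R)) c \<xi>}"
      have "\<not> x - K < pass_val R c \<xi>"
        using pass_val_large_jump[OF R(1), of "x - K" c \<xi>] elim * by (auto simp: algebra_simps)
      then show "\<xi> \<in> space S \<and> exceeds x \<xi> \<and> pass_val R c \<xi> \<le> x - K" using * by auto
    qed measurable
    also have "\<dots> \<le> pass_prob R c * (C * G (x - K)) + C * (C1 * ?J)"
      using elim K by (intro passage_bound R assms C C1 Yt) auto
    also have "\<dots> \<le> pass_prob R c * (C * (2 * G x)) + C * (C1 * (3 * G K * G x))"
      using elim C C1 by (intro add_mono mult_left_mono pass_prob_nonneg) auto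
    also have "\<dots> = (pass_prob R c * (C * 2)) * G x + (C * (C1 * (3 * G K))) * G x" by simp
    also have "\<dots> \<le> \<eta> / 2 * G x + \<eta> / 2 * G x"
      using 1 2 G_pos[of x] by (intro add_mono mult_right_mono) auto
    finally show ?case by simp
  qed
  then show ?thesis by blast
qed

subsection \<open>Upper bound\<close>

definition W :: "(nat \<Rightarrow> 'a) \<Rightarrow> ereal" where
  "W \<xi> = queue2_wait (\<lambda>i. s1 (\<xi> i)) (\<lambda>i. s2 (\<xi> i)) (\<lambda>i. t (\<xi> i))"

definition W_tail :: "real \<Rightarrow> real" where "W_tail x = \<P>(\<xi> in S. ereal x < W \<xi>)"

definition stable :: "(nat \<Rightarrow> 'a) \<Rightarrow> bool" where
  "stable \<xi> \<longleftrightarrow> stable_path (\<lambda>i. s1 (\<xi> i)) (\<lambda>i. s2 (\<xi> i)) (\<lambda>i. t (\<xi> i))"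

lemma W_measurable [measurable]: "W \<in> borel_measurable S"
  unfolding W_def[abs_def] queue2_wait_def queue1_wait_def by measurable

lemma AE_stable: "AE \<xi> in S. stable \<xi>"
proof -
  have "AE \<xi> in S. \<exists>L. \<forall>n. (\<Sum>i<n. s1 (\<xi> i) - t (\<xi> i)) \<le> L"
    using walk_bounded_AE[of "\<lambda>z. s1 z - t z"] int mean b by simp
  then show ?thesis
    by eventually_elim (simp add: stable_def stable_path_def nonneg)
qed

lemma q2_small:
  assumes "0 < \<delta>"
  shows "eventually (\<lambda>y. q2 y \<le> \<delta>) at_top"
proof -
  obtain C y0 where C: "0 \<le> C" "0 \<le> y0" and q: "\<And>y. y0 \<le> y \<Longrightarrow> q1 y \<le> C * Fb y \<and> q2 y \<le> C * Fb y"
    using tail_le by blast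
  have lim: "((\<lambda>y. C * Fb y) \<longlongrightarrow> 0) at_top"
    using tendsto_mult[OF tendsto_const tail_tendsto_0[OF F_df], of C] by simp
  from order_tendstoD(2)[OF lim assms] show ?thesis
    using eventually_ge_at_top[of y0] by eventually_elim (use q in force)
qed

lemma dat_tail_small:
  assumes "0 < \<delta>"
  shows "eventually (\<lambda>y. dat_tail y \<le> \<delta>) at_top"
proof -
  obtain C where C: "0 \<le> C" "\<And>x. 0 \<le> x \<Longrightarrow> dat_tail x \<le> C * G x" using dat_tail_bound by blast
  have lim: "((\<lambda>y. C * G y) \<longlongrightarrow> 0) at_top"
    using tendsto_mult[OF tendsto_const tail_tendsto_0[OF Fs_df], of C] by simp
  from order_tendstoD(2)[OF lim assms] show ?thesis
    using eventually_ge_at_top[of 0] by eventually_elim (use C in force)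
qed

lemma W_imp_D:
  assumes "stable \<xi>" "0 \<le> x" "ereal x < W \<xi>"
  shows "\<exists>k. x < dat (drop_seq 1 \<xi>) k"
proof -
  from assms(1) interpret stable_path "\<lambda>i. s1 (\<xi> i)" "\<lambda>i. s2 (\<xi> i)" "\<lambda>i. t (\<xi> i)"
    by (simp add: stable_def)
  \<comment> \<open>With level \<open>0\<close> and \<open>j = 0\<close>, the first alternative
    would say that an empty sum is positive.\<close>
  show ?thesis
    using queue2_wait_split[of 0 x 0] assms(2,3) by (auto simp: W_def dat_def drop_seq_def)
qed

text \<open>On a good path the sums of the first alternative of \<open>queue2_wait_split\<close> are
  at most \<open>x - 2 * y\<close> for \<open>m < i\<close>, and the last summand can add
  \<open>y\<close> only through \<open>s2 (\<xi> i)\<close>. So a big \<open>s1 (\<xi> i)\<close>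
  with \<open>i\<close> this small is not enough: one of the two alternatives has to help, and
  neither they nor \<open>good e L i\<close> read \<open>s1 (\<xi> i)\<close>.\<close>

lemma W_split:
  assumes st: "stable \<xi>" and W: "ereal x < W \<xi>" and i: "0 < i" and y: "0 \<le> y" and e: "0 \<le> e" "0 \<le> L"
    and good: "good e L i \<xi>" and x: "real i * (b2 - b1 + 2 * e) + (2 * L + b2 + e) + 2 * y \<le> x"
  shows "y < s2 (\<xi> i) \<or> (\<exists>k. y < dat (drop_seq (Suc i) \<xi>) k)"
proof -
  from st interpret stable_path "\<lambda>i. s1 (\<xi> i)" "\<lambda>i. s2 (\<xi> i)" "\<lambda>i. t (\<xi> i)"
    by (simp add: stable_def)
  have sums: "(\<Sum>l=1..m. s2 (\<xi> l) - s1 (\<xi> (l - 1))) = (\<Sum>l\<le>m. s2 (\<xi> l)) - s2 (\<xi> 0) - (\<Sum>l<m. s1 (\<xi> l))" for m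
    by (induction m) auto
  have le: "(\<Sum>l=1..m. s2 (\<xi> l) - s1 (\<xi> (l - 1))) \<le> x - 2 * y" if "m < i" for m
  proof -
    have "real m * (b2 - b1 + 2 * e) \<le> real i * (b2 - b1 + 2 * e)"
      using that b e by (intro mult_right_mono) auto
    then show ?thesis
      unfolding sums using lin_close_sum_diff_le[of e L b1 "\<lambda>i. s1 (\<xi> i)" i b2 "\<lambda>i. s2 (\<xi> i)" m] good x that
        nonneg(2)[of 0]
      unfolding good_def by (simp add: algebra_simps)
  qed
  from queue2_wait_split[of "x - y" y i] W y
  consider m where "m \<le> i" "x - y < (\<Sum>l=1..m. s2 (\<xi> l) - s1 (\<xi> (l - 1)))"
    | k where "y < dat (drop_seq (Suc i) \<xi>) k"
    by (auto simp: W_def dat_def drop_seq_def)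
  then show ?thesis
  proof cases
    case 1
    show ?thesis
    proof (cases "m < i")
      case True
      then show ?thesis using le[OF True] 1 y by simp
    next
      case False
      then have m: "m = Suc (i - 1)" using 1 i by simp
      have "x - y < (\<Sum>l=1..i - 1. s2 (\<xi> l) - s1 (\<xi> (l - 1))) + (s2 (\<xi> i) - s1 (\<xi> (i - 1)))"
        using 1(2) i unfolding m by (cases i) auto
      then show ?thesis using le[of "i - 1"] i nonneg(1)[of "i - 1"] by simp
    qed
  qed blast
qed

lemma q_coordinate: "\<P>(\<xi> in S. z < s1 (\<xi> i)) = q1 z" "\<P>(\<xi> in S. z < s2 (\<xi> i)) = q2 z"
  unfolding q1_def q2_def by (rule prob_coordinate; measurable)+

text \<open>By \<open>W_split\<close>, the event is covered almost surely by three intersections of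
  \<open>z < s1 (\<xi> i)\<close> with an event independent of it: one about the entries below
  \<open>i\<close>, one about the other service time of the same customer, and one about the entries
  above \<open>i\<close>.\<close>

lemma W_jump_le:
  assumes i: "0 < i" and y: "0 \<le> y" and e: "0 \<le> e" "0 \<le> L"
    and x: "real i * (b2 - b1 + 2 * e) + (2 * L + b2 + e) + 2 * y \<le> x"
  shows "\<P>(\<xi> in S. ereal x < W \<xi> \<and> z < s1 (\<xi> i)) \<le>
    q1 z * (bad e L + q2 y + dat_tail y)"
proof -
  let ?A = "{\<xi>\<in>space S. \<not> good e L i \<xi> \<and> z < s1 (drop_seq i \<xi> 0)}"
  let ?B = "{\<xi>\<in>space S. y < s2 (\<xi> i) \<and> z < s1 (\<xi> i)}"
  let ?C = "{\<xi>\<in>space S. z < s1 (\<xi> i) \<and> (\<exists>k. y < dat (drop_seq (Suc i) \<xi>) k)}"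
  have "\<P>(\<xi> in S. ereal x < W \<xi> \<and> z < s1 (\<xi> i)) \<le> measure S (?A \<union> ?B \<union> ?C)"
  proof (rule P.finite_measure_mono_AE)
    show "AE \<xi> in S. \<xi> \<in> {\<xi> \<in> space S. ereal x < W \<xi> \<and> z < s1 (\<xi> i)} \<longrightarrow> \<xi> \<in> ?A \<union> ?B \<union> ?C"
      using AE_stable
    proof eventually_elim
      case (elim \<xi>)
      then show ?case using W_split[OF elim _ i y e _ x] by (auto simp: drop_seq_def)
    qed
  qed measurable
  also have "\<dots> \<le> measure S ?A + measure S ?B + measure S ?C"
    by (intro order_trans[OF measure_Un_le] add_right_mono order_refl) measurable
  also have "measure S ?A = \<P>(\<xi> in S. \<not> good e L i \<xi>) * q1 z"
    using prob_split[of "\<lambda>\<xi>. \<not> good e L i \<xi>" "\<lambda>\<xi>. z < s1 (\<xi> 0)" i]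
    by (simp add: q_coordinate good_comb_seq)
  also have "measure S ?B = \<P>(x in N. s1 x \<in> {z<..} \<and> s2 x \<in> {y<..})"
    using prob_coordinate[of "\<lambda>x. y < s2 x \<and> z < s1 x" i] by (simp add: conj_commute)
  also have "\<dots> = q1 z * q2 y"
    using indep12 by (subst M.prob_indep_random_variable) (auto simp: q1_def q2_def)
  also have "measure S ?C = q1 z * dat_tail y"
    using prob_split[of "\<lambda>\<xi>. z < s1 (\<xi> i)" "\<lambda>\<xi>. \<exists>k. y < dat \<xi> k" "Suc i"]
    by (simp add: q_coordinate comb_seq_def dat_tail_def)
  also have "\<P>(\<xi> in S. \<not> good e L i \<xi>) * q1 z \<le> bad e L * q1 z"
    by (intro mult_right_mono P.finite_measure_mono q_nonneg) auto
  finally show ?thesis by (simp add: algebra_simps)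
qed

text \<open>A union bound. If some customer has a jump over the line, then both of its service times
  exceed \<open>K1\<close>, or one of them exceeds the line lowered by \<open>K1\<close>. Big
  service times at station 1 count with the factor \<open>\<rho>\<close> for the first
  \<open>n\<close> customers and in full afterwards. Indices are shifted by one because
  \<open>W_imp_D\<close> leaves out customer \<open>0\<close>.\<close>

lemma W_tail_le:
  assumes x: "0 \<le> x"
    and \<rho>: "\<And>i z. 0 < i \<Longrightarrow> i \<le> n \<Longrightarrow> \<P>(\<xi> in S. ereal x < W \<xi> \<and> z < s1 (\<xi> i)) \<le> \<rho> * q1 z" "0 \<le> \<rho>"
    and summ: "summable (\<lambda>i. r K1 (x - K + c * real i))" "summable (\<lambda>i. q2 (x - (K + K1) + c * real i))"
      "summable (\<lambda>i. q1 (x - (K + K1) + c * real i))"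
  shows "W_tail x \<le> no_jump (x - K) c x +
    ((\<Sum>i. r K1 (x - K + c * real i)) + (\<Sum>i. q2 (x - (K + K1) + c * real i)) +
     (\<rho> * (\<Sum>i. q1 (x - (K + K1) + c * real i)) + (\<Sum>i. q1 (x - (K + K1) + c * real (i + n)))))"
proof -
  define z where "z i = x - K + c * real i" for i
  define Q where "Q \<xi> \<longleftrightarrow> exceeds x \<xi> \<and> \<not> jump (x - K) c \<xi>" for \<xi>
  have [measurable]: "Measurable.pred S Q" unfolding Q_def[abs_def] by measurable
  define B where "B i = {\<xi>\<in>space S. K1 < s1 (\<xi> (Suc i)) \<and> K1 < s2 (\<xi> (Suc i)) \<and> z i < s1 (\<xi> (Suc i)) + s2 (\<xi> (Suc i))}" for i
  define C where "C i = {\<xi>\<in>space S. z i - K1 < s2 (\<xi> (Suc i))}" for i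
  define D where "D i = {\<xi>\<in>space S. ereal x < W \<xi> \<and> z i - K1 < s1 (\<xi> (Suc i))}" for i
  have [measurable]: "B i \<in> sets S" "C i \<in> sets S" "D i \<in> sets S" for i
    unfolding B_def C_def D_def by measurable
  define v where "v i = q1 (x - (K + K1) + c * real i)" for i
  \<comment> \<open>Carrying \<open>\<rho> * v i\<close> for all \<open>i\<close>, not only for
    \<open>i < n\<close>, keeps the first of the two resulting sums free of
    \<open>n\<close>.\<close>
  define u where "u i = \<rho> * v i + (if i < n then 0 else v i)" for i
  have v: "q1 (z i - K1) = v i" and q2: "q2 (z i - K1) = q2 (x - (K + K1) + c * real i)" for i
    by (simp_all add: v_def z_def algebra_simps)
  have mB: "measure S (B i) = r K1 (z i)" for i
    unfolding B_def r_def by (rule prob_coordinate) measurable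
  have mC: "measure S (C i) = q2 (x - (K + K1) + c * real i)" for i
    unfolding C_def q2[symmetric] by (rule q_coordinate)
  have mD: "measure S (D i) \<le> u i" for i
  proof (cases "i < n")
    case True
    then show ?thesis using \<rho>(1)[of "Suc i" "z i - K1"] by (simp add: D_def u_def v)
  next
    case False
    have "measure S (D i) \<le> \<P>(\<xi> in S. z i - K1 < s1 (\<xi> (Suc i)))"
      unfolding D_def by (intro P.finite_measure_mono) auto
    also have "\<dots> = v i" by (simp add: q_coordinate v)
    also have "\<dots> \<le> \<rho> * v i + v i" using \<rho>(2) q_nonneg(1) by (simp add: v_def)
    finally show ?thesis using False by (simp add: u_def)
  qed
  have vs: "summable v" unfolding v_def[abs_def] by (rule summ(3))
  have us: "summable u"
    unfolding u_def[abs_def] by (intro summable_add summable_mult vs suminf_if_ge)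
  have usum: "(\<Sum>i. u i) = \<rho> * (\<Sum>i. v i) + (\<Sum>i. v (i + n))"
    unfolding u_def using vs suminf_if_ge[OF vs, of n]
    by (simp add: suminf_add[symmetric] suminf_mult summable_mult)
  let ?m = "\<lambda>i. r K1 (z i) + q2 (x - (K + K1) + c * real i) + u i"
  have le: "measure S (B i \<union> C i \<union> D i) \<le> ?m i" for i
    using mD[of i] mB[of i] mC[of i]
      measure_Un_le[of "B i" S "C i"] measure_Un_le[of "B i \<union> C i" S "D i"] by simp
  have ms: "summable ?m" using summ us by (intro summable_add) (simp_all add: z_def)
  have ABs: "summable (\<lambda>i. measure S (B i \<union> C i \<union> D i))"
    by (rule summable_comparison_test'[OF ms, of 0]) (simp add: le)
  have "W_tail x \<le> measure S ({\<xi>\<in>space S. Q (drop_seq 1 \<xi>)} \<union> (\<Union>i. B i \<union> C i \<union> D i))"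
    unfolding W_tail_def
  proof (rule P.finite_measure_mono_AE)
    show "AE \<xi> in S. \<xi> \<in> {\<xi> \<in> space S. ereal x < W \<xi>} \<longrightarrow>
      \<xi> \<in> {\<xi>\<in>space S. Q (drop_seq 1 \<xi>)} \<union> (\<Union>i. B i \<union> C i \<union> D i)"
      using AE_stable
    proof (eventually_elim, intro impI)
      fix \<xi> assume st: "stable \<xi>" and \<xi>: "\<xi> \<in> {\<xi> \<in> space S. ereal x < W \<xi>}"
      show "\<xi> \<in> {\<xi>\<in>space S. Q (drop_seq 1 \<xi>)} \<union> (\<Union>i. B i \<union> C i \<union> D i)"
      proof (cases "Q (drop_seq 1 \<xi>)")
        case False
        then obtain i where "z i < s1 (\<xi> (Suc i)) + s2 (\<xi> (Suc i))"
          using W_imp_D[OF st x] \<xi> by (auto simp: Q_def drop_seq_def z_def)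
        then have "\<xi> \<in> B i \<union> C i \<union> D i"
          using \<xi> by (auto simp: B_def C_def D_def)
        then show ?thesis by blast
      qed (use \<xi> in simp)
    qed
  qed measurable
  also have "\<dots> \<le> \<P>(\<xi> in S. Q (drop_seq 1 \<xi>)) + measure S (\<Union>i. B i \<union> C i \<union> D i)"
    by (rule measure_Un_le) measurable
  also have "\<P>(\<xi> in S. Q (drop_seq 1 \<xi>)) = \<P>(\<xi> in S. Q \<xi>)"
    by (rule prob_drop_seq) measurable
  also have "measure S (\<Union>i. B i \<union> C i \<union> D i) \<le> (\<Sum>i. measure S (B i \<union> C i \<union> D i))"
    by (rule P.finite_measure_subadditive_countably) (use ABs in auto)
  also have "\<dots> \<le> (\<Sum>i. ?m i)"
    by (intro suminf_le le ABs ms)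
  also have "\<dots> = (\<Sum>i. r K1 (z i)) + (\<Sum>i. q2 (x - (K + K1) + c * real i)) + (\<Sum>i. u i)"
    using summ us by (subst suminf_add[symmetric], (simp_all add: z_def summable_add)[2])
      (subst suminf_add[symmetric], simp_all add: z_def)
  finally show ?thesis
    unfolding usum by (simp add: v_def[abs_def] z_def Q_def)
qed

lemmas tail1' = tail1[folded q1_def[abs_def]] and tail2' = tail2[folded q2_def[abs_def]]

lemma upper_step:
  assumes c: "0 < c" "c < a - b2" and \<epsilon>: "0 < \<epsilon>" "\<epsilon> < 1" and \<eta>: "0 < \<eta>"
  shows "eventually (\<lambda>x. c * W_tail x \<le> d2 * G x + d1 * G ((1 + c * (1 - \<epsilon>) / (b2 - b1)) * x) + \<eta> * G x) at_top"
proof -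
  \<comment> \<open>For \<open>i <= n\<close> one has
    \<open>i * (b2 - b1) <= (1 - \<epsilon>) * x\<close>, which leaves room
    \<open>\<epsilon> * x\<close>. At most a quarter of it each goes to the errors
    \<open>2 * e * i\<close>, to the constants, and to \<open>2 * y\<close> with
    \<open>y = \<epsilon> / 8 * x\<close>.\<close>
  define e where "e = \<epsilon> * (b2 - b1) / 8"
  have e: "0 < e" using \<epsilon> b by (simp add: e_def)
  define \<delta> where "\<delta> = \<eta> / (12 * (d1 + 1))"
  have \<delta>: "0 < \<delta>" "3 * \<delta> * (d1 + 1) = \<eta> / 4" using \<eta> d by (simp_all add: \<delta>_def divide_simps)
  define p where "p = 1 + c * (1 - \<epsilon>) / (b2 - b1)"
  have p: "0 < p" "1 \<le> p" using c \<epsilon> b by (simp_all add: p_def add_pos_nonneg)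
  obtain L where L: "0 \<le> L" "bad e L \<le> \<delta>"
    using prob_good[OF e \<delta>(1)] by blast
  have "0 < \<eta> / (4 * c)" using \<eta> c by simp
  from no_big_jump[OF this c] obtain K where
    K: "eventually (\<lambda>x. no_jump (x - K) c x \<le> \<eta> / (4 * c) * G x) at_top" by blast
  have "0 < \<eta> / 16" using \<eta> by simp
  from r_small[OF this] obtain K1 where K1: "0 \<le> K1" "eventually (\<lambda>x. r K1 x \<le> \<eta> / 16 * Fb x) at_top" by blast
  have \<eta>8: "0 < \<eta> / 8" "0 \<le> \<eta> / 16" using \<eta> by simp_all
  \<comment> \<open>The extra \<open>c\<close> makes up for rounding \<open>n\<close> down.\<close>
  define K2 where "K2 = K + K1 + c"
  have "0 < \<epsilon> / 8" using \<epsilon> by simp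
  note ev_\<delta> = eventually_scale[OF this q2_small[OF \<delta>(1)]] eventually_scale[OF this dat_tail_small[OF \<delta>(1)]]
  have "eventually (\<lambda>x. 2 * L + b2 + e \<le> (\<epsilon> / 4) * x) at_top"
    using \<epsilon> by (intro eventually_scale eventually_ge_at_top) auto
  with K eventually_at_top_minus[OF sum_tail_le[OF c(1) \<eta>8(2) q_nonneg(4) K1(2)], of K]
    eventually_G_shift[of 1 K, simplified]
    asymp_tail_sum_shift[OF tail2' q_nonneg(2) d(2) c(1) \<eta>8(1), of "K + K1"]
    asymp_tail_sum_shift[OF tail1' q_nonneg(1) d(1) c(1) zero_less_one, of "K + K1"]
    eventually_scale[OF p(1) asymp_tail_sum_shift[OF tail1' q_nonneg(1) d(1) c(1) \<eta>8(1), of K2]]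
    ev_\<delta> eventually_ge_at_top[of 0]
  show ?thesis
  proof eventually_elim
    case (elim x)
    \<comment> \<open>The threshold \<open>x / (b2 - b1)\<close> lowered by the factor
      \<open>1 - \<epsilon>\<close>; at this customer the level \<open>x + c * n\<close> has grown
      to about \<open>p * x\<close>.\<close>
    define n where "n = nat \<lfloor>(1 - \<epsilon>) * x / (b2 - b1)\<rfloor>"
    have x0: "0 \<le> (1 - \<epsilon>) * x / (b2 - b1)" using elim \<epsilon> b by simp
    have n: "real n \<le> (1 - \<epsilon>) * x / (b2 - b1)" "(1 - \<epsilon>) * x / (b2 - b1) - 1 \<le> real n"
      using x0 unfolding n_def by linarith+
    have G: "0 \<le> G x" "G (p * x) \<le> G x"
      using G_pos[of x] mult_right_mono[OF p(2), of x] elim by (auto intro!: tail_antimono[OF Fs_df])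
    have \<rho>: "\<P>(\<xi> in S. ereal x < W \<xi> \<and> z < s1 (\<xi> i)) \<le> 3 * \<delta> * q1 z" if "0 < i" "i \<le> n" for i z
    proof -
      have "real i \<le> (1 - \<epsilon>) * x / (b2 - b1)" using that n(1) by linarith
      then have ib: "real i * (b2 - b1) \<le> (1 - \<epsilon>) * x" using b by (simp add: pos_le_divide_eq)
      have "real i * (2 * e) \<le> \<epsilon> / 4 * x"
      proof -
        have "real i * (b2 - b1) * (\<epsilon> / 4) \<le> (1 - \<epsilon>) * x * (\<epsilon> / 4)"
          using \<epsilon> ib by (intro mult_right_mono) auto
        also have "\<dots> \<le> 1 * x * (\<epsilon> / 4)" using \<epsilon> elim by (intro mult_right_mono) auto
        finally show ?thesis by (simp add: e_def algebra_simps)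
      qed
      note e2 = this
      have "real i * (b2 - b1 + 2 * e) + (2 * L + b2 + e) + 2 * (\<epsilon> / 8 * x) \<le> x"
      proof -
        have "real i * (b2 - b1 + 2 * e) = real i * (b2 - b1) + real i * (2 * e)" "(1 - \<epsilon>) * x = x - \<epsilon> * x"
          by (simp_all add: algebra_simps)
        moreover have "0 \<le> \<epsilon> * x" "2 * L + b2 + e \<le> \<epsilon> / 4 * x" using elim \<epsilon> by simp_all
        ultimately show ?thesis using ib e2 by linarith
      qed
      then have "\<P>(\<xi> in S. ereal x < W \<xi> \<and> z < s1 (\<xi> i)) \<le>
          q1 z * (bad e L + q2 (\<epsilon> / 8 * x) + dat_tail (\<epsilon> / 8 * x))"
        using that e L elim \<epsilon> by (intro W_jump_le) auto
      also have "\<dots> \<le> q1 z * (\<delta> + \<delta> + \<delta>)"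
        using L elim by (intro mult_left_mono add_mono q_nonneg) auto
      finally show ?thesis by (simp add: mult.commute)
    qed
    let ?P = "no_jump (x - K) c x"
    let ?r = "\<Sum>i. r K1 (x - K + c * real i)" and ?q2 = "\<Sum>i. q2 (x - (K + K1) + c * real i)"
      and ?q1 = "\<Sum>i. q1 (x - (K + K1) + c * real i)" and ?q1' = "\<Sum>i. q1 (x - (K + K1) + c * real (i + n))"
    have summ: "summable (\<lambda>i. q1 (x - (K + K1) + c * real i))" using elim by blast
    have "W_tail x \<le> ?P + (?r + ?q2 + (3 * \<delta> * ?q1 + ?q1'))"
      using elim \<delta> by (intro W_tail_le \<rho>) auto
    then have "c * W_tail x \<le> c * (?P + (?r + ?q2 + (3 * \<delta> * ?q1 + ?q1')))"
      using c by (intro mult_left_mono) auto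
    also have "\<dots> = c * ?P + c * ?r + c * ?q2 + 3 * \<delta> * (c * ?q1) + c * ?q1'"
      by (simp add: algebra_simps)
    also have "\<dots> \<le> \<eta> / 4 * G x + \<eta> / 4 * G x + (d2 * G x + \<eta> / 8 * G x) + \<eta> / 4 * G x + (d1 * G (p * x) + \<eta> / 8 * G x)"
    proof (intro add_mono)
      have "c * ?P \<le> c * (\<eta> / (4 * c) * G x)" using elim c by (intro mult_left_mono) auto
      then show "c * ?P \<le> \<eta> / 4 * G x" using c by simp
      have "c * ?r \<le> 2 * (\<eta> / 16) * G (x - K)" using elim by simp
      also have "\<dots> \<le> 2 * (\<eta> / 16) * (2 * G x)" using elim \<eta> by (intro mult_left_mono) auto
      finally show "c * ?r \<le> \<eta> / 4 * G x" by simp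
      have "\<bar>c * ?q2 - d2 * G x\<bar> \<le> \<eta> / 8 * G x" using elim by blast
      then show "c * ?q2 \<le> d2 * G x + \<eta> / 8 * G x" by linarith
      have "\<bar>c * ?q1 - d1 * G x\<bar> \<le> 1 * G x" using elim by blast
      then have "c * ?q1 \<le> (d1 + 1) * G x" by (simp add: algebra_simps abs_le_iff)
      then have "3 * \<delta> * (c * ?q1) \<le> 3 * \<delta> * ((d1 + 1) * G x)" using \<delta> by (intro mult_left_mono) auto
      also have "\<dots> = \<eta> / 4 * G x" by (simp only: mult.assoc[symmetric] \<delta>(2))
      finally show "3 * \<delta> * (c * ?q1) \<le> \<eta> / 4 * G x" .
      have s': "summable (\<lambda>i. q1 (p * x - K2 + c * real i))"
        "\<bar>c * (\<Sum>i. q1 (p * x - K2 + c * real i)) - d1 * G (p * x)\<bar> \<le> \<eta> / 8 * G (p * x)"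
        using elim by blast+
      have "p * x - K2 \<le> x - (K + K1) + c * real n"
      proof -
        have "c * ((1 - \<epsilon>) * x / (b2 - b1) - 1) \<le> c * real n" using n(2) c by (intro mult_left_mono) auto
        then show ?thesis by (simp add: p_def K2_def algebra_simps)
      qed
      then have "?q1' \<le> (\<Sum>i. q1 (p * x - K2 + c * real i))"
        using summable_ignore_initial_segment[OF summ, of n] s'
        by (intro suminf_le q_antimono) (auto simp: algebra_simps)
      then have "c * ?q1' \<le> c * (\<Sum>i. q1 (p * x - K2 + c * real i))" using c by (intro mult_left_mono) auto
      moreover have "\<eta> / 8 * G (p * x) \<le> \<eta> / 8 * G x" using G \<eta> by (intro mult_left_mono) auto
      ultimately show "c * ?q1' \<le> d1 * G (p * x) + \<eta> / 8 * G x" using s'(2) by linarith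
    qed
    also have "\<dots> = d2 * G x + d1 * G (p * x) + \<eta> * G x" by (simp add: algebra_simps)
    finally show ?case by (simp add: p_def)
  qed
qed

subsection \<open>Lower bound\<close>

text \<open>By independence, the union of both jumps has probability
  \<open>q2 y + q1 y * (1 - q2 y)\<close>, and the condition on \<open>t\<close> costs another
  factor. The flag \<open>J\<close> marks the customers far enough in the past for a big service
  time at station 1 to be effective.\<close>

lemma jump_prob_ge:
  assumes "\<P>(z in N. \<not> t z \<le> L) \<le> \<delta>" "q2 y \<le> \<delta>" "\<delta> \<le> 1"
  shows "(1 - \<delta>) * (1 - \<delta>) * (q2 y + (if J then q1 y else 0)) \<le>
    \<P>(z in N. (y < s2 z \<or> (J \<and> y < s1 z)) \<and> t z \<le> L)"
proof -
  have \<delta>: "0 \<le> \<delta>" using assms(2) q_nonneg(2)[of y] by linarith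
  let ?A = "{p::real \<times> real. y < snd p \<or> (J \<and> y < fst p)}"
  have "Measurable.pred (borel \<Otimes>\<^sub>M borel) (\<lambda>p::real \<times> real. y < snd p \<or> (J \<and> y < fst p))"
    by measurable
  then have A: "?A \<in> sets (borel \<Otimes>\<^sub>M borel)" by (simp add: pred_def space_pair_measure)
  have "(1 - \<delta>) * (q2 y + (if J then q1 y else 0)) \<le> \<P>(z in N. y < s2 z \<or> (J \<and> y < s1 z))"
  proof (cases J)
    case True
    have "\<P>(z in N. y < s2 z \<or> y < s1 z) = measure N ({z\<in>space N. y < s2 z} \<union> {z\<in>space N. s1 z \<in> {y<..} \<and> s2 z \<in> {..y}})"
      by (intro arg_cong[where f="measure N"]) auto
    also have "\<dots> = q2 y + \<P>(z in N. s1 z \<in> {y<..} \<and> s2 z \<in> {..y})"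
      unfolding q2_def by (intro M.finite_measure_Union) auto
    also have "\<P>(z in N. s1 z \<in> {y<..} \<and> s2 z \<in> {..y}) = q1 y * \<P>(z in N. s2 z \<in> {..y})"
      using indep12 by (subst M.prob_indep_random_variable) (auto simp: q1_def)
    also have "\<P>(z in N. s2 z \<in> {..y}) = 1 - q2 y"
      using M.prob_neg[of "\<lambda>z. y < s2 z"] by (simp add: q2_def not_less)
    finally have "\<P>(z in N. y < s2 z \<or> y < s1 z) = q2 y + q1 y * (1 - q2 y)" .
    moreover have "q1 y * (1 - \<delta>) \<le> q1 y * (1 - q2 y)" using assms by (intro mult_left_mono q_nonneg) auto
    moreover have "(1 - \<delta>) * q2 y \<le> 1 * q2 y" using \<delta> by (intro mult_right_mono q_nonneg) auto
    ultimately show ?thesis using True by (simp add: algebra_simps)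
  next
    case False
    have "(1 - \<delta>) * q2 y \<le> 1 * q2 y" using \<delta> by (intro mult_right_mono q_nonneg) auto
    then show ?thesis using False by (simp add: q2_def)
  qed
  moreover have "1 - \<delta> \<le> \<P>(z in N. t z \<le> L)"
    using assms(1) M.prob_neg[of "\<lambda>z. t z \<le> L"] by simp
  ultimately have "(1 - \<delta>) * ((1 - \<delta>) * (q2 y + (if J then q1 y else 0))) \<le>
      \<P>(z in N. t z \<le> L) * \<P>(z in N. y < s2 z \<or> (J \<and> y < s1 z))"
    using assms(3) by (intro mult_mono mult_nonneg_nonneg add_nonneg_nonneg) (auto simp: q_nonneg)
  also have "\<dots> = \<P>(z in N. (y < s2 z \<or> (J \<and> y < s1 z)) \<and> t z \<le> L)"
    using indep3[OF A, of L] by simp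
  finally show ?thesis by (simp only: mult.assoc)
qed

text \<open>Summing over the first big jump makes the events disjoint.\<close>

lemma W_tail_ge:
  assumes e: "0 < e" "2 * e \<le> a - b1" "2 * e < b2 - b1"
    and L: "0 \<le> L" "bad e L \<le> \<delta>" "\<P>(z in N. \<not> t z \<le> L) \<le> \<delta>"
    and \<delta>: "2 * \<delta> \<le> 1"
    and q2: "\<And>y. x \<le> y \<Longrightarrow> q2 y \<le> \<delta>"
  defines "c \<equiv> a - b2 + 2 * e" and "C \<equiv> 8 * L + a + b1 + b2 + 3 * e"
  assumes x: "0 \<le> x" and n: "x + C < real (Suc n) * (b2 - b1 - 2 * e)"
    and summ: "summable (\<lambda>i. q1 (x + C + c + c * real i))" "summable (\<lambda>i. q2 (x + C + c + c * real i))"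
    and small: "(\<Sum>i. q1 (x + C + c + c * real i)) + (\<Sum>i. q2 (x + C + c + c * real i)) \<le> \<delta>"
  shows "(1 - 2 * \<delta>) * (1 - \<delta>) * (1 - \<delta>) * ((\<Sum>i. q2 (x + C + c + c * real i)) + (\<Sum>i. q1 (x + C + c + c * real (i + n)))) \<le> W_tail x"
proof -
  \<comment> \<open>The additional \<open>c\<close> appears because term \<open>i\<close> belongs to
    customer \<open>Suc i\<close>.\<close>
  define y where "y i = x + C + c + c * real i" for i
  define H where "H i z \<longleftrightarrow> (y i < s2 z \<or> (n \<le> i \<and> y i < s1 z)) \<and> t z \<le> L" for i z
  have [measurable]: "Measurable.pred N (H i)" for i unfolding H_def[abs_def] by measurable
  define h where "h i = \<P>(z in N. H i z)" for i
  \<comment> \<open>Reads only the entries up to \<open>i\<close>, so it is independent of the entry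
    \<open>Suc i\<close> tested by \<open>H i\<close>.\<close>
  define pre where "pre i \<xi> \<longleftrightarrow> good e L (Suc i) \<xi> \<and> (\<forall>k<i. \<not> H k (\<xi> (Suc k)))" for i \<xi>
  have [measurable]: "Measurable.pred S (pre i)" for i unfolding pre_def[abs_def] by measurable
  define E where "E i = {\<xi>\<in>space S. pre i \<xi> \<and> H i (\<xi> (Suc i))}" for i
  have Em [measurable]: "E i \<in> sets S" for i unfolding E_def by measurable
  define w where "w i = q2 (y i) + (if n \<le> i then q1 (y i) else 0)" for i
  have C0: "0 \<le> C" and c0: "0 < c" using L b_nonneg e b by (simp_all add: C_def c_def)
  have yx: "x \<le> y i" for i using C0 c0 by (simp add: y_def)
  have \<delta>0: "0 \<le> \<delta>" using q2[of x] q_nonneg(2)[of x] by linarith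
  have h_le: "h i \<le> q1 (y i) + q2 (y i)" for i
  proof -
    have "h i \<le> measure N ({z\<in>space N. y i < s1 z} \<union> {z\<in>space N. y i < s2 z})"
      unfolding h_def H_def by (intro M.finite_measure_mono) auto
    also have "\<dots> \<le> q1 (y i) + q2 (y i)" unfolding q1_def q2_def by (rule measure_Un_le) measurable
    finally show ?thesis .
  qed
  have qs: "summable (\<lambda>i. q1 (y i))" "summable (\<lambda>i. q2 (y i))" using summ by (simp_all add: y_def)
  have hs: "summable h"
    by (rule summable_comparison_test'[OF summable_add[OF qs], of 0]) (use h_le in \<open>auto simp: h_def\<close>)
  have hsum: "(\<Sum>i. h i) \<le> \<delta>"
  proof -
    have "(\<Sum>i. h i) \<le> (\<Sum>i. q1 (y i) + q2 (y i))" by (intro suminf_le h_le hs summable_add qs)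
    also have "\<dots> = (\<Sum>i. q1 (y i)) + (\<Sum>i. q2 (y i))" by (rule suminf_add[OF qs, symmetric])
    finally show ?thesis using small by (simp add: y_def)
  qed
  have Hcoord: "\<P>(\<xi> in S. H i (\<xi> k)) = h i" for i k
    unfolding h_def by (rule prob_coordinate) measurable
  \<comment> \<open>One \<open>\<delta>\<close> is lost to bad paths, the other one to earlier big
    jumps, whose total probability is controlled by \<open>small\<close>.\<close>
  have pre_ge: "1 - 2 * \<delta> \<le> \<P>(\<xi> in S. pre i \<xi>)" for i
  proof -
    have "\<P>(\<xi> in S. \<not> pre i \<xi>) \<le> measure S ({\<xi>\<in>space S. \<not> (\<forall>n. good e L n \<xi>)} \<union> (\<Union>k. {\<xi>\<in>space S. H k (\<xi> (Suc k))}))"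
      by (intro P.finite_measure_mono) (auto simp: pre_def)
    also have "\<dots> \<le> bad e L + measure S (\<Union>k. {\<xi>\<in>space S. H k (\<xi> (Suc k))})"
      by (rule measure_Un_le) measurable
    also have "measure S (\<Union>k. {\<xi>\<in>space S. H k (\<xi> (Suc k))}) \<le> (\<Sum>k. \<P>(\<xi> in S. H k (\<xi> (Suc k))))"
      using hs by (intro P.finite_measure_subadditive_countably) (auto simp: Hcoord)
    also have "\<dots> \<le> \<delta>" using hsum by (simp add: Hcoord)
    finally have "\<P>(\<xi> in S. \<not> pre i \<xi>) \<le> 2 * \<delta>" using L(2) by simp
    then show ?thesis using P.prob_neg[of "pre i"] by simp
  qed
  have E_ge: "(1 - 2 * \<delta>) * (1 - \<delta>) * (1 - \<delta>) * w i \<le> measure S (E i)" for i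
  proof -
    have "measure S (E i) = \<P>(\<xi> in S. pre i \<xi> \<and> H i (drop_seq (Suc i) \<xi> 0))"
      by (simp add: E_def drop_seq_def)
    also have "\<dots> = \<P>(\<xi> in S. pre i \<xi>) * \<P>(\<xi> in S. H i (\<xi> 0))"
      by (rule prob_split) (measurable, simp add: pre_def good_comb_seq comb_seq_def)
    also have "\<dots> = \<P>(\<xi> in S. pre i \<xi>) * h i" by (simp only: Hcoord)
    also have "\<dots> \<ge> (1 - 2 * \<delta>) * ((1 - \<delta>) * (1 - \<delta>) * w i)"
      unfolding w_def h_def H_def
      using \<delta> \<delta>0 pre_ge[of i] q2[OF yx[of i]] L(3)
      by (intro mult_mono jump_prob_ge) (auto simp: q_nonneg)
    finally show ?thesis by (simp only: mult.assoc)
  qed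
  have disj: "disjoint_family E"
  proof -
    have "i = k" if "\<xi> \<in> E i" "\<xi> \<in> E k" for i k \<xi>
      using that by (rule_tac ccontr) (auto simp: E_def pre_def neq_iff)
    then show ?thesis by (auto simp: disjoint_family_on_def)
  qed
  have sums: "(\<lambda>i. measure S (E i)) sums measure S (\<Union>i. E i)"
    by (rule P.finite_measure_UNION) (use disj Em in auto)
  have ifs: "(\<lambda>i. if n \<le> i then q1 (y i) else 0) = (\<lambda>i. if i < n then 0 else q1 (y i))"
    by auto
  note ge = suminf_if_ge[OF qs(1), of n, folded ifs]
  have ws: "summable w" unfolding w_def[abs_def] by (intro summable_add qs ge(1))
  have wsum: "(\<Sum>i. w i) = (\<Sum>i. q2 (y i)) + (\<Sum>i. q1 (y (i + n)))"
    unfolding w_def suminf_add[OF qs(2) ge(1), symmetric] ge(2) ..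
  have "(1 - 2 * \<delta>) * (1 - \<delta>) * (1 - \<delta>) * (\<Sum>i. w i) = (\<Sum>i. (1 - 2 * \<delta>) * (1 - \<delta>) * (1 - \<delta>) * w i)"
    by (rule suminf_mult[OF ws, symmetric])
  also have "\<dots> \<le> (\<Sum>i. measure S (E i))"
    by (intro suminf_le E_ge summable_mult ws sums_summable[OF sums])
  also have "\<dots> = measure S (\<Union>i. E i)" by (rule sums_unique[OF sums, symmetric])
  also have "\<dots> \<le> W_tail x"
    unfolding W_tail_def
  proof (rule P.finite_measure_mono_AE)
    show "AE \<xi> in S. \<xi> \<in> (\<Union>i. E i) \<longrightarrow> \<xi> \<in> {\<xi>\<in>space S. ereal x < W \<xi>}"
      using AE_stable
    proof (eventually_elim, intro impI)
      fix \<xi> assume st: "stable \<xi>" and "\<xi> \<in> (\<Union>i. E i)"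
      then obtain i where i: "\<xi> \<in> E i" by blast
      interpret stable_path "\<lambda>i. s1 (\<xi> i)" "\<lambda>i. s2 (\<xi> i)" "\<lambda>i. t (\<xi> i)"
        using st by (simp add: stable_def)
      have good: "good e L (Suc i) \<xi>" and t: "t (\<xi> (Suc i)) \<le> L"
        and or: "y i < s2 (\<xi> (Suc i)) \<or> (n \<le> i \<and> y i < s1 (\<xi> (Suc i)))"
        using i by (auto simp: E_def pre_def H_def)
      have y: "y i = x + real (Suc i) * (a - b2 + 2 * e) + (8 * L + a + b1 + b2 + 3 * e)"
        by (simp add: y_def c_def C_def algebra_simps)
      note jump = queue2_wait_jump[OF good[unfolded good_def, THEN conjunct1]
          good[unfolded good_def, THEN conjunct2, THEN conjunct1]
          good[unfolded good_def, THEN conjunct2, THEN conjunct2] less_imp_le[OF e(1)] e(2) zero_less_Suc t, of x]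
      have "ereal x < W \<xi>"
        using or
      proof
        assume "y i < s2 (\<xi> (Suc i))"
        then show ?thesis unfolding W_def by (intro jump(1)) (simp only: y)
      next
        assume *: "n \<le> i \<and> y i < s1 (\<xi> (Suc i))"
        have "real (Suc n) * (b2 - b1 - 2 * e) \<le> real (Suc i) * (b2 - b1 - 2 * e)"
          using * e by (intro mult_right_mono) auto
        then have "x + (8 * L + a + b1 + b2 + 3 * e) < real (Suc i) * (b2 - b1 - 2 * e)"
          using n unfolding C_def by linarith
        then show ?thesis unfolding W_def using * by (intro jump(2)) (simp_all only: y)
      qed
      then show "\<xi> \<in> {\<xi>\<in>space S. ereal x < W \<xi>}" using i by (simp add: E_def)
    qed
  qed measurable
  finally show ?thesis unfolding wsum y_def .
qed

lemma lower_step: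
  assumes e: "0 < e" "2 * e \<le> a - b1" "2 * e < b2 - b1" and \<delta>: "0 < \<delta>" "\<delta> < 1" and \<eta>: "0 < \<eta>"
  defines "c \<equiv> a - b2 + 2 * e"
  shows "eventually (\<lambda>x. (1 - \<delta>) * (d2 * G x + d1 * G ((1 + c / (b2 - b1 - 2 * e)) * x) - \<eta> * G x) \<le> c * W_tail x) at_top"
proof -
  \<comment> \<open>A quarter is enough: \<open>(1 - \<delta>1) * (1 - \<delta>1)\<close> is at
    least \<open>1 - 2 * \<delta>1\<close>, and the square of the latter is at least
    \<open>1 - 4 * \<delta>1\<close>.\<close>
  define \<delta>1 where "\<delta>1 = \<delta> / 4"
  have \<delta>1: "0 < \<delta>1" "2 * \<delta>1 \<le> 1" "1 - \<delta> \<le> (1 - 2 * \<delta>1) * (1 - \<delta>1) * (1 - \<delta>1)"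
  proof -
    show "0 < \<delta>1" "2 * \<delta>1 \<le> 1" using \<delta> by (simp_all add: \<delta>1_def)
    then have "1 - 2 * \<delta>1 \<le> (1 - \<delta>1) * (1 - \<delta>1)" by (simp add: algebra_simps)
    then have "(1 - 2 * \<delta>1) * (1 - 2 * \<delta>1) \<le> (1 - 2 * \<delta>1) * ((1 - \<delta>1) * (1 - \<delta>1))"
      using \<open>2 * \<delta>1 \<le> 1\<close> by (intro mult_left_mono) auto
    moreover have "1 - \<delta> \<le> (1 - 2 * \<delta>1) * (1 - 2 * \<delta>1)"
      by (simp add: \<delta>1_def algebra_simps)
    ultimately show "1 - \<delta> \<le> (1 - 2 * \<delta>1) * (1 - \<delta>1) * (1 - \<delta>1)" by (simp only: mult.assoc)
  qed
  obtain L0 where L0: "0 \<le> L0" "\<And>L. L0 \<le> L \<Longrightarrow> bad e L \<le> \<delta>1"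
    using prob_good[OF e(1) \<delta>1(1)] by blast
  \<comment> \<open>Enlarged so that a good path with offset \<open>L0\<close> has
    \<open>t (\<xi> 0) <= L\<close>, which also bounds the tail of a single interarrival
    time.\<close>
  define L where "L = L0 + a + e"
  have L: "0 \<le> L" "L0 \<le> L" using L0 e b_nonneg by (simp_all add: L_def)
  have tL: "\<P>(z in N. \<not> t z \<le> L) \<le> \<delta>1"
  proof -
    have "\<P>(z in N. \<not> t z \<le> L) = \<P>(\<xi> in S. \<not> t (\<xi> 0) \<le> L)"
      by (rule prob_coordinate[symmetric]) measurable
    also have "\<dots> \<le> bad e L0"
    proof (intro P.finite_measure_mono subsetI)
      fix \<xi> assume *: "\<xi> \<in> {\<xi>\<in>space S. \<not> t (\<xi> 0) \<le> L}"
      have "\<not> good e L0 1 \<xi>"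
        using * lin_closeD(1)[of e L0 a "\<lambda>i. t (\<xi> i)" 1 1] by (auto simp: good_def L_def)
      then show "\<xi> \<in> {\<xi>\<in>space S. \<not> (\<forall>n. good e L0 n \<xi>)}" using * by blast
    qed measurable
    also have "\<dots> \<le> \<delta>1" by (rule L0) simp
    finally show ?thesis .
  qed
  have c: "0 < c" using e b by (simp add: c_def)
  define D where "D = b2 - b1 - 2 * e"
  have D: "0 < D" using e by (simp add: D_def)
  define C where "C = 8 * L + a + b1 + b2 + 3 * e"
  have C: "0 \<le> C" using L b_nonneg e by (simp add: C_def)
  define p where "p = 1 + c / D"
  have p: "0 < p" "1 \<le> p" using c D by (simp_all add: p_def add_pos_nonneg)
  \<comment> \<open>As the index \<open>n\<close> below satisfies \<open>n <= (x + C) / D\<close>,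
    the level \<open>x + C + c + c * n\<close> at which the sum for station 1 starts is at most
    \<open>p * x + K\<close>.\<close>
  define K where "K = C + c + c * (C / D + 1)"
  have \<eta>2: "0 < \<eta> / 2" using \<eta> by simp
  obtain Y where Y: "\<And>y. Y \<le> y \<Longrightarrow> q2 y \<le> \<delta>1"
    using q2_small[OF \<delta>1(1)] by (auto simp: eventually_at_top_linorder)
  have "0 < c * \<delta>1 / (d1 + d2 + 2)" using c \<delta>1 d by (simp add: add_nonneg_pos)
  note small = G_small[OF this]
  have comm: "x - - k + r = x + k + r" for x k r :: real by simp
  show ?thesis
    using asymp_tail_sum_shift[OF tail2' q_nonneg(2) d(2) c \<eta>2, of "- (C + c)"]
      asymp_tail_sum_shift[OF tail2' q_nonneg(2) d(2) c zero_less_one, of "- (C + c)"]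
      asymp_tail_sum_shift[OF tail1' q_nonneg(1) d(1) c zero_less_one, of "- (C + c)"]
      eventually_scale[OF p(1) asymp_tail_sum_shift[OF tail1' q_nonneg(1) d(1) c \<eta>2, of "- K"]]
      small eventually_ge_at_top[of "max 0 Y"]
  proof eventually_elim
    case (elim x)
    let ?s1 = "\<Sum>i. q1 (x + C + c + c * real i)" and ?s2 = "\<Sum>i. q2 (x + C + c + c * real i)"
    have s1: "summable (\<lambda>i. q1 (x + C + c + c * real i))" "\<bar>c * ?s1 - d1 * G x\<bar> \<le> 1 * G x"
      and s2: "summable (\<lambda>i. q2 (x + C + c + c * real i))" "\<bar>c * ?s2 - d2 * G x\<bar> \<le> 1 * G x" "\<bar>c * ?s2 - d2 * G x\<bar> \<le> \<eta> / 2 * G x"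
      and s3: "summable (\<lambda>i. q1 (p * x + K + c * real i))" "\<bar>c * (\<Sum>i. q1 (p * x + K + c * real i)) - d1 * G (p * x)\<bar> \<le> \<eta> / 2 * G (p * x)"
      using elim by (simp_all only: comm add.assoc)
    have x0: "0 \<le> x" "Y \<le> x" using elim by simp_all
    have G: "0 \<le> G x" "G (p * x) \<le> G x"
      using G_pos[of x] mult_right_mono[OF p(2), of x] x0 by (auto intro!: tail_antimono[OF Fs_df])
    define n where "n = nat \<lfloor>(x + C) / D\<rfloor>"
    have n0: "0 \<le> (x + C) / D" using x0 C D by simp
    have n: "real n \<le> (x + C) / D" "(x + C) / D < real (Suc n)" using n0 unfolding n_def by linarith+
    have n': "x + C < real (Suc n) * (b2 - b1 - 2 * e)"
      using n(2) D unfolding D_def[symmetric] by (simp add: pos_divide_less_eq)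
    have "c * ?s1 + c * ?s2 \<le> (d1 + d2 + 2) * G x"
      using s1(2) s2(2) by (simp add: abs_le_iff algebra_simps)
    also have "\<dots> \<le> (d1 + d2 + 2) * (c * \<delta>1 / (d1 + d2 + 2))"
      using elim d by (intro mult_left_mono) auto
    also have "\<dots> = c * \<delta>1" using d by (simp add: add_nonneg_pos divide_simps)
    finally have "c * (?s1 + ?s2) \<le> c * \<delta>1" by (simp only: distrib_left)
    then have small: "?s1 + ?s2 \<le> \<delta>1" using c by simp
    let ?s1' = "\<Sum>i. q1 (x + C + c + c * real (i + n))"
    have main: "(1 - 2 * \<delta>1) * (1 - \<delta>1) * (1 - \<delta>1) * (?s2 + ?s1') \<le> W_tail x"
      unfolding C_def c_def
      by (rule W_tail_ge[OF e L(1) L0(2)[OF L(2)] tL \<delta>1(2) _ x0(1) n'[unfolded C_def] s1(1)[unfolded C_def c_def]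
            s2(1)[unfolded C_def c_def] small[unfolded C_def c_def]])
         (use x0 in \<open>auto intro: Y\<close>)
    have "x + C + c + c * real n \<le> p * x + K"
    proof -
      have "c * real n \<le> c * ((x + C) / D)" using n(1) c by (intro mult_left_mono) auto
      then show ?thesis using c by (simp add: p_def K_def algebra_simps add_divide_distrib)
    qed
    then have "(\<Sum>i. q1 (p * x + K + c * real i)) \<le> ?s1'"
      using summable_ignore_initial_segment[OF s1(1), of n] s3(1)
      by (intro suminf_le q_antimono) (auto simp: algebra_simps)
    then have "c * (\<Sum>i. q1 (p * x + K + c * real i)) \<le> c * ?s1'" using c by (intro mult_left_mono) auto
    moreover have "\<eta> / 2 * G (p * x) \<le> \<eta> / 2 * G x" using G \<eta> by (intro mult_left_mono) auto
    ultimately have "d1 * G (p * x) - \<eta> / 2 * G x \<le> c * ?s1'" using s3(2) by linarith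
    moreover have "d2 * G x - \<eta> / 2 * G x \<le> c * ?s2" using s2(3) by linarith
    ultimately have *: "d2 * G x + d1 * G (p * x) - \<eta> * G x \<le> c * (?s2 + ?s1')"
      by (simp add: algebra_simps)
    have "0 \<le> ?s2" "0 \<le> ?s1'"
      using s2(1) summable_ignore_initial_segment[OF s1(1), of n] by (auto intro!: suminf_nonneg q_nonneg)
    \<comment> \<open>The bracket with \<open>- \<eta> * G x\<close> may be negative, so
      \<open>1 - \<delta>\<close> is exchanged for the larger product only in front of this
      nonnegative sum.\<close>
    then have nn: "0 \<le> c * (?s2 + ?s1')" using c by simp
    have "(1 - \<delta>) * (d2 * G x + d1 * G (p * x) - \<eta> * G x) \<le> (1 - \<delta>) * (c * (?s2 + ?s1'))"
      using * \<delta> by (intro mult_left_mono) auto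
    also have "\<dots> \<le> (1 - 2 * \<delta>1) * (1 - \<delta>1) * (1 - \<delta>1) * (c * (?s2 + ?s1'))"
      using \<delta>1(3) nn by (rule mult_right_mono)
    also have "\<dots> = c * ((1 - 2 * \<delta>1) * (1 - \<delta>1) * (1 - \<delta>1) * (?s2 + ?s1'))"
      by (simp only: ac_simps)
    also have "\<dots> \<le> c * W_tail x" using main c by (intro mult_left_mono) auto
    finally show ?case by (simp add: p_def D_def)
  qed
qed

section \<open>Passage to the exact constants\<close>

definition limit_tail :: "real \<Rightarrow> real" where
  "limit_tail x = d2 / (a - b2) * G x + d1 / (a - b2) * G (x * ((a - b1) / (b2 - b1)))"

text \<open>The deviations from the limit are functions of one parameter \<open>\<epsilon>\<close>:
  the speed is \<open>(1 - \<epsilon>) * A\<close> instead of \<open>A\<close>, and the scale is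
  \<open>p \<epsilon>\<close> instead of \<open>1 + A / D\<close>, which equals
  \<open>(a - b1) / (b2 - b1)\<close>. \<open>\<kappa>\<close> is the constant of
  \<open>G_scale_diff\<close> for these two scales, and \<open>err\<close> adds up what both
  deviations contribute relative to \<open>G x\<close>.\<close>

lemma W_tail_upper:
  assumes \<eta>: "0 < \<eta>"
  shows "eventually (\<lambda>x. W_tail x \<le> limit_tail x + \<eta> * G x) at_top"
proof -
  define A D where "A = a - b2" and "D = b2 - b1"
  have AD: "0 < A" "0 < D" using b by (simp_all add: A_def D_def)
  define p where "p \<epsilon> = 1 + (1 - \<epsilon>) * A * (1 - \<epsilon>) / D" for \<epsilon>
  define \<kappa> where "\<kappa> \<epsilon> = ((1 + A / D) - p \<epsilon>) / (p \<epsilon> - 1)" for \<epsilon>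
  define err where "err \<epsilon> = (d1 + d2) * (1 / ((1 - \<epsilon>) * A) - 1 / A) + d1 * \<kappa> \<epsilon> / ((1 - \<epsilon>) * A)" for \<epsilon>
  have p0: "(p \<longlongrightarrow> 1 + A / D) (at_right 0)"
    unfolding p_def[abs_def] by (rule tendsto_eq_intros refl | use AD in simp)+
  have \<kappa>0: "(\<kappa> \<longlongrightarrow> 0) (at_right 0)"
    unfolding \<kappa>_def[abs_def] by (rule tendsto_eq_intros p0 refl | use AD in simp)+
  have "(err \<longlongrightarrow> 0) (at_right 0)"
    unfolding err_def[abs_def] by (rule tendsto_eq_intros \<kappa>0 refl | use AD in simp)+
  then obtain \<epsilon> where \<epsilon>: "0 < \<epsilon>" "\<epsilon> < 1" "err \<epsilon> < \<eta> / 2"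
    using limit_at_right_0[of err "\<eta> / 2" 1] \<eta> by auto
  define c where "c = (1 - \<epsilon>) * A"
  have err_c: "err \<epsilon> = (d1 + d2) * (1 / c - 1 / A) + d1 * \<kappa> \<epsilon> / c" by (simp only: err_def c_def)
  have c: "0 < c" "c < a - b2" "c < A" using \<epsilon> AD by (auto simp: c_def A_def)
  have "0 < c * (\<eta> / 2)" using c \<eta> by simp
  note up = upper_step[OF c(1,2) \<epsilon>(1,2) this]
  have p_eq: "1 + c * (1 - \<epsilon>) / (b2 - b1) = p \<epsilon>" by (simp add: p_def c_def D_def)
  have p1: "1 < p \<epsilon>" using \<epsilon> AD by (simp add: p_def)
  have p2: "p \<epsilon> \<le> 1 + A / D"
  proof -
    have "(1 - \<epsilon>) * A * (1 - \<epsilon>) \<le> 1 * A * 1" using \<epsilon> AD by (intro mult_mono) auto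
    then show ?thesis using AD by (simp add: p_def divide_right_mono)
  qed
  have \<theta>: "(a - b1) / (b2 - b1) = 1 + A / D" using AD by (simp add: A_def D_def field_simps)
  show ?thesis
    using up G_scale_diff[OF p1 p2] eventually_ge_at_top[of 0]
  proof eventually_elim
    case (elim x)
    let ?g = "G ((1 + A / D) * x)"
    have Gx: "0 < G x" "0 < ?g" by (rule G_pos)+
    have g_le: "?g \<le> G x"
      using elim AD mult_right_mono[of 1 "1 + A / D" x] by (intro tail_antimono[OF Fs_df]) auto
    have "G (p \<epsilon> * x) \<le> ?g + \<kappa> \<epsilon> * G x" using elim(2) by (simp add: \<kappa>_def)
    then have "d1 * G (p \<epsilon> * x) \<le> d1 * (?g + \<kappa> \<epsilon> * G x)" using d by (intro mult_left_mono)
    then have "c * W_tail x \<le> d2 * G x + d1 * (?g + \<kappa> \<epsilon> * G x) + c * (\<eta> / 2) * G x"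
      using elim(1) unfolding p_eq by linarith
    then have "W_tail x \<le> (d2 * G x + d1 * (?g + \<kappa> \<epsilon> * G x) + c * (\<eta> / 2) * G x) / c"
      using c by (simp add: pos_le_divide_eq mult.commute)
    also have "\<dots> = d2 * G x * (1 / c) + d1 * ?g * (1 / c) + d1 * \<kappa> \<epsilon> / c * G x + \<eta> / 2 * G x"
      using c by (simp add: field_simps)
    also have "d2 * G x * (1 / c) = d2 / A * G x + d2 * G x * (1 / c - 1 / A)" by (simp add: algebra_simps)
    also have "d1 * ?g * (1 / c) = d1 / A * ?g + d1 * ?g * (1 / c - 1 / A)" by (simp add: algebra_simps)
    also have "d1 * ?g * (1 / c - 1 / A) \<le> d1 * G x * (1 / c - 1 / A)"
      using d g_le c AD by (intro mult_right_mono mult_left_mono) (auto simp: frac_le)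
    finally have "W_tail x \<le> d2 / A * G x + d1 / A * ?g + err \<epsilon> * G x + \<eta> / 2 * G x"
      unfolding err_c by (simp add: algebra_simps add_divide_distrib)
    moreover have "err \<epsilon> * G x \<le> \<eta> / 2 * G x" using \<epsilon> Gx by (intro mult_right_mono) auto
    moreover have "limit_tail x = d2 / A * G x + d1 / A * ?g"
      by (simp add: limit_tail_def \<theta> mult.commute A_def)
    ultimately show ?case by simp
  qed
qed

text \<open>Here the speed and the scale \<open>p e\<close> lie above their limits. The same
  \<open>e\<close> is both the slack of the slopes and the loss of probability in
  \<open>lower_step\<close>; \<open>e < D / 2\<close> keeps the denominator of \<open>p e\<close>
  positive.\<close>

lemma W_tail_lower:
  assumes \<eta>: "0 < \<eta>"
  shows "eventually (\<lambda>x. limit_tail x - \<eta> * G x \<le> W_tail x) at_top"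
proof -
  define A D where "A = a - b2" and "D = b2 - b1"
  have AD: "0 < A" "0 < D" using b by (simp_all add: A_def D_def)
  define p where "p e = 1 + (A + 2 * e) / (D - 2 * e)" for e
  define \<kappa> where "\<kappa> e = (p e - (1 + A / D)) / ((1 + A / D) - 1)" for e
  define err where "err e = (d1 + d2) * (1 / A - (1 - e) / (A + 2 * e)) + d1 * \<kappa> e / A" for e
  have p0: "(p \<longlongrightarrow> 1 + A / D) (at_right 0)"
    unfolding p_def[abs_def] by (rule tendsto_eq_intros refl | use AD in simp)+
  have \<kappa>0: "(\<kappa> \<longlongrightarrow> 0) (at_right 0)"
    unfolding \<kappa>_def[abs_def] by (rule tendsto_eq_intros p0 refl | use AD in simp)+
  have "(err \<longlongrightarrow> 0) (at_right 0)"
    unfolding err_def[abs_def] by (rule tendsto_eq_intros \<kappa>0 refl | use AD in simp)+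
  then obtain e where e: "0 < e" "e < min 1 (D / 2)" "err e < \<eta> / 2"
    using limit_at_right_0[of err "\<eta> / 2" "min 1 (D / 2)"] \<eta> AD by auto
  define c where "c = A + 2 * e"
  have c: "0 < c" "A \<le> c" using e AD by (auto simp: c_def)
  have \<eta>A: "0 < A * (\<eta> / 2)" using AD \<eta> by simp
  have "2 * e \<le> a - b1" "2 * e < b2 - b1" using e AD by (auto simp: A_def D_def)
  note low = lower_step[OF e(1) this e(1) _ \<eta>A]
  have p_eq: "1 + (a - b2 + 2 * e) / (b2 - b1 - 2 * e) = p e" by (simp add: p_def A_def D_def)
  have p2: "1 + A / D \<le> p e"
    using e AD by (auto simp: p_def intro!: frac_le)
  have p1: "1 < 1 + A / D" using AD by simp
  have \<kappa>_nonneg: "0 \<le> \<kappa> e" using p1 p2 unfolding \<kappa>_def by (intro divide_nonneg_nonneg) auto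
  have \<theta>: "(a - b1) / (b2 - b1) = 1 + A / D" using AD by (simp add: A_def D_def field_simps)
  have e1: "e < 1" using e by simp
  show ?thesis
    using low[OF e1] G_scale_diff[OF p1 p2] eventually_ge_at_top[of 0]
  proof eventually_elim
    case (elim x)
    let ?g = "G ((1 + A / D) * x)"
    have Gx: "0 < G x" "0 < ?g" by (rule G_pos)+
    have g_le: "?g \<le> G x"
      using elim AD mult_right_mono[of 1 "1 + A / D" x] by (intro tail_antimono[OF Fs_df]) auto
    have "?g - \<kappa> e * G x \<le> G (p e * x)" using elim(2) by (simp add: \<kappa>_def)
    then have "d1 * (?g - \<kappa> e * G x) \<le> d1 * G (p e * x)" using d by (intro mult_left_mono)
    then have "(1 - e) * (d2 * G x + d1 * (?g - \<kappa> e * G x) - A * (\<eta> / 2) * G x) \<le>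
        (1 - e) * (d2 * G x + d1 * G (p e * x) - A * (\<eta> / 2) * G x)"
      using e1 by (intro mult_left_mono) auto
    also have "\<dots> \<le> c * W_tail x"
      using elim(1) unfolding p_eq by (simp add: c_def A_def)
    finally have "(1 - e) * (d2 * G x + d1 * (?g - \<kappa> e * G x) - A * (\<eta> / 2) * G x) / c \<le> W_tail x"
      using c by (simp add: pos_divide_le_eq mult.commute)
    moreover define k where "k = (1 - e) / c"
    have k: "0 \<le> k" "k \<le> 1 / A"
    proof -
      show "0 \<le> k" using e1 c by (simp add: k_def)
      have "k \<le> 1 / c" using e c unfolding k_def by (intro divide_right_mono) auto
      also have "\<dots> \<le> 1 / A" using c AD by (intro frac_le) auto
      finally show "k \<le> 1 / A" .
    qed
    ultimately have 1: "k * (d2 * G x + d1 * (?g - \<kappa> e * G x) - A * (\<eta> / 2) * G x) \<le> W_tail x"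
      by (simp add: k_def)
    have "k * (d1 * (\<kappa> e * G x)) \<le> 1 / A * (d1 * (\<kappa> e * G x))"
      using k d \<kappa>_nonneg Gx by (intro mult_right_mono) auto
    moreover have "k * (A * (\<eta> / 2) * G x) \<le> 1 / A * (A * (\<eta> / 2) * G x)"
      using k AD \<eta> Gx by (intro mult_right_mono) auto
    moreover have "(1 / A - k) * (d1 * ?g) \<le> (1 / A - k) * (d1 * G x)"
      using k d g_le by (intro mult_left_mono) auto
    ultimately have "1 / A * (d2 * G x) + 1 / A * (d1 * ?g) - ((1 / A - k) * ((d1 + d2) * G x) + 1 / A * (d1 * (\<kappa> e * G x)) + 1 / A * (A * (\<eta> / 2) * G x)) \<le>
        k * (d2 * G x + d1 * (?g - \<kappa> e * G x) - A * (\<eta> / 2) * G x)"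
      by (simp add: algebra_simps)
    note le = this
    have "d2 / A * G x + d1 / A * ?g - (err e * G x + \<eta> / 2 * G x) \<le> W_tail x"
    proof -
      have A\<eta>: "1 / A * (A * (\<eta> / 2) * G x) = \<eta> / 2 * G x" using AD by simp
      have err_k: "err e = (d1 + d2) * (1 / A - k) + d1 * \<kappa> e / A" by (simp only: err_def c_def k_def)
      show ?thesis using order_trans[OF le 1] unfolding err_k A\<eta> by (simp add: algebra_simps add_divide_distrib)
    qed
    moreover have "err e * G x \<le> \<eta> / 2 * G x" using e Gx by (intro mult_right_mono) auto
    moreover have "limit_tail x = d2 / A * G x + d1 / A * ?g"
      by (simp add: limit_tail_def \<theta> mult.commute A_def)
    ultimately show ?case by simp
  qed
qed

lemma W_tail_asymp: "(\<lambda>x. W_tail x - limit_tail x) \<in> o[at_top](G)"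
proof (rule landau_o.smallI)
  fix \<eta> :: real assume "0 < \<eta>"
  from W_tail_upper[OF this] W_tail_lower[OF this]
  show "eventually (\<lambda>x. norm (W_tail x - limit_tail x) \<le> \<eta> * norm (G x)) at_top"
    by eventually_elim (use G_pos in \<open>auto simp: abs_le_iff less_imp_le\<close>)
qed

end

subsection \<open>Transfer to the sequence space\<close>

text \<open>A finite set of pairs is grouped by the first component. Each group is a cylinder event
  for one sequence, so independence of the sequences factors over the groups, and independence
  within a sequence factors each group.\<close>

lemma (in prob_space) indep_vars_Times:
  fixes V :: "'c \<Rightarrow> 'i \<Rightarrow> 'a \<Rightarrow> 'b" and B :: "'b measure"
  assumes C: "finite C" "C \<noteq> {}"
    and seqs: "indep_vars (\<lambda>_. \<Pi>\<^sub>M i\<in>UNIV. B) (\<lambda>c \<omega> i. V c i \<omega>) C"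
    and indep: "\<And>c. c \<in> C \<Longrightarrow> indep_vars (\<lambda>_. B) (V c) UNIV"
  shows "indep_vars (\<lambda>_. B) (\<lambda>p. V (fst p) (snd p)) (C \<times> UNIV)"
  unfolding indep_vars_def2
proof (intro conjI ballI indep_setsI)
  have rv: "random_variable B (V c i)" if "c \<in> C" for c i
    using indep[OF that] by (auto simp: indep_vars_def2)
  show "random_variable B (V (fst p) (snd p))" if "p \<in> C \<times> UNIV" for p
    using that by (auto intro: rv)
  show "{V (fst p) (snd p) -` A \<inter> space M |A. A \<in> sets B} \<subseteq> events" if "p \<in> C \<times> UNIV" for p
    using that rv by (auto intro: measurable_sets)
  fix A and J :: "('c \<times> 'i) set"
  assume J: "J \<noteq> {}" "J \<subseteq> C \<times> UNIV" "finite J"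
    and "\<forall>j\<in>J. A j \<in> {V (fst j) (snd j) -` A \<inter> space M |A. A \<in> sets B}"
  then have "\<forall>j\<in>J. \<exists>D. D \<in> sets B \<and> A j = V (fst j) (snd j) -` D \<inter> space M" by blast
  then obtain D where D: "\<And>j. j \<in> J \<Longrightarrow> D j \<in> sets B" "\<And>j. j \<in> J \<Longrightarrow> A j = V (fst j) (snd j) -` D j \<inter> space M"
    by metis
  define I where "I c = {i. (c, i) \<in> J}" for c
  have I: "finite (I c)" for c
    using finite_imageI[OF J(3), of snd] by (rule finite_subset[rotated]) (force simp: I_def)
  have J_eq: "J = Sigma C I" using J(2) by (auto simp: I_def)
  define Y where "Y c = {f \<in> space (\<Pi>\<^sub>M i\<in>(UNIV :: 'i set). B). \<forall>i\<in>I c. f i \<in> D (c, i)}" for c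
  have Y: "Y c \<in> sets (\<Pi>\<^sub>M i\<in>UNIV. B)" if "c \<in> C" for c
    unfolding Y_def using I[of c] D(1)
    by (intro sets.sets_Collect_finite_All sets_Collect_single') (auto simp: I_def)
  have sp: "(\<lambda>i. V c i \<omega>) \<in> space (\<Pi>\<^sub>M i\<in>UNIV. B)" if "c \<in> C" "\<omega> \<in> space M" for c \<omega>
    using measurable_space[OF rv[OF that(1)] that(2)] by (auto simp: space_PiM)
  have "(\<Inter>j\<in>J. A j) = (\<Inter>c\<in>C. (\<lambda>\<omega> i. V c i \<omega>) -` Y c \<inter> space M)"
  proof (intro set_eqI iffI INT_I)
    fix \<omega> c assume \<omega>: "\<omega> \<in> (\<Inter>j\<in>J. A j)" and c: "c \<in> C"
    have \<omega>sp: "\<omega> \<in> space M" using \<omega> J(1) D(2) by blast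
    have "V c i \<omega> \<in> D (c, i)" if "i \<in> I c" for i
    proof -
      have j: "(c, i) \<in> J" using that by (simp add: I_def)
      with \<omega> have "\<omega> \<in> A (c, i)" by blast
      then show ?thesis unfolding D(2)[OF j] by simp
    qed
    then show "\<omega> \<in> (\<lambda>\<omega> i. V c i \<omega>) -` Y c \<inter> space M"
      using sp[OF c \<omega>sp] \<omega>sp by (simp add: Y_def)
  next
    fix \<omega> j assume \<omega>: "\<omega> \<in> (\<Inter>c\<in>C. (\<lambda>\<omega> i. V c i \<omega>) -` Y c \<inter> space M)" and j: "j \<in> J"
    have "fst j \<in> C" using j J(2) by auto
    with \<omega> have "(\<lambda>i. V (fst j) i \<omega>) \<in> Y (fst j)" "\<omega> \<in> space M" by blast+
    then show "\<omega> \<in> A j" unfolding D(2)[OF j] using j by (cases j) (simp add: Y_def I_def)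
  qed
  then have "prob (\<Inter>j\<in>J. A j) = (\<Prod>c\<in>C. prob ((\<lambda>\<omega> i. V c i \<omega>) -` Y c \<inter> space M))"
    using indep_varsD[OF seqs C(2,1) order_refl Y] by simp
  also have "\<dots> = (\<Prod>c\<in>C. \<Prod>i\<in>I c. prob (A (c, i)))"
  proof (rule prod.cong[OF refl])
    fix c assume c: "c \<in> C"
    show "prob ((\<lambda>\<omega> i. V c i \<omega>) -` Y c \<inter> space M) = (\<Prod>i\<in>I c. prob (A (c, i)))"
    \<comment> \<open>A sequence without a prescribed index contributes the sure event and an empty
      product, whereas \<open>indep_varsD\<close> asks for a nonempty index set.\<close>
    proof (cases "I c = {}")
      case True
      have "(\<lambda>\<omega> i. V c i \<omega>) -` Y c \<inter> space M = space M" using sp[OF c] True by (auto simp: Y_def)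
      then show ?thesis using True prob_space by simp
    next
      case False
      have "(\<lambda>\<omega> i. V c i \<omega>) -` Y c \<inter> space M = (\<Inter>i\<in>I c. V c i -` D (c, i) \<inter> space M)"
        using sp[OF c] False by (auto simp: Y_def)
      then have "prob ((\<lambda>\<omega> i. V c i \<omega>) -` Y c \<inter> space M) = (\<Prod>i\<in>I c. prob (V c i -` D (c, i) \<inter> space M))"
        using indep_varsD[OF indep[OF c] False I subset_UNIV, of "\<lambda>i. D (c, i)"] D(1) by (simp add: I_def)
      also have "\<dots> = (\<Prod>i\<in>I c. prob (A (c, i)))"
        by (intro prod.cong refl) (simp add: D(2) I_def)
      finally show ?thesis .
    qed
  qed
  also have "\<dots> = (\<Prod>j\<in>J. prob (A j))"
    unfolding J_eq using C I by (subst prod.Sigma) (auto simp: split_beta')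
  finally show "prob (\<Inter>j\<in>J. A j) = (\<Prod>j\<in>J. prob (A j))" .
qed

context tandem_queue
begin

definition V :: "nat \<Rightarrow> int \<Rightarrow> 'w \<Rightarrow> real" where
  "V c n \<omega> = (if c = 0 then \<tau> n \<omega> else \<sigma> c n \<omega>)"

definition X :: "nat \<Rightarrow> 'w \<Rightarrow> real \<times> real \<times> real" where
  "X i \<omega> = (\<sigma> 1 (- int i) \<omega>, \<sigma> 2 (- int i) \<omega>, \<tau> (- int i) \<omega>)"

abbreviation B3 :: "(real \<times> real \<times> real) measure" where
  "B3 \<equiv> borel \<Otimes>\<^sub>M borel \<Otimes>\<^sub>M borel"

definition N :: "(real \<times> real \<times> real) measure" where
  "N = distr M B3 (X 0)"

lemma indep_V: "c \<in> {0, 1, 2} \<Longrightarrow> indep_vars (\<lambda>_. borel) (V c) UNIV"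
  using iid_interarrival iid_service[of c] unfolding iid_with_mean_def V_def[abs_def] by auto

lemma distr_V: "c \<in> {0, 1, 2} \<Longrightarrow> distr M borel (V c n) = distr M borel (V c 0)"
  using iid_interarrival iid_service[of c] unfolding iid_with_mean_def V_def[abs_def] by auto

lemma V_measurable: "c \<in> {0, 1, 2} \<Longrightarrow> random_variable borel (V c n)"
  using indep_V[of c] by (auto simp: indep_vars_def2)

lemma [measurable]:
  shows sigma1_measurable: "random_variable borel (\<sigma> (Suc 0) n)"
    and sigma2_measurable: "random_variable borel (\<sigma> 2 n)"
    and tau_measurable: "random_variable borel (\<tau> n)"
  using V_measurable[of 1 n] V_measurable[of 2 n] V_measurable[of 0 n] by (simp_all add: V_def[abs_def])

lemma X_measurable [measurable]: "random_variable B3 (X i)"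
  unfolding X_def[abs_def] by (simp; measurable)

lemma indep_V_all: "indep_vars (\<lambda>_. borel) (\<lambda>p. V (fst p) (snd p)) ({0, 1, 2} \<times> UNIV)"
  using indep_sequences by (intro indep_vars_Times indep_V) (auto simp: V_def[abs_def])

lemma indep_V_fixed: "indep_vars (\<lambda>_. borel) (\<lambda>c. V c n) {0, 1, 2}"
proof -
  have "indep_vars (\<lambda>_. borel) (\<lambda>j x. (\<lambda>f. f n) ((\<lambda>j \<omega> n. if j = 0 then \<tau> n \<omega> else \<sigma> j n \<omega>) j x)) {0, 1, 2}"
    by (rule indep_vars_compose2[OF indep_sequences]) simp
  then show ?thesis by (simp add: V_def[abs_def])
qed

text \<open>The three marks of customer \<open>-i\<close> are independent, so their joint law is the
  image of a product of marginals, none of which depends on \<open>i\<close>.\<close>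

lemma distr_X: "distr M B3 (X i) = N"
proof -
  define g :: "(nat \<Rightarrow> real) \<Rightarrow> real \<times> real \<times> real" where "g f = (f 1, f 2, f 0)" for f
  have g: "g \<in> (\<Pi>\<^sub>M c\<in>{0, 1, 2}. borel) \<rightarrow>\<^sub>M B3"
    unfolding g_def by (intro measurable_Pair measurable_component_singleton) auto
  have "distr M B3 (X i) = distr (\<Pi>\<^sub>M c\<in>{0, 1, 2}. distr M borel (V c 0)) B3 g" for i
  proof -
    let ?V = "\<lambda>\<omega>. \<lambda>c\<in>{0, 1, 2}. V c (- int i) \<omega>"
    have Vm: "?V \<in> M \<rightarrow>\<^sub>M (\<Pi>\<^sub>M c\<in>{0, 1, 2}. borel)"
      by (intro measurable_restrict V_measurable)
    have "distr M B3 (X i) = distr M B3 (g \<circ> ?V)"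
      by (rule arg_cong[where f="distr M B3"]) (auto simp: fun_eq_iff X_def g_def V_def)
    also have "\<dots> = distr (distr M (\<Pi>\<^sub>M c\<in>{0, 1, 2}. borel) ?V) B3 g"
      by (rule distr_distr[OF g Vm, symmetric])
    also have "distr M (\<Pi>\<^sub>M c\<in>{0, 1, 2}. borel) ?V = (\<Pi>\<^sub>M c\<in>{0, 1, 2}. distr M borel (V c (- int i)))"
      using indep_V_fixed[of "- int i"] V_measurable by (subst (asm) indep_vars_iff_distr_eq_PiM') auto
    also have "\<dots> = (\<Pi>\<^sub>M c\<in>{0, 1, 2}. distr M borel (V c 0))"
      by (intro PiM_cong refl distr_V)
    finally show ?thesis .
  qed
  then show ?thesis by (simp add: N_def)
qed

text \<open>Different customers read disjoint blocks of the independent array.\<close>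

lemma indep_X: "indep_vars (\<lambda>_. B3) X UNIV"
proof -
  let ?K = "\<lambda>i::nat. {0, 1, 2::nat} \<times> {- int i}"
  let ?Y = "\<lambda>i::nat. \<lambda>f::nat \<times> int \<Rightarrow> real. (f (1, - int i), f (2, - int i), f (0, - int i))"
  have "indep_vars (\<lambda>i. \<Pi>\<^sub>M p\<in>?K i. borel) (\<lambda>i \<omega>. \<lambda>p\<in>?K i. V (fst p) (snd p) \<omega>) UNIV"
    using indep_V_all by (rule indep_vars_restrict) (auto simp: disjoint_family_on_def)
  then have "indep_vars (\<lambda>_. B3) (\<lambda>i \<omega>. ?Y i (\<lambda>p\<in>?K i. V (fst p) (snd p) \<omega>)) UNIV"
    by (rule indep_vars_compose2) (intro measurable_Pair measurable_component_singleton, auto)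
  then show ?thesis by (simp add: X_def[abs_def] V_def)
qed

text \<open>The wait of customer \<open>0\<close> at station 2 is determined by the customers
  \<open>-i\<close> with \<open>i >= 0\<close>, so its law can be computed on a one-sided i.i.d.
  sequence.\<close>

lemma distr_X_seq: "distr M (\<Pi>\<^sub>M i\<in>UNIV. N) (\<lambda>\<omega> i. X i \<omega>) = (\<Pi>\<^sub>M i\<in>(UNIV :: nat set). N)"
proof -
  have "distr M (\<Pi>\<^sub>M i\<in>UNIV. N) (\<lambda>\<omega> i. X i \<omega>) = distr M (\<Pi>\<^sub>M i\<in>UNIV. B3) (\<lambda>\<omega>. \<lambda>i\<in>UNIV. X i \<omega>)"
    by (intro distr_cong sets_PiM_cong refl) (simp_all add: N_def restrict_def)
  also have "\<dots> = (\<Pi>\<^sub>M i\<in>UNIV. distr M B3 (X i))"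
    using indep_X by (subst (asm) indep_vars_iff_distr_eq_PiM) auto
  finally show ?thesis by (simp add: distr_X)
qed

text \<open>The truncation at \<open>0\<close> makes nonnegativity hold everywhere and not just almost surely.\<close>

definition s1 :: "real \<times> real \<times> real \<Rightarrow> real" where "s1 z = max 0 (fst z)"
definition s2 :: "real \<times> real \<times> real \<Rightarrow> real" where "s2 z = max 0 (fst (snd z))"
definition t :: "real \<times> real \<times> real \<Rightarrow> real" where "t z = max 0 (snd (snd z))"

lemma s_measurable [measurable]:
  "s1 \<in> borel_measurable B3" "s2 \<in> borel_measurable B3" "t \<in> borel_measurable B3"
  unfolding s1_def[abs_def] s2_def[abs_def] t_def[abs_def] by measurable

lemma s_measurable_N: "s1 \<in> borel_measurable N" "s2 \<in> borel_measurable N" "t \<in> borel_measurable N"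
  unfolding N_def by simp_all

lemma s_X: "s1 (X 0 \<omega>) = max 0 (V 1 0 \<omega>)" "s2 (X 0 \<omega>) = max 0 (V 2 0 \<omega>)" "t (X 0 \<omega>) = max 0 (V 0 0 \<omega>)"
  by (simp_all add: s1_def s2_def t_def X_def V_def)

lemma V_moments:
  "integrable M (\<lambda>\<omega>. max 0 (V c 0 \<omega>))" "integral\<^sup>L M (\<lambda>\<omega>. max 0 (V c 0 \<omega>)) = (if c = 0 then a else b c)"
  if "c \<in> {0, 1, 2}"
proof -
  have int: "integrable M (V c 0)" "integral\<^sup>L M (V c 0) = (if c = 0 then a else b c)"
    using that iid_interarrival iid_service[of c] unfolding iid_with_mean_def V_def[abs_def] by auto
  have "AE \<omega> in M. 0 \<le> V c 0 \<omega>"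
    using that nonneg_interarrival nonneg_service[of c] unfolding V_def by auto
  then have AE: "AE \<omega> in M. max 0 (V c 0 \<omega>) = V c 0 \<omega>" by eventually_elim simp
  show "integrable M (\<lambda>\<omega>. max 0 (V c 0 \<omega>))" using int by (intro integrable_max) auto
  show "integral\<^sup>L M (\<lambda>\<omega>. max 0 (V c 0 \<omega>)) = (if c = 0 then a else b c)"
    unfolding int(2)[symmetric] using V_measurable[OF that] by (intro integral_cong_AE AE) auto
qed

lemma prob_N: "Measurable.pred B3 Q \<Longrightarrow> \<P>(z in N. Q z) = \<P>(\<omega> in M. Q (X 0 \<omega>))"
  unfolding N_def by (subst measure_distr) (auto intro!: arg_cong[where f=prob] simp: space_pair_measure pred_def)

lemma indep_12: "indep_var borel (\<lambda>\<omega>. s1 (X 0 \<omega>)) borel (\<lambda>\<omega>. s2 (X 0 \<omega>))"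
proof -
  have "indep_var (\<Pi>\<^sub>M c\<in>{1}. borel) (\<lambda>\<omega>. \<lambda>c\<in>{1}. V c 0 \<omega>) (\<Pi>\<^sub>M c\<in>{2}. borel) (\<lambda>\<omega>. \<lambda>c\<in>{2}. V c 0 \<omega>)"
    by (rule indep_var_restrict[OF indep_V_fixed]) auto
  then have "indep_var borel ((\<lambda>f. max 0 (f 1)) \<circ> (\<lambda>\<omega>. \<lambda>c\<in>{1}. V c 0 \<omega>)) borel ((\<lambda>f. max 0 (f 2)) \<circ> (\<lambda>\<omega>. \<lambda>c\<in>{2}. V c 0 \<omega>))"
    by (rule indep_var_compose) (auto intro!: borel_measurable_max measurable_component_singleton)
  then show ?thesis by (simp add: s_X comp_def)
qed

lemma distr_12:
  "distr M borel (\<lambda>\<omega>. s1 (X 0 \<omega>)) \<Otimes>\<^sub>M distr M borel (\<lambda>\<omega>. s2 (X 0 \<omega>)) =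
    distr M (borel \<Otimes>\<^sub>M borel) (\<lambda>\<omega>. (s1 (X 0 \<omega>), s2 (X 0 \<omega>)))"
  using indep_12[unfolded indep_var_distribution_eq] by simp

lemma indep_3:
  assumes A: "A \<in> sets (borel \<Otimes>\<^sub>M borel)"
  shows "\<P>(\<omega> in M. (s1 (X 0 \<omega>), s2 (X 0 \<omega>)) \<in> A \<and> t (X 0 \<omega>) \<le> L) =
    \<P>(\<omega> in M. (s1 (X 0 \<omega>), s2 (X 0 \<omega>)) \<in> A) * \<P>(\<omega> in M. t (X 0 \<omega>) \<le> L)"
proof -
  let ?P = "\<lambda>I::nat set. \<Pi>\<^sub>M c\<in>I. (borel :: real measure)" and ?V = "\<lambda>I \<omega>. \<lambda>c\<in>I. V c 0 \<omega>"
  have ind: "indep_var (?P {1, 2}) (?V {1, 2}) (?P {0}) (?V {0})"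
    by (rule indep_var_restrict[OF indep_V_fixed]) auto
  have m: "(\<lambda>f. (max 0 (f 1), max 0 (f 2))) \<in> ?P {1, 2} \<rightarrow>\<^sub>M borel \<Otimes>\<^sub>M borel"
    by (intro measurable_Pair borel_measurable_max measurable_component_singleton) auto
  have m0: "(\<lambda>f. max 0 (f 0)) \<in> ?P {0} \<rightarrow>\<^sub>M borel"
    by (intro borel_measurable_max measurable_component_singleton) auto
  have vsp: "?V I \<omega> \<in> space (?P I)" for I \<omega>
    by (simp add: space_PiM)
  let ?A = "(\<lambda>f. (max 0 (f 1), max 0 (f 2))) -` A \<inter> space (?P {1, 2})" and ?B = "(\<lambda>f. max 0 (f 0)) -` {..L} \<inter> space (?P {0})"
  have "prob ((\<lambda>\<omega>. (?V {1, 2} \<omega>, ?V {0} \<omega>)) -` (?A \<times> ?B) \<inter> space M) = prob (?V {1, 2} -` ?A \<inter> space M) * prob (?V {0} -` ?B \<inter> space M)"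
    using ind measurable_sets[OF m A] measurable_sets[OF m0, of "{..L}"] by (intro indep_varD) auto
  moreover have "(\<lambda>\<omega>. (?V {1, 2} \<omega>, ?V {0} \<omega>)) -` (?A \<times> ?B) \<inter> space M = {\<omega>\<in>space M. (s1 (X 0 \<omega>), s2 (X 0 \<omega>)) \<in> A \<and> t (X 0 \<omega>) \<le> L}"
    "?V {1, 2} -` ?A \<inter> space M = {\<omega>\<in>space M. (s1 (X 0 \<omega>), s2 (X 0 \<omega>)) \<in> A}"
    "?V {0} -` ?B \<inter> space M = {\<omega>\<in>space M. t (X 0 \<omega>) \<le> L}"
    by (auto simp: s_X vsp)
  ultimately show ?thesis by (simp only:)
qed

lemma iid_tandem_N:
  assumes F: "subexponential F" "subexponential (integrated_tail_df F)"
    and tails: "\<And>i n. i \<in> {1, 2} \<Longrightarrow> asymp_proportional (\<lambda>x. measure M {\<omega> \<in> space M. \<sigma> i n \<omega> > x}) (d i) (tail F)"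
    and d: "0 \<le> d 1" "0 \<le> d 2" and b: "b 1 < b 2" "b 2 < a"
  shows "iid_tandem N F s1 s2 t (b 1) (b 2) a (d 1) (d 2)"
proof -
  interpret N: prob_space N unfolding N_def by (rule prob_space_distr) measurable
  interpret subexponential_pair F using F by unfold_locales
  interpret sequence_space N by unfold_locales
  have X0: "X 0 \<in> M \<rightarrow>\<^sub>M B3" by measurable
  \<comment> \<open>Truncating at \<open>0\<close> leaves the tail at levels \<open>x >= 0\<close>
    unchanged, which is all that \<open>asymp_tail\<close> sees.\<close>
  have tail_eq: "eventually (\<lambda>x. \<P>(\<omega> in M. x < max 0 (V c 0 \<omega>)) = \<P>(\<omega> in M. \<sigma> c 0 \<omega> > x)) at_top" if "c \<in> {1, 2}" for c
    using eventually_ge_at_top[of 0]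
    by eventually_elim (use that in \<open>auto intro!: arg_cong[where f="measure M"] simp: V_def\<close>)
  have at: "asymp_tail (\<lambda>x. \<P>(\<omega> in M. x < max 0 (V c 0 \<omega>))) (d c)" if "c \<in> {1, 2}" for c
  proof -
    have "asymp_tail (\<lambda>x. \<P>(\<omega> in M. \<sigma> c 0 \<omega> > x)) (d c)"
      by (rule asymp_proportional_imp_asymp_tail[OF tails[OF that]])
    then show ?thesis
      unfolding asymp_tail_def
    proof (intro allI impI)
      fix e :: real assume *: "\<forall>e>0. \<forall>\<^sub>F x in at_top. \<bar>\<P>(\<omega> in M. \<sigma> c 0 \<omega> > x) - d c * Fb x\<bar> \<le> e * Fb x" "0 < e"
      then have "\<forall>\<^sub>F x in at_top. \<bar>\<P>(\<omega> in M. \<sigma> c 0 \<omega> > x) - d c * Fb x\<bar> \<le> e * Fb x" by blast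
      with tail_eq[OF that] show "\<forall>\<^sub>F x in at_top. \<bar>\<P>(\<omega> in M. x < max 0 (V c 0 \<omega>)) - d c * Fb x\<bar> \<le> e * Fb x"
        by eventually_elim simp
    qed
  qed
  show ?thesis
  proof
    show "0 \<le> s1 z" "0 \<le> s2 z" "0 \<le> t z" for z by (simp_all add: s1_def s2_def t_def)
    show "integrable N s1" "integrable N s2" "integrable N t"
      unfolding N_def using V_moments(1)[of 1] V_moments(1)[of 2] V_moments(1)[of 0]
      by (simp_all add: integrable_distr_eq[OF X0] s_X)
    show "integral\<^sup>L N s1 = b 1" "integral\<^sup>L N s2 = b 2" "integral\<^sup>L N t = a"
      unfolding N_def using V_moments(2)[of 1] V_moments(2)[of 2] V_moments(2)[of 0]
      by (simp_all add: integral_distr[OF X0] s_X)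
    show "N.indep_var borel s1 borel s2"
    proof -
      from distr_12 show ?thesis
        unfolding N.indep_var_distribution_eq
        using s_measurable_N by (simp add: N_def distr_distr comp_def)
    qed
    show "\<P>(z in N. (s1 z, s2 z) \<in> A \<and> t z \<le> L) = \<P>(z in N. (s1 z, s2 z) \<in> A) * \<P>(z in N. t z \<le> L)"
      if A: "A \<in> sets (borel \<Otimes>\<^sub>M borel)" for A L
    proof -
      note [measurable] = A
      show ?thesis using indep_3[OF A, of L] by (simp add: prob_N)
    qed
    show "asymp_tail (\<lambda>x. \<P>(z in N. x < s1 z)) (d 1)" "asymp_tail (\<lambda>x. \<P>(z in N. x < s2 z)) (d 2)"
      using at[of 1] at[of 2] by (simp_all add: prob_N s_X)
    show "0 \<le> d 1" "0 \<le> d 2" "b 1 < b 2" "b 2 < a" by fact+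
  qed
qed

lemma prob_waiting2:
  assumes "iid_tandem N F s1 s2 t b1 b2 a d1 d2"
  shows "\<P>(\<omega> in M. ereal x < waiting2 \<tau> \<sigma> \<omega>) = iid_tandem.W_tail N s1 s2 t x"
proof -
  interpret T: iid_tandem N F s1 s2 t b1 b2 a d1 d2 by fact
  let ?S = "\<Pi>\<^sub>M i\<in>(UNIV :: nat set). N"
  have Xm: "(\<lambda>\<omega> i. X i \<omega>) \<in> M \<rightarrow>\<^sub>M ?S"
  proof -
    have "(\<lambda>\<omega>. \<lambda>i\<in>UNIV. X i \<omega>) \<in> M \<rightarrow>\<^sub>M ?S"
      by (rule measurable_restrict) (simp add: N_def)
    then show ?thesis by (simp add: restrict_def)
  qed
  have "T.W_tail x = measure (distr M ?S (\<lambda>\<omega> i. X i \<omega>)) {\<omega>\<in>space ?S. ereal x < T.W \<omega>}"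
    unfolding T.W_tail_def by (simp only: distr_X_seq)
  also have "\<dots> = \<P>(\<omega> in M. ereal x < T.W (\<lambda>i. X i \<omega>))"
    using measurable_space[OF Xm] by (subst measure_distr[OF Xm]) (auto intro!: arg_cong[where f=prob])
  also have "\<dots> = \<P>(\<omega> in M. ereal x < waiting2 \<tau> \<sigma> \<omega>)"
  proof (rule finite_measure_eq_AE)
    \<comment> \<open>Almost surely all marks are nonnegative at once, and then the truncation in
      \<open>s1\<close>, \<open>s2\<close> and \<open>t\<close> changes nothing.\<close>
    have "AE \<omega> in M. \<forall>n. 0 \<le> \<tau> n \<omega>" "AE \<omega> in M. \<forall>n. 0 \<le> \<sigma> 1 n \<omega>" "AE \<omega> in M. \<forall>n. 0 \<le> \<sigma> 2 n \<omega>"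
      unfolding AE_all_countable using nonneg_interarrival nonneg_service by auto
    then show "AE \<omega> in M. \<omega> \<in> {\<omega>\<in>space M. ereal x < T.W (\<lambda>i. X i \<omega>)} \<longleftrightarrow> \<omega> \<in> {\<omega>\<in>space M. ereal x < waiting2 \<tau> \<sigma> \<omega>}"
      by eventually_elim (simp add: T.W_def waiting2_eq_queue2_wait X_def s1_def s2_def t_def)
    show "{\<omega>\<in>space M. ereal x < T.W (\<lambda>i. X i \<omega>)} \<in> events"
      using measurable_compose[OF Xm T.W_measurable] by measurable
    show "{\<omega>\<in>space M. ereal x < waiting2 \<tau> \<sigma> \<omega>} \<in> events"
      unfolding waiting2_def interarrival2_def waiting1_def One_nat_def by measurable
  qed
  finally show ?thesis ..
qed

end

theorem theorem12:
  fixes M :: "'w measure"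
    and \<tau> :: "int \<Rightarrow> 'w \<Rightarrow> real"
    and \<sigma> :: "nat \<Rightarrow> int \<Rightarrow> 'w \<Rightarrow> real"
    and a :: real
    and b d :: "nat \<Rightarrow> real"
    and F :: "real \<Rightarrow> real"
  defines "Fs \<equiv> integrated_tail_df F"
    and "P \<equiv> (\<lambda>x. measure M {\<omega> \<in> space M. waiting2 \<tau> \<sigma> \<omega> > ereal x})"
    and "R \<equiv> (\<lambda>x. d 2 / (a - b 2) * tail (integrated_tail_df F) x
              + d 1 / (a - b 2) * tail (integrated_tail_df F) (x * ((a - b 1) / (b 2 - b 1))))"
  assumes queue: "tandem_queue M \<tau> \<sigma> a b"
    and stable: "max (b 1) (b 2) < a"
    and F_df: "nonneg_distribution_function F"
    and F_mean: "integrable (interval_measure F) (\<lambda>x. x)"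
    and F_subexp: "subexponential F"
    and Fs_subexp: "subexponential Fs"
    and d_nonneg: "d 1 \<ge> 0" "d 2 \<ge> 0"
    and d_pos: "d 1 + d 2 > 0"
    and service_tails: "\<And>i n. i \<in> {1, 2} \<Longrightarrow>
          asymp_proportional (\<lambda>x. measure M {\<omega> \<in> space M. \<sigma> i n \<omega> > x}) (d i) (tail F)"
    and b_less: "b 1 < b 2"
  shows "(\<lambda>x. P x - R x) \<in> o[at_top](tail Fs) \<and>
         (d 2 > 0 \<or>
          (d 2 = 0 \<and> d 1 > 0 \<and> Liminf at_top (\<lambda>x. ereal (tail Fs (2 * x) / tail Fs x)) > 0)
          \<longrightarrow> P \<sim>[at_top] R)"
proof -
  interpret Q: tandem_queue M \<tau> \<sigma> a b by (rule queue)
  have b2: "b 2 < a" using stable by simp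
  have T: "iid_tandem Q.N F Q.s1 Q.s2 Q.t (b 1) (b 2) a (d 1) (d 2)"
    using Q.iid_tandem_N[OF F_subexp Fs_subexp[unfolded Fs_def] service_tails d_nonneg b_less b2] .
  interpret T: iid_tandem Q.N F Q.s1 Q.s2 Q.t "b 1" "b 2" a "d 1" "d 2" by (rule T)
  have P: "P = T.W_tail" using Q.prob_waiting2[OF T] by (simp add: P_def fun_eq_iff)
  have R: "R = T.limit_tail" by (rule ext) (simp only: R_def T.limit_tail_def)
  have main: "(\<lambda>x. P x - R x) \<in> o[at_top](T.G)"
    unfolding P R by (rule T.W_tail_asymp)
  have "P \<sim>[at_top] R" if "d 2 > 0 \<or>
      (d 2 = 0 \<and> d 1 > 0 \<and> Liminf at_top (\<lambda>x. ereal (tail Fs (2 * x) / tail Fs x)) > 0)"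
  proof -
    \<comment> \<open>Then the error of order \<open>o(G)\<close> is also \<open>o(R)\<close>, which
      gives the equivalence. In case (i) the first summand of \<open>R\<close> is already a positive
      multiple of \<open>G\<close>; in case (ii) the liminf condition bounds \<open>G\<close> by its
      value at the rescaled argument.\<close>
    have "T.G \<in> O[at_top](R)"
      using that
    proof
      assume d2: "d 2 > 0"
      show ?thesis
      proof (rule bigoI[where c="(a - b 2) / d 2"], intro always_eventually allI)
        fix x
        have "0 \<le> d 1 / (a - b 2) * T.G (x * ((a - b 1) / (b 2 - b 1)))"
          using d_nonneg b2 T.G_pos by (intro mult_nonneg_nonneg divide_nonneg_nonneg) (auto simp: less_imp_le)
        then have "d 2 / (a - b 2) * T.G x \<le> \<bar>R x\<bar>"
          unfolding R_def by linarith
        then have "(a - b 2) / d 2 * (d 2 / (a - b 2) * T.G x) \<le> (a - b 2) / d 2 * \<bar>R x\<bar>"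
          using d2 b2 by (intro mult_left_mono) auto
        then show "norm (T.G x) \<le> (a - b 2) / d 2 * norm (R x)"
          using d2 b2 T.G_pos[of x] by simp
      qed
    next
      assume *: "d 2 = 0 \<and> d 1 > 0 \<and> Liminf at_top (\<lambda>x. ereal (tail Fs (2 * x) / tail Fs x)) > 0"
      then have "T.G \<in> O[at_top](\<lambda>x. T.G (x * ((a - b 1) / (b 2 - b 1))))"
        using b_less b2 by (intro T.G_bigo_scale) (auto simp: Fs_def)
      then show ?thesis using * b2 by (simp add: R_def)
    qed
    then have "(\<lambda>x. P x - R x) \<in> o[at_top](R)"
      using main by (rule landau_o.small_big_trans[rotated])
    then show ?thesis by (rule smallo_imp_asymp_equiv)
  qed
  with main show ?thesis by (simp add: Fs_def)
qed

end
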